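(* Suppose Algorithm SPG (described in the context) is run without termination, with $\mathcal{O}(z^{(0)})<\theta$, $\tau_1\tau_3\ge1$, and $$\mu^{(0)}L^{(0)}\ge\max\left\{6\lambda_2N_1N_0+\frac{2}{\eta}\left(N_2L_{\widetilde{\mathcal{H}}}+\lambda_1N_1N\right),\ 8\lambda_2+L_{\nabla\widetilde{\mathcal{H}}}\right\}.$$ Let $\mathcal{K}=\{k\ge0:\mu^{(k+1)}=\tau_1\mu^{(k)}\}$. Then $\{z^{(k)}:k\in\mathcal{K}\}$ is bounded, and any accumulation point $z^*$ of $\{z^{(k)}:k\in\mathcal{K}\}$ is a generalized d-stationary point of problem (LRP). Moreover, if $\mathcal{O}$ is regular at $z^*$, then $z^*$ is a d-stationary point of (LRP).
   Context: Let $N,N_0,N_1$ be positive integers, $X=(x_1,\ldots,x_N)\in\mathbb{R}^{N_0\times N}$ a given data matrix, and $\lambda_1,\lambda_2,\beta>0$ given parameters. For a real vector $y$, $(y)_+=\max\{y,0\}$ componentwise; $e$ denotes the all-ones vector of $\mathbb{R}^{N_1}$. For a matrix $Y$, $\|Y\|_F$ is the Frobenius norm and $\|Y\|_1$ the maximum absolute column sum. The variable is $z=(\mathrm{vec}(W)^\top,b^\top,\mathrm{vec}(V)^\top)^\top\in\mathbb{R}^{N_2}$, $N_2=N_0N_1+N_1+N_0+N_1N$, where $W\in\mathbb{R}^{N_1\times N_0}$, $b=(b_1^\top,b_2^\top)^\top$ with $b_1\in\mathbb{R}^{N_1}$, $b_2\in\mathbb{R}^{N_0}$, $V=(v_1,\ldots,v_N)\in\mathbb{R}^{N_1\times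 N}$, and vec is columnwise vectorization. Define $\mathcal{F}(z)=\frac1N\sum_{n=1}^N\|(W^\top v_n+b_2)_+-x_n\|_2^2$, $\mathcal{R}(z)=\lambda_1\sum_{n=1}^N e^\top v_n+\lambda_2\|W\|_F^2$, $\mathcal{P}(z)=\beta\sum_{n=1}^N e^\top(v_n-(Wx_n+b_1)_+)$, $\mathcal{O}=\mathcal{F}+\mathcal{R}+\mathcal{P}$. Let $\Omega_2=\{z: v_n\ge (Wx_n+b_1)_+,\ n=1,\ldots,N\}$. Fix $\theta>\frac1N\|X\|_F^2$ and set $\alpha=\max\left\{\frac{\theta}{\lambda_1}+\sqrt{\frac{N_1N_0\theta}{\lambda_2}}\|X\|_1,\ \frac{\theta\sqrt{N_1N_0\theta}}{\lambda_1\sqrt{\lambda_2}}+\sqrt{N\theta}+\|X\|_1\right\}$, $\eta=\max\{\sqrt{N_1N_0\theta/\lambda_2},\ \theta/\lambda_1\}$. Let $\Omega_3=\{z:\|b\|_\infty\le\alpha\}$, $\mathcal{Z}=\Omega_2\cap\Omega_3$, $\Omega_\theta=\{z\in\Omega_2:\mathcal{O}(z)\le\theta\}$. Problem (LRP) is: minimize $\mathcal{O}(z)$ subject to $z\in\mathcal{Z}$. For locally Lipschitz $f$: $f'(\bar y;d)=\lim_{t\downarrow0}(f(\bar y+td)-f(\bar y))/t$; $f^\circ(\bar y;d)=\limsup_{y\to\bar y,t\downarrow0}(f(y+td)-f(y))/t$; $f$ is regular at $\bar y$ if $f'(\bar y;d)$ exists and equals $f^\circ(\bar y;d)$ for all $d$.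 The tangent cone of $\mathcal{Z}$ at $\bar z$ is $\mathcal{T}_{\mathcal{Z}}(\bar z)=\{d: d=\lim(z-\bar z)/\tau,\ z\in\mathcal{Z},\ z\to\bar z,\ \tau\downarrow0\}$. A point $\bar z\in\mathcal{Z}$ is a d-stationary point of (LRP) if $\mathcal{O}'(\bar z;d)\ge0$ for all $d\in\mathcal{T}_{\mathcal{Z}}(\bar z)$, and a generalized d-stationary point if $\mathcal{O}^\circ(\bar z;d)\ge0$ for all $d\in\mathcal{T}_{\mathcal{Z}}(\bar z)$. Smoothing: for $y\in\mathbb{R}^m$, $\mu>0$, $\widetilde\sigma(y,\mu)\in\mathbb{R}^m$ has components $\widetilde\sigma_i(y,\mu)=0$ if $y_i<0$, $y_i^2/(2\mu)$ if $0\le y_i\le\mu$, $y_i-\mu/2$ if $y_i>\mu$. Define $\widetilde{\mathcal{F}}(z,\mu)=\frac1N\sum_{n=1}^N\|(W^\top v_n+b_2)_+\|_2^2+\frac1N\|X\|_F^2-\frac2N\sum_{n=1}^Nx_n^\top\widetilde\sigma(W^\top v_n+b_2,\mu)$, $\widetilde{\mathcal{P}}(z,\mu)=\beta\sum_{n=1}^Ne^\top(v_n-\widetilde\sigma(Wx_n+b_1,\mu))$, $\widetilde{\mathcal{H}}=\widetilde{\mathcal{F}}+\widetilde{\mathcal{P}}$, $\widetilde{\mathcal{O}}(z,\mu)=\widetilde{\mathcal{H}}(z,\mu)+\mathcal{R}(z)$. Let $L_{\widetilde{\mathcal{H}}}$ be a Lipschitz constant of $(z,\mu)\mapsto\mu\widetilde{\mathcal{H}}(z,\mu)$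 over $(\Omega_\theta\cap\mathcal{Z})\times(0,1)$, and $L_{\nabla\widetilde{\mathcal{H}}}$ a Lipschitz constant of $(z,\mu)\mapsto\mu\nabla_z\widetilde{\mathcal{H}}(z,\mu)$ over $\{z:\|z\|_\infty\le\max\{\alpha,2\eta\}\}\times(0,1)$. Algorithm SPG: choose $z^{(0)}\in\mathcal{Z}$, $0<\mu^{(0)}<1$, $0<\tau_1<1$, $\tau_2>0$, $\tau_3\ge1$, $L^{(0)}\ge1$. For $k=0,1,2,\ldots$: let $z^{(k+1)}$ be the unique minimizer over $z\in\mathcal{Z}$ of $\langle\nabla_z\widetilde{\mathcal{H}}(z^{(k)},\mu^{(k)}),z-z^{(k)}\rangle+\mathcal{R}(z)+\frac{L^{(k)}}2\|z-z^{(k)}\|_2^2$; then set $(\mu^{(k+1)},L^{(k+1)})=(\mu^{(k)},L^{(k)})$ if $\widetilde{\mathcal{O}}(z^{(k+1)},\mu^{(k)})-\widetilde{\mathcal{O}}(z^{(k)},\mu^{(k)})<-\tau_2\mu^{(k)}/L^{(k)}$, and $(\mu^{(k+1)},L^{(k+1)})=(\tau_1\mu^{(k)},\tau_3L^{(k)})$ otherwise. *)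

theory Defs
  imports "HOL-Analysis.Analysis" "HOL-Library.Liminf_Limsup"
begin

text \<open>Variable z = (W, (b1, b2), V).  W :: real^'n0^'n1 is the N1 x N0 matrix (rows indexed
by 'n1), b1 :: real^'n1, b2 :: real^'n0, and V :: real^'n1^'N stores the columns v_n as V $ n.
The data matrix X is given by its columns x :: 'N => real^'n0.  N = CARD('N), N0 = CARD('n0),
N1 = CARD('n1).  The Euclidean norm on this product type is the 2-norm of z
(norm of real^'a^'b is the Frobenius norm).\<close>

type_synonym ('n0,'n1,'N) pt = "(real^'n0^'n1) \<times> ((real^'n1) \<times> (real^'n0)) \<times> (real^'n1^'N)"

definition relu :: "real^'n \<Rightarrow> real^'n" where
  "relu y = (\<chi> i. max (y $ i) 0)"

definition sig1 :: "real \<Rightarrow> real \<Rightarrow> real" where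
  "sig1 \<mu> t = (if t < 0 then 0 else if t \<le> \<mu> then t\<^sup>2 / (2 * \<mu>) else t - \<mu> / 2)"

definition sigv :: "real^'n \<Rightarrow> real \<Rightarrow> real^'n" where
  "sigv y \<mu> = (\<chi> i. sig1 \<mu> (y $ i))"

definition esum :: "real^'n \<Rightarrow> real" where
  "esum y = (\<Sum>i\<in>UNIV. y $ i)"

definition frob2 :: "('N::finite \<Rightarrow> real^'n0) \<Rightarrow> real" where
  "frob2 x = (\<Sum>n\<in>UNIV. (norm (x n))\<^sup>2)"

definition norm1 :: "('N::finite \<Rightarrow> real^'n0) \<Rightarrow> real" where
  "norm1 x = Max (range (\<lambda>n. \<Sum>i\<in>UNIV. \<bar>x n $ i\<bar>))"

definition Fobj :: "('N::finite \<Rightarrow> real^'n0::finite) \<Rightarrow> ('n0,'n1::finite,'N) pt \<Rightarrow> real" where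
  "Fobj x z = (case z of (W, (b1, b2), V) \<Rightarrow>
     (1 / real CARD('N)) * (\<Sum>n\<in>UNIV. (norm (relu (transpose W *v (V $ n) + b2) - x n))\<^sup>2))"

definition Robj :: "real \<Rightarrow> real \<Rightarrow> ('n0::finite,'n1::finite,'N::finite) pt \<Rightarrow> real" where
  "Robj lam1 lam2 z = (case z of (W, (b1, b2), V) \<Rightarrow>
     lam1 * (\<Sum>n\<in>UNIV. esum (V $ n)) + lam2 * (norm W)\<^sup>2)"

definition Pobj :: "('N::finite \<Rightarrow> real^'n0::finite) \<Rightarrow> real \<Rightarrow> ('n0,'n1::finite,'N) pt \<Rightarrow> real" where
  "Pobj x \<beta> z = (case z of (W, (b1, b2), V) \<Rightarrow>
     \<beta> * (\<Sum>n\<in>UNIV. esum (V $ n - relu (W *v x n + b1))))"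

definition Oobj :: "('N::finite \<Rightarrow> real^'n0::finite) \<Rightarrow> real \<Rightarrow> real \<Rightarrow> real \<Rightarrow> ('n0,'n1::finite,'N) pt \<Rightarrow> real" where
  "Oobj x lam1 lam2 \<beta> z = Fobj x z + Robj lam1 lam2 z + Pobj x \<beta> z"

definition Omega2 :: "('N::finite \<Rightarrow> real^'n0::finite) \<Rightarrow> ('n0,'n1::finite,'N) pt set" where
  "Omega2 x = {z. case z of (W, (b1, b2), V) \<Rightarrow> (\<forall>n i. relu (W *v x n + b1) $ i \<le> V $ n $ i)}"

definition Omega3 :: "real \<Rightarrow> ('n0::finite,'n1::finite,'N::finite) pt set" where
  "Omega3 \<alpha> = {z. infnorm (fst (snd z)) \<le> \<alpha>}"

definition Zset :: "('N::finite \<Rightarrow> real^'n0::finite) \<Rightarrow> real \<Rightarrow> ('n0,'n1::finite,'N) pt set" where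
  "Zset x \<alpha> = Omega2 x \<inter> Omega3 \<alpha>"

definition OmegaTheta :: "('N::finite \<Rightarrow> real^'n0::finite) \<Rightarrow> real \<Rightarrow> real \<Rightarrow> real \<Rightarrow> real
     \<Rightarrow> ('n0,'n1::finite,'N) pt set" where
  "OmegaTheta x lam1 lam2 \<beta> \<theta> = {z \<in> Omega2 x. Oobj x lam1 lam2 \<beta> z \<le> \<theta>}"

definition alpha_c :: "nat \<Rightarrow> nat \<Rightarrow> nat \<Rightarrow> real \<Rightarrow> real \<Rightarrow> real \<Rightarrow> real \<Rightarrow> real" where
  "alpha_c nn n0 n1 lam1 lam2 \<theta> X1 =
     max (\<theta> / lam1 + sqrt (real n1 * real n0 * \<theta> / lam2) * X1)
         (\<theta> * sqrt (real n1 * real n0 * \<theta>) / (lam1 * sqrt lam2) + sqrt (real nn * \<theta>) + X1)"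

definition eta_c :: "nat \<Rightarrow> nat \<Rightarrow> real \<Rightarrow> real \<Rightarrow> real \<Rightarrow> real" where
  "eta_c n0 n1 lam1 lam2 \<theta> = max (sqrt (real n1 * real n0 * \<theta> / lam2)) (\<theta> / lam1)"

definition Ftil :: "('N::finite \<Rightarrow> real^'n0::finite) \<Rightarrow> ('n0,'n1::finite,'N) pt \<Rightarrow> real \<Rightarrow> real" where
  "Ftil x z \<mu> = (case z of (W, (b1, b2), V) \<Rightarrow>
     (1 / real CARD('N)) * (\<Sum>n\<in>UNIV. (norm (relu (transpose W *v (V $ n) + b2)))\<^sup>2)
     + (1 / real CARD('N)) * frob2 x
     - (2 / real CARD('N)) * (\<Sum>n\<in>UNIV. x n \<bullet> sigv (transpose W *v (V $ n) + b2) \<mu>))"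

definition Ptil :: "('N::finite \<Rightarrow> real^'n0::finite) \<Rightarrow> real \<Rightarrow> ('n0,'n1::finite,'N) pt \<Rightarrow> real \<Rightarrow> real" where
  "Ptil x \<beta> z \<mu> = (case z of (W, (b1, b2), V) \<Rightarrow>
     \<beta> * (\<Sum>n\<in>UNIV. esum (V $ n - sigv (W *v x n + b1) \<mu>)))"

definition Htil :: "('N::finite \<Rightarrow> real^'n0::finite) \<Rightarrow> real \<Rightarrow> ('n0,'n1::finite,'N) pt \<Rightarrow> real \<Rightarrow> real" where
  "Htil x \<beta> z \<mu> = Ftil x z \<mu> + Ptil x \<beta> z \<mu>"

definition Otil :: "('N::finite \<Rightarrow> real^'n0::finite) \<Rightarrow> real \<Rightarrow> real \<Rightarrow> real \<Rightarrow> ('n0,'n1::finite,'N) pt \<Rightarrow> real \<Rightarrow> real" where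
  "Otil x lam1 lam2 \<beta> z \<mu> = Htil x \<beta> z \<mu> + Robj lam1 lam2 z"

text \<open>Gradient with respect to z (the function is C^1 in z).\<close>
definition gradHtil :: "('N::finite \<Rightarrow> real^'n0::finite) \<Rightarrow> real \<Rightarrow> ('n0,'n1::finite,'N) pt \<Rightarrow> real
     \<Rightarrow> ('n0,'n1,'N) pt" where
  "gradHtil x \<beta> z \<mu> = (SOME g. GDERIV (\<lambda>w. Htil x \<beta> w \<mu>) z :> g)"

definition tangent_cone :: "'a::real_normed_vector set \<Rightarrow> 'a \<Rightarrow> 'a set" where
  "tangent_cone S zb = {d. \<exists>zs ts. (\<forall>k. zs k \<in> S) \<and> zs \<longlonglongrightarrow> zb \<and> (\<forall>k. ts k > (0::real))
      \<and> ts \<longlonglongrightarrow> 0 \<and> (\<lambda>k. (1 / ts k) *\<^sub>R (zs k - zb)) \<longlonglongrightarrow> d}"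

definition has_dir_deriv :: "('a::real_normed_vector \<Rightarrow> real) \<Rightarrow> 'a \<Rightarrow> 'a \<Rightarrow> real \<Rightarrow> bool" where
  "has_dir_deriv f y d D \<longleftrightarrow> ((\<lambda>t. (f (y + t *\<^sub>R d) - f y) / t) \<longlongrightarrow> D) (at_right 0)"

definition clarke_dd :: "('a::real_normed_vector \<Rightarrow> real) \<Rightarrow> 'a \<Rightarrow> 'a \<Rightarrow> ereal" where
  "clarke_dd f y d = Limsup (at (y, 0) within (UNIV \<times> {0<..}))
      (\<lambda>(w, t). ereal ((f (w + t *\<^sub>R d) - f w) / t))"

definition regular_at :: "('a::real_normed_vector \<Rightarrow> real) \<Rightarrow> 'a \<Rightarrow> bool" where
  "regular_at f y \<longleftrightarrow> (\<forall>d. \<exists>D. has_dir_deriv f y d D \<and> clarke_dd f y d = ereal D)"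

definition d_stationary :: "('a::real_normed_vector \<Rightarrow> real) \<Rightarrow> 'a set \<Rightarrow> 'a \<Rightarrow> bool" where
  "d_stationary f S zb \<longleftrightarrow> zb \<in> S \<and> (\<forall>d\<in>tangent_cone S zb. \<exists>D. has_dir_deriv f zb d D \<and> D \<ge> 0)"

definition gen_d_stationary :: "('a::real_normed_vector \<Rightarrow> real) \<Rightarrow> 'a set \<Rightarrow> 'a \<Rightarrow> bool" where
  "gen_d_stationary f S zb \<longleftrightarrow> zb \<in> S \<and> (\<forall>d\<in>tangent_cone S zb. clarke_dd f zb d \<ge> 0)"

end

theory Submission imports Defs begin

text \<open>
  The objective need not stay below \<open>\<theta>\<close> along the run, so boundedness comes from a Lyapunov function.
  The pre-activation \<open>W\<^sup>T v + b\<^sub>2\<close> is weighted homogeneous in \<open>(W, v, b\<^sub>2)\<close> with weights \<open>1, 1, 2\<close>. Testing the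
  variational inequality of the proximal step with the corresponding inward field makes the convex part
  of the loss contribute with a sign, and so
  \<open>\<Psi> = \<bar>W\<bar>\<^sup>2 + \<bar>b\<^sub>1\<bar>\<^sup>2 + \<bar>V\<bar>\<^sup>2 + 2 \<bar>b\<^sub>2\<bar>\<^sup>2\<close> plus \<open>2/L\<close> times the smoothed penalty cannot increase where
  \<open>\<R>\<close> is large, provided that \<open>L\<close> dominates the bound \<open>B\<close> on \<open>\<Psi>\<close>. This is what the hypothesis on \<open>\<mu> 0 * L 0\<close>
  buys: secants of the scaled gradient between points with constant entries bound its Lipschitz constant
  from below by a quantity larger than \<open>B\<close> requires.

  When \<open>\<mu>\<close> is reduced the smoothed objective has failed to decrease, so the descent inequality forces
  \<open>L k * norm (z (Suc k) - z k)\<close> to vanish along these indices, and the variational inequality passes to the limit.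
  Finally \<open>\<mu> * sig1 \<mu> t\<close> is the integral of \<open>max (t - m) 0\<close> over \<open>0 \<le> m \<le> \<mu>\<close>: by the mean value theorem the difference
  quotients of the smoothed kinks are those of the true ones at a point whose two biases are shifted by
  at most \<open>\<mu>\<close>. This compares the limiting inequality with the Clarke derivative.
\<close>

subsection \<open>Scalar smoothing\<close>

text \<open>Write \<open>c0\<close> for \<open>\<mu> 0 * L 0\<close>. Everything hinges on
  \<open>2 + B / real CARD('N) \<le> \<kappa> * c0\<close>, whose two sides share a free number
  \<open>c\<close>: \<open>\<kappa> = 2 - 2 / c\<close> measures how much of the loss gradient may
  be spent on the second-order terms of a step, while \<open>c\<close> also scales the level of the
  regulariser beyond which the Lyapunov function stops growing, and so enters \<open>B\<close>. For
  \<open>c\<close> near 1 nothing can be spent, and a large \<open>c\<close> inflates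
  \<open>B\<close>.

  The Lipschitz constant must be bounded below for arbitrary data, and data with positive mean
  weaken the secants. In a small box this loss is linear in the mean, whereas the summand
  \<open>8 * lam2\<close> dominates a multiple of its square, because \<open>\<theta>\<close> bounds
  the data and \<open>\<eta>\<close> is defined from \<open>\<theta> / lam2\<close>; completing the
  square settles the account. In a large box the bound \<open>\<rho> / 2\<close> on the mean is
  enough.

  The half of the hypothesis with \<open>LH\<close> enters through \<open>\<beta> \<le> LH\<close>.
  It keeps the penalty part of the Lyapunov function below a fraction of
  \<open>\<eta>\<^sup>2\<close>.\<close>

definition pos :: "real \<Rightarrow> real" where
  "pos t = max t 0"

text \<open>The ramp \<open>t / \<mu>\<close> clipped to the unit interval. In this form it is
  visibly the slope of \<open>sig1 \<mu>\<close> once the latter is a difference of squares.\<close>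

definition dsig :: "real \<Rightarrow> real \<Rightarrow> real" where
  "dsig \<mu> t = (pos t - pos (t - \<mu>)) / \<mu>"

text \<open>Smoothed form of \<open>(pos u - c)\<^sup>2\<close>. Only the cross term has a kink; the
  square of \<open>pos\<close> is already continuously differentiable.\<close>

definition phi :: "real \<Rightarrow> real \<Rightarrow> real \<Rightarrow> real" where
  "phi c \<mu> u = (pos u)\<^sup>2 + c\<^sup>2 - 2 * c * sig1 \<mu> u"

definition dphi :: "real \<Rightarrow> real \<Rightarrow> real \<Rightarrow> real" where
  "dphi c \<mu> u = 2 * pos u - 2 * c * dsig \<mu> u"

lemma pos_nonneg [simp]: "0 \<le> pos t"
  by (simp add: pos_def)

lemma pos_ge: "t \<le> pos t"
  by (simp add: pos_def)

lemma pos_mono: "s \<le> t \<Longrightarrow> pos s \<le> pos t"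
  by (simp add: pos_def)

lemma pos_square_lower: "(pos s)\<^sup>2 + 2 * pos s * (t - s) \<le> (pos t)\<^sup>2"
proof (cases "s \<le> 0")
  case True
  then show ?thesis by (simp add: pos_def max_def)
next
  case False
  have "(pos t)\<^sup>2 - s\<^sup>2 - 2 * s * (t - s) = (pos t - s)\<^sup>2 + 2 * s * (pos t - t)"
    by (simp add: power2_eq_square algebra_simps)
  also have "\<dots> \<ge> 0"
    using False pos_ge[of t] by simp
  finally show ?thesis using False by (simp add: pos_def max_def)
qed

text \<open>Together with the tangent inequality this traps the first-order remainder of the squared
  \<open>pos\<close> between 0 and the squared increment. The derivative and the remainder bound of
  \<open>sig1\<close> come from this sandwich.\<close>

lemma pos_square_upper: "(pos t)\<^sup>2 \<le> (pos s)\<^sup>2 + 2 * pos s * (t - s) + (t - s)\<^sup>2"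
proof (cases "s \<le> 0")
  case True
  then have "pos t \<le> \<bar>t - s\<bar>" by (auto simp: pos_def max_def)
  then have "(pos t)\<^sup>2 \<le> (t - s)\<^sup>2" by (metis pos_nonneg power2_abs power_mono)
  then show ?thesis using True by (simp add: pos_def max_def)
next
  case False
  have "(pos t)\<^sup>2 \<le> t\<^sup>2" by (auto simp: pos_def max_def)
  then show ?thesis using False by (simp add: pos_def max_def power2_eq_square algebra_simps)
qed

lemma pos_square_deriv: "((\<lambda>t. (pos t)\<^sup>2) has_real_derivative 2 * pos t) (at t)"
proof -
  have "((\<lambda>h. ((pos (t + h))\<^sup>2 - (pos t)\<^sup>2) / h - 2 * pos t) \<longlongrightarrow> 0) (at 0)"
  proof (rule Lim_null_comparison)
    show "\<forall>\<^sub>F h in at 0. norm (((pos (t + h))\<^sup>2 - (pos t)\<^sup>2) / h - 2 * pos t) \<le> \<bar>h\<bar>"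
    proof (rule eventually_at_filter[THEN iffD2], rule always_eventually, intro allI impI)
      fix h :: real assume "h \<noteq> 0"
      have e: "((pos (t + h))\<^sup>2 - (pos t)\<^sup>2) / h - 2 * pos t
          = ((pos (t + h))\<^sup>2 - (pos t)\<^sup>2 - 2 * pos t * h) / h"
        using \<open>h \<noteq> 0\<close> by (simp add: field_simps)
      have "\<bar>(pos (t + h))\<^sup>2 - (pos t)\<^sup>2 - 2 * pos t * h\<bar> \<le> \<bar>h\<bar> * \<bar>h\<bar>"
        using pos_square_lower[of t "t + h"] pos_square_upper[of "t + h" t]
        by (simp add: power2_eq_square abs_if)
      then show "norm (((pos (t + h))\<^sup>2 - (pos t)\<^sup>2) / h - 2 * pos t) \<le> \<bar>h\<bar>"
        unfolding e using \<open>h \<noteq> 0\<close> by (simp add: divide_le_eq)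
    qed
    show "((\<lambda>h::real. \<bar>h\<bar>) \<longlongrightarrow> 0) (at 0)"
      by (intro tendsto_eq_intros) auto
  qed
  then show ?thesis
    unfolding DERIV_def by (simp add: LIM_zero_iff)
qed

lemma sig1_eq: "0 < \<mu> \<Longrightarrow> sig1 \<mu> t = ((pos t)\<^sup>2 - (pos (t - \<mu>))\<^sup>2) / (2 * \<mu>)"
  by (auto simp: sig1_def pos_def max_def power2_eq_square field_simps)

lemma sig1_deriv: "0 < \<mu> \<Longrightarrow> (sig1 \<mu> has_real_derivative dsig \<mu> t) (at t)"
proof -
  assume m: "0 < \<mu>"
  have "((\<lambda>t. (pos (t - \<mu>))\<^sup>2) has_real_derivative 2 * pos (t - \<mu>)) (at t)"
    using DERIV_shift[of "\<lambda>t. (pos t)\<^sup>2" "2 * pos (t - \<mu>)" t "- \<mu>"] pos_square_deriv[of "t - \<mu>"]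
    by simp
  then have "((\<lambda>t. ((pos t)\<^sup>2 - (pos (t - \<mu>))\<^sup>2) / (2 * \<mu>)) has_real_derivative
      (2 * pos t - 2 * pos (t - \<mu>)) / (2 * \<mu>)) (at t)"
    by (intro DERIV_cdivide DERIV_diff pos_square_deriv)
  moreover have "(2 * pos t - 2 * pos (t - \<mu>)) / (2 * \<mu>) = dsig \<mu> t"
    using m by (simp add: dsig_def field_simps)
  moreover have "sig1 \<mu> = (\<lambda>t. ((pos t)\<^sup>2 - (pos (t - \<mu>))\<^sup>2) / (2 * \<mu>))"
    using sig1_eq[OF m] by auto
  ultimately show ?thesis by simp
qed

lemma dsig_nonneg: "0 < \<mu> \<Longrightarrow> 0 \<le> dsig \<mu> t"
  by (simp add: dsig_def pos_mono)

lemma dsig_le_1: "0 < \<mu> \<Longrightarrow> dsig \<mu> t \<le> 1"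
  by (auto simp: dsig_def pos_def max_def)

lemma dsig_eq_0: "0 < \<mu> \<Longrightarrow> t \<le> 0 \<Longrightarrow> dsig \<mu> t = 0"
  by (simp add: dsig_def pos_def max_def)

lemma dsig_eq_1: "0 < \<mu> \<Longrightarrow> \<mu> \<le> t \<Longrightarrow> dsig \<mu> t = 1"
  by (simp add: dsig_def pos_def max_def)

lemma dsig_linear: "0 < \<mu> \<Longrightarrow> 0 \<le> t \<Longrightarrow> t \<le> \<mu> \<Longrightarrow> dsig \<mu> t = t / \<mu>"
  by (simp add: dsig_def pos_def max_def)

lemma dsig_mono: "0 < \<mu> \<Longrightarrow> s \<le> t \<Longrightarrow> dsig \<mu> s \<le> dsig \<mu> t"
  by (auto simp: dsig_def pos_def max_def divide_right_mono)

lemma dsig_mult_le: "0 < \<mu> \<Longrightarrow> dsig \<mu> t * t \<le> pos t"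
proof -
  assume m: "0 < \<mu>"
  show ?thesis
  proof (cases "t \<le> 0")
    case True
    then show ?thesis using dsig_eq_0[OF m True] by simp
  next
    case False
    then show ?thesis using mult_right_mono[OF dsig_le_1[OF m, of t], of t] by (simp add: pos_def)
  qed
qed

lemma sig1_tangent: "0 < \<mu> \<Longrightarrow> sig1 \<mu> s + dsig \<mu> s * (t - s) \<le> sig1 \<mu> t"
proof -
  assume m: "0 < \<mu>"
  have "\<exists>z. (s < t \<longrightarrow> s < z \<and> z < t) \<and> (t < s \<longrightarrow> t < z \<and> z < s) \<and>
      sig1 \<mu> t - sig1 \<mu> s = (t - s) * dsig \<mu> z"
  proof (cases s t rule: linorder_cases)
    case less
    obtain z where "z > s" "z < t" "sig1 \<mu> t - sig1 \<mu> s = (t - s) * dsig \<mu> z"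
      using MVT2[OF less, of "sig1 \<mu>" "dsig \<mu>"] sig1_deriv[OF m] by blast
    then show ?thesis using less by auto
  next
    case equal
    then show ?thesis by auto
  next
    case greater
    obtain z where "z > t" "z < s" "sig1 \<mu> s - sig1 \<mu> t = (s - t) * dsig \<mu> z"
      using MVT2[OF greater, of "sig1 \<mu>" "dsig \<mu>"] sig1_deriv[OF m] by blast
    then show ?thesis using greater by (intro exI[of _ z]) (auto simp: algebra_simps)
  qed
  then obtain z where z: "s < t \<Longrightarrow> s < z" "t < s \<Longrightarrow> z < s"
      "sig1 \<mu> t - sig1 \<mu> s = (t - s) * dsig \<mu> z" by auto
  have "dsig \<mu> s * (t - s) \<le> dsig \<mu> z * (t - s)"
  proof (cases s t rule: linorder_cases)
    case less
    then show ?thesis using dsig_mono[OF m, of s z] z by (intro mult_right_mono) auto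
  next
    case greater
    then show ?thesis using dsig_mono[OF m, of z s] z by (intro mult_right_mono_neg) auto
  qed simp
  then show ?thesis using z(3) by (simp add: mult.commute)
qed

text \<open>The remainder is a difference of two remainders of the squared \<open>pos\<close>, taken
  at shifted points. Both lie in the interval from 0 to \<open>(t - s)\<^sup>2\<close>, so their
  difference is at most its length and no factor 2 is lost.\<close>

lemma sig1_remainder: "0 < \<mu> \<Longrightarrow> \<bar>sig1 \<mu> t - sig1 \<mu> s - dsig \<mu> s * (t - s)\<bar> \<le> (t - s)\<^sup>2 / (2 * \<mu>)"
proof -
  assume m: "0 < \<mu>"
  let ?Q = "\<lambda>a b. (pos b)\<^sup>2 - (pos a)\<^sup>2 - 2 * pos a * (b - a)"
  have Q: "0 \<le> ?Q a b" "?Q a b \<le> (b - a)\<^sup>2" for a b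
    using pos_square_lower[of a b] pos_square_upper[of b a] by auto
  have e: "sig1 \<mu> t - sig1 \<mu> s - dsig \<mu> s * (t - s) = (?Q s t - ?Q (s - \<mu>) (t - \<mu>)) / (2 * \<mu>)"
    using m by (simp add: sig1_eq dsig_def field_simps)
  have "\<bar>?Q s t - ?Q (s - \<mu>) (t - \<mu>)\<bar> \<le> (t - s)\<^sup>2"
    using Q[where a=s and b=t] Q[where a="s - \<mu>" and b="t - \<mu>"] by (auto simp: abs_le_iff)
  then show ?thesis unfolding e using m by (simp add: divide_right_mono)
qed

lemma sig1_nonneg: "0 < \<mu> \<Longrightarrow> 0 \<le> sig1 \<mu> t"
  by (auto simp: sig1_def)

text \<open>A mean of \<open>pos (t - m)\<close> over fewer shifts \<open>m\<close> is larger. Hence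
  reducing \<open>\<mu>\<close> never raises the smoothed penalty, in which \<open>sig1\<close> has
  a minus sign.\<close>

lemma sig1_antimono:
  assumes "0 < \<mu>'" "\<mu>' \<le> \<mu>"
  shows "sig1 \<mu> t \<le> sig1 \<mu>' t"
proof -
  have aux: "t\<^sup>2 / (2 * \<mu>) \<le> t - \<mu>' / 2" if "\<mu>' < t" "t \<le> \<mu>"
  proof -
    have "0 \<le> (\<mu> - t) * (t - \<mu>')"
      using that assms by (intro mult_nonneg_nonneg) auto
    moreover have "0 \<le> t * (\<mu> - \<mu>')" using that assms by (intro mult_nonneg_nonneg) auto
    ultimately have "\<mu> * \<mu>' + t * t \<le> \<mu> * (t * 2)" by (simp add: algebra_simps)
    then show ?thesis using assms that by (simp add: field_simps power2_eq_square)
  qed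
  have "t\<^sup>2 / (2 * \<mu>) \<le> t\<^sup>2 / (2 * \<mu>')"
    using assms by (intro divide_left_mono) auto
  then show ?thesis using assms aux by (auto simp: sig1_def)
qed

lemma sig1_le_pos: "0 < \<mu> \<Longrightarrow> sig1 \<mu> t \<le> pos t"
  using sig1_tangent[of \<mu> t 0] dsig_mult_le[of \<mu> t] by (simp add: sig1_def)

lemma phi_deriv: "0 < \<mu> \<Longrightarrow> (phi c \<mu> has_real_derivative dphi c \<mu> u) (at u)"
proof -
  assume m: "0 < \<mu>"
  have "((\<lambda>u. (pos u)\<^sup>2 + c\<^sup>2 - 2 * c * sig1 \<mu> u) has_real_derivative
      2 * pos u + 0 - 2 * c * dsig \<mu> u) (at u)"
    by (intro DERIV_diff DERIV_add DERIV_const pos_square_deriv DERIV_cmult sig1_deriv m)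
  then show ?thesis by (simp add: phi_def[abs_def] dphi_def)
qed

text \<open>The data entry \<open>c\<close> may have either sign, so the cross term is controlled
  only in absolute value. This is the one source of curvature of order \<open>1 / \<mu>\<close> in
  the descent estimate.\<close>

lemma phi_upper:
  assumes "0 < \<mu>"
  shows "phi c \<mu> t \<le> phi c \<mu> s + dphi c \<mu> s * (t - s) + (1 + \<bar>c\<bar> / \<mu>) * (t - s)\<^sup>2"
proof -
  define r where "r = sig1 \<mu> t - sig1 \<mu> s - dsig \<mu> s * (t - s)"
  have "- (c * r) \<le> \<bar>c\<bar> * \<bar>r\<bar>"
    using abs_ge_minus_self[of "c * r"] by (simp add: abs_mult)
  also have "\<dots> \<le> \<bar>c\<bar> * ((t - s)\<^sup>2 / (2 * \<mu>))"
    using sig1_remainder[OF assms, of t s] by (intro mult_left_mono) (auto simp: r_def)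
  finally have "- (2 * (c * r)) \<le> \<bar>c\<bar> / \<mu> * (t - s)\<^sup>2"
    using assms by (simp add: field_simps)
  moreover have "phi c \<mu> t = phi c \<mu> s + dphi c \<mu> s * (t - s)
      + ((pos t)\<^sup>2 - (pos s)\<^sup>2 - 2 * pos s * (t - s)) - 2 * (c * r)"
    by (simp add: phi_def dphi_def r_def algebra_simps)
  ultimately show ?thesis using pos_square_upper[of t s] by (simp add: distrib_right)
qed

text \<open>With \<open>s = dsig \<mu> u\<close> and \<open>y = u - x * s\<close> the derivative is
  \<open>2 * y\<close>, and the right-hand side becomes
  \<open>4 / c * y\<^sup>2 + 4 * x * s * y\<close>; completing the square leaves
  \<open>c * (x * s)\<^sup>2\<close>. The subtracted \<open>\<kappa>\<close> term is a reserve: the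
  Lyapunov estimate pays its second-order errors from it.\<close>

lemma dphi_mult_lower:
  assumes m: "0 < \<mu>" and k: "0 < c" "\<kappa> = 2 - 2 / c"
  shows "- c * x\<^sup>2 \<le> 2 * dphi x \<mu> u * u - \<kappa> / 2 * (dphi x \<mu> u)\<^sup>2"
proof (cases "u \<le> 0")
  case True
  then have "dphi x \<mu> u = 0" using dsig_eq_0[OF m] by (simp add: dphi_def pos_def)
  then show ?thesis using k by simp
next
  case False
  define s where "s = dsig \<mu> u"
  define y where "y = u - x * s"
  have s: "0 \<le> s" "s \<le> 1" using dsig_nonneg[OF m] dsig_le_1[OF m] by (auto simp: s_def)
  have d: "dphi x \<mu> u = 2 * y" using False by (simp add: dphi_def s_def y_def pos_def algebra_simps)
  have u: "u = y + x * s" by (simp add: y_def)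
  have "2 * dphi x \<mu> u * u - \<kappa> / 2 * (dphi x \<mu> u)\<^sup>2 = 4 / c * y\<^sup>2 + 4 * x * s * y"
    unfolding d k(2) by (subst u) (simp add: power2_eq_square algebra_simps diff_divide_distrib)
  also have "\<dots> = 4 / c * (y + c * x * s / 2)\<^sup>2 - c * (x * s)\<^sup>2"
    using k(1) by (simp add: power2_eq_square field_simps)
  also have "\<dots> \<ge> - c * (x * s)\<^sup>2" using k by simp
  finally have "- c * (x * s)\<^sup>2 \<le> 2 * dphi x \<mu> u * u - \<kappa> / 2 * (dphi x \<mu> u)\<^sup>2" by simp
  moreover have "c * (x * s)\<^sup>2 \<le> c * x\<^sup>2"
    using s k(1) mult_left_mono[OF power_le_one[OF s, of 2], of "x\<^sup>2"]
    by (intro mult_left_mono) (auto simp: power_mult_distrib)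
  ultimately show ?thesis by linarith
qed

subsection \<open>The gradient of the smoothed objective\<close>

abbreviation Wm :: "('n0,'n1,'N) pt \<Rightarrow> real^'n0^'n1" where "Wm z \<equiv> fst z"
abbreviation Bh :: "('n0,'n1,'N) pt \<Rightarrow> real^'n1" where "Bh z \<equiv> fst (fst (snd z))"
abbreviation Bo :: "('n0,'n1,'N) pt \<Rightarrow> real^'n0" where "Bo z \<equiv> snd (fst (snd z))"
abbreviation Vm :: "('n0,'n1,'N) pt \<Rightarrow> real^'n1^'N" where "Vm z \<equiv> snd (snd z)"

definition rep :: "real^'n \<Rightarrow> real^'n^'N" where
  "rep b = (\<chi> n. b)"

text \<open>All output pre-activations at once. \<open>Vm z\<close> holds the vectors
  \<open>v_n\<close> as rows, so row \<open>n\<close> of the product \<open>Vm z ** Wm z\<close> is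
  \<open>W\<close> transposed applied to \<open>v_n\<close>. The map is bilinear plus linear, and
  \<open>dumat\<close> is its differential.\<close>

definition umat :: "('n0::finite,'n1::finite,'N::finite) pt \<Rightarrow> real^'n0^'N" where
  "umat z = Vm z ** Wm z + rep (Bo z)"

definition dumat :: "('n0::finite,'n1::finite,'N::finite) pt \<Rightarrow> ('n0,'n1,'N) pt \<Rightarrow> real^'n0^'N" where
  "dumat z d = Vm d ** Wm z + Vm z ** Wm d + rep (Bo d)"

definition tmat :: "('N::finite \<Rightarrow> real^'n0::finite) \<Rightarrow> ('n0,'n1::finite,'N) pt \<Rightarrow> real^'n1^'N" where
  "tmat x z = (\<chi> n. Wm z *v x n + Bh z)"

definition gmat :: "('N::finite \<Rightarrow> real^'n0::finite) \<Rightarrow> real \<Rightarrow> ('n0,'n1::finite,'N) pt \<Rightarrow> real^'n0^'N" where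
  "gmat x \<mu> z = (\<chi> n i. dphi (x n $ i) \<mu> (umat z $ n $ i))"

definition DF :: "('N::finite \<Rightarrow> real^'n0::finite) \<Rightarrow> ('n0,'n1::finite,'N) pt \<Rightarrow> real \<Rightarrow> ('n0,'n1,'N) pt \<Rightarrow> real" where
  "DF x z \<mu> d = gmat x \<mu> z \<bullet> dumat z d / real CARD('N)"

definition DP :: "('N::finite \<Rightarrow> real^'n0::finite) \<Rightarrow> real \<Rightarrow> ('n0,'n1::finite,'N) pt \<Rightarrow> real \<Rightarrow> ('n0,'n1,'N) pt \<Rightarrow> real" where
  "DP x \<beta> z \<mu> d = \<beta> * (\<Sum>n\<in>UNIV. \<Sum>j\<in>UNIV. Vm d $ n $ j - dsig \<mu> (tmat x z $ n $ j) * tmat x d $ n $ j)"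

definition DR :: "real \<Rightarrow> real \<Rightarrow> ('n0::finite,'n1::finite,'N::finite) pt \<Rightarrow> ('n0,'n1,'N) pt \<Rightarrow> real" where
  "DR lam1 lam2 z d = lam1 * (\<Sum>n\<in>UNIV. esum (Vm d $ n)) + 2 * lam2 * (Wm z \<bullet> Wm d)"

section \<open>Frobenius norms and coordinate formulas\<close>

lemma inner_mat: "(A :: real^'n^'m) \<bullet> B = (\<Sum>i\<in>UNIV. \<Sum>j\<in>UNIV. A $ i $ j * B $ i $ j)"
  by (simp add: inner_vec_def)

lemma norm_mat_square: "(norm (A :: real^'n^'m))\<^sup>2 = (\<Sum>i\<in>UNIV. \<Sum>j\<in>UNIV. (A $ i $ j)\<^sup>2)"
  unfolding power2_norm_eq_inner inner_mat by (simp add: power2_eq_square)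

lemma norm_vec_square: "(norm (v :: real^'n))\<^sup>2 = (\<Sum>i\<in>UNIV. (v $ i)\<^sup>2)"
  unfolding power2_norm_eq_inner inner_vec_def by (simp add: power2_eq_square)

lemma norm_matrix_mult_le: "norm ((A :: real^'k^'m) ** (B :: real^'n^'k)) \<le> norm A * norm B"
proof -
  have "(norm (A ** B))\<^sup>2 = (\<Sum>i\<in>UNIV. \<Sum>j\<in>UNIV. (\<Sum>k\<in>UNIV. A $ i $ k * B $ k $ j)\<^sup>2)"
    by (simp add: norm_mat_square matrix_matrix_mult_def)
  also have "\<dots> \<le> (\<Sum>i\<in>UNIV. \<Sum>j\<in>UNIV. (\<Sum>k\<in>UNIV. (A $ i $ k)\<^sup>2) * (\<Sum>k\<in>UNIV. (B $ k $ j)\<^sup>2))"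
    by (intro sum_mono Cauchy_Schwarz_ineq_sum)
  also have "\<dots> = (\<Sum>i\<in>UNIV. \<Sum>k\<in>UNIV. (A $ i $ k)\<^sup>2) * (\<Sum>j\<in>UNIV. \<Sum>k\<in>UNIV. (B $ k $ j)\<^sup>2)"
    by (simp add: sum_product)
  also have "(\<Sum>j\<in>UNIV. \<Sum>k\<in>UNIV. (B $ k $ j)\<^sup>2) = (norm B)\<^sup>2"
    by (subst sum.swap) (simp add: norm_mat_square)
  also have "(\<Sum>i\<in>UNIV. \<Sum>k\<in>UNIV. (A $ i $ k)\<^sup>2) = (norm A)\<^sup>2"
    by (simp add: norm_mat_square)
  finally have "(norm (A ** B))\<^sup>2 \<le> (norm A * norm B)\<^sup>2" by (simp add: power_mult_distrib)
  then show ?thesis by (rule power2_le_imp_le) simp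
qed

lemma norm_rep: "norm (rep b :: real^'n^'N::finite) = sqrt (real CARD('N)) * norm b"
proof -
  have "(norm (rep b :: real^'n^'N))\<^sup>2 = (sqrt (real CARD('N)) * norm b)\<^sup>2"
    by (simp add: norm_mat_square norm_vec_square rep_def power_mult_distrib)
  then show ?thesis by (simp add: power2_eq_iff_nonneg)
qed

lemma umat_nth: "umat z $ n $ i = (\<Sum>j\<in>UNIV. Vm z $ n $ j * Wm z $ j $ i) + Bo z $ i"
  by (simp add: umat_def rep_def matrix_matrix_mult_def)

lemma dumat_nth: "dumat z d $ n $ i = (\<Sum>j\<in>UNIV. Vm d $ n $ j * Wm z $ j $ i)
   + (\<Sum>j\<in>UNIV. Vm z $ n $ j * Wm d $ j $ i) + Bo d $ i"
  by (simp add: dumat_def rep_def matrix_matrix_mult_def)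

lemma tmat_nth: "tmat x z $ n $ j = (\<Sum>i\<in>UNIV. Wm z $ j $ i * x n $ i) + Bh z $ j"
  by (simp add: tmat_def matrix_vector_mult_def)

lemma vector_matrix_mult_nth: "(v v* W) $ i = (\<Sum>j\<in>UNIV. v $ j * W $ j $ i)" for v :: "real^'n"
  by (simp add: vector_matrix_mult_def mult.commute)

lemma Ftil_eq: "Ftil x z \<mu> = (\<Sum>n\<in>UNIV. \<Sum>i\<in>UNIV. phi (x n $ i) \<mu> (umat z $ n $ i)) / real CARD('N)"
  for x :: "'N::finite \<Rightarrow> real^'n0::finite" and z :: "('n0,'n1::finite,'N) pt"
proof -
  obtain W b1 b2 V where z: "z = (W, (b1, b2), V)" by (metis prod.collapse)
  show ?thesis
    unfolding z Ftil_def frob2_def norm_vec_square inner_vec_def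
    by (simp add: phi_def umat_nth sum.distrib sum_subtractf sum_distrib_left sum_divide_distrib
      relu_def sigv_def pos_def vector_matrix_mult_nth)
       (simp add: diff_divide_distrib add_divide_distrib sum_distrib_left sum_divide_distrib sum.distrib mult.assoc)
qed

lemma Ptil_eq: "Ptil x \<beta> z \<mu> = \<beta> * (\<Sum>n\<in>UNIV. \<Sum>j\<in>UNIV. Vm z $ n $ j - sig1 \<mu> (tmat x z $ n $ j))"
proof -
  obtain W b1 b2 V where z: "z = (W, (b1, b2), V)" by (metis prod.collapse)
  show ?thesis
    unfolding z Ptil_def esum_def sigv_def tmat_def by simp
qed

lemma Robj_eq: "Robj lam1 lam2 z = lam1 * (\<Sum>n\<in>UNIV. esum (Vm z $ n)) + lam2 * (norm (Wm z))\<^sup>2"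
  by (cases z) (auto simp: Robj_def)

lemma Fobj_eq: "Fobj x z = (\<Sum>n\<in>UNIV. \<Sum>i\<in>UNIV. (pos (umat z $ n $ i) - x n $ i)\<^sup>2) / real CARD('N)"
  for x :: "'N::finite \<Rightarrow> real^'n0::finite" and z :: "('n0,'n1::finite,'N) pt"
proof -
  obtain W b1 b2 V where z: "z = (W, (b1, b2), V)" by (metis prod.collapse)
  show ?thesis
    unfolding z Fobj_def norm_vec_square
    by (simp add: relu_def pos_def umat_nth vector_matrix_mult_nth)
qed

lemma Pobj_eq: "Pobj x \<beta> z = \<beta> * (\<Sum>n\<in>UNIV. \<Sum>j\<in>UNIV. Vm z $ n $ j - pos (tmat x z $ n $ j))"
proof -
  obtain W b1 b2 V where z: "z = (W, (b1, b2), V)" by (metis prod.collapse)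
  show ?thesis
    unfolding z Pobj_def esum_def relu_def tmat_def pos_def by simp
qed

lemma umat_nth_deriv: "((\<lambda>w. umat w $ n $ i) has_derivative (\<lambda>d. dumat z d $ n $ i)) (at z)"
  for z :: "('n0::finite,'n1::finite,'N::finite) pt"
proof -
  have V: "((\<lambda>w::('n0,'n1,'N) pt. Vm w $ n $ j) has_derivative (\<lambda>d. Vm d $ n $ j)) (at z)" for j
    by (intro bounded_linear_imp_has_derivative linear_conv_bounded_linear[THEN iffD1] linearI) auto
  have W: "((\<lambda>w::('n0,'n1,'N) pt. Wm w $ j $ i) has_derivative (\<lambda>d. Wm d $ j $ i)) (at z)" for j
    by (intro bounded_linear_imp_has_derivative linear_conv_bounded_linear[THEN iffD1] linearI) auto
  have B: "((\<lambda>w::('n0,'n1,'N) pt. Bo w $ i) has_derivative (\<lambda>d. Bo d $ i)) (at z)"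
    by (intro bounded_linear_imp_has_derivative linear_conv_bounded_linear[THEN iffD1] linearI) auto
  have "((\<lambda>w. (\<Sum>j\<in>UNIV. Vm w $ n $ j * Wm w $ j $ i) + Bo w $ i) has_derivative
     (\<lambda>d. (\<Sum>j\<in>UNIV. Vm z $ n $ j * Wm d $ j $ i + Vm d $ n $ j * Wm z $ j $ i) + Bo d $ i)) (at z)"
    by (intro has_derivative_add has_derivative_sum has_derivative_mult V W B)
  then show ?thesis
    by (simp add: umat_nth dumat_nth sum.distrib add.commute)
qed

lemma tmat_nth_add: "tmat x (z + w) $ n $ j = tmat x z $ n $ j + tmat x w $ n $ j"
  by (simp add: tmat_nth sum.distrib distrib_right)

lemma tmat_nth_scaleR: "tmat x (c *\<^sub>R z) $ n $ j = c * tmat x z $ n $ j"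
  by (simp add: tmat_nth sum_distrib_left distrib_left mult.assoc)

lemma tmat_nth_deriv: "((\<lambda>w. tmat x w $ n $ j) has_derivative (\<lambda>d. tmat x d $ n $ j)) (at z)"
  by (intro bounded_linear_imp_has_derivative linear_conv_bounded_linear[THEN iffD1] linearI)
     (simp_all add: tmat_nth_add tmat_nth_scaleR)

lemma Htil_deriv:
  fixes x :: "'N::finite \<Rightarrow> real^'n0::finite" and z :: "('n0,'n1::finite,'N) pt"
  assumes m: "0 < \<mu>"
  shows "((\<lambda>w. Htil x \<beta> w \<mu>) has_derivative (\<lambda>d. DF x z \<mu> d + DP x \<beta> z \<mu> d)) (at z)"
proof -
  have V: "((\<lambda>w::('n0,'n1,'N) pt. Vm w $ n $ j) has_derivative (\<lambda>d. Vm d $ n $ j)) (at z)" for n j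
    by (intro bounded_linear_imp_has_derivative linear_conv_bounded_linear[THEN iffD1] linearI) auto
  have "((\<lambda>w. Ftil x w \<mu>) has_derivative (\<lambda>d.
      (\<Sum>n\<in>UNIV. \<Sum>i\<in>UNIV. dumat z d $ n $ i * dphi (x n $ i) \<mu> (umat z $ n $ i)) / real CARD('N))) (at z)"
    unfolding Ftil_eq
    by (intro bounded_linear.has_derivative[OF bounded_linear_divide] has_derivative_sum DERIV_compose_FDERIV phi_deriv m umat_nth_deriv)
  moreover have "((\<lambda>w. Ptil x \<beta> w \<mu>) has_derivative (\<lambda>d. \<beta> * (\<Sum>n\<in>UNIV. \<Sum>j\<in>UNIV.
      Vm d $ n $ j - tmat x d $ n $ j * dsig \<mu> (tmat x z $ n $ j)))) (at z)"
    unfolding Ptil_eq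
    by (intro has_derivative_mult_right has_derivative_sum has_derivative_diff V tmat_nth_deriv
        DERIV_compose_FDERIV[where f = "sig1 \<mu>"] sig1_deriv m)
  ultimately have "((\<lambda>w. Htil x \<beta> w \<mu>) has_derivative (\<lambda>d.
      (\<Sum>n\<in>UNIV. \<Sum>i\<in>UNIV. dumat z d $ n $ i * dphi (x n $ i) \<mu> (umat z $ n $ i)) / real CARD('N)
      + \<beta> * (\<Sum>n\<in>UNIV. \<Sum>j\<in>UNIV. Vm d $ n $ j - tmat x d $ n $ j * dsig \<mu> (tmat x z $ n $ j)))) (at z)"
    unfolding Htil_def by (rule has_derivative_add)
  then show ?thesis
    by (simp add: DF_def DP_def gmat_def inner_mat mult.commute)
qed

text \<open>The gradient is given by a choice operator. Its existence follows by representing the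
  derivative in the standard basis, and uniqueness of the derivative then identifies the chosen
  vector.\<close>

lemma gradHtil_inner:
  assumes m: "0 < \<mu>"
  shows "gradHtil x \<beta> z \<mu> \<bullet> d = DF x z \<mu> d + DP x \<beta> z \<mu> d"
proof -
  let ?D = "\<lambda>d. DF x z \<mu> d + DP x \<beta> z \<mu> d"
  let ?H = "\<lambda>w. Htil x \<beta> w \<mu>"
  have D: "(?H has_derivative ?D) (at z)" by (rule Htil_deriv[OF m])
  then have lin: "linear ?D" by (rule has_derivative_linear)
  define g where "g = (\<Sum>b\<in>Basis. ?D b *\<^sub>R b)"
  have "?D h = h \<bullet> g" for h
  proof -
    have "?D h = ?D (\<Sum>b\<in>Basis. (h \<bullet> b) *\<^sub>R b)" by (simp add: euclidean_representation)
    also have "\<dots> = (\<Sum>b\<in>Basis. (h \<bullet> b) * ?D b)"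
      by (subst linear_sum[OF lin]) (simp add: linear_scale[OF lin])
    finally show ?thesis by (simp add: g_def inner_sum_right mult.commute)
  qed
  then have "?D = (\<lambda>h. h \<bullet> g)" by (rule ext)
  then have "(?H has_derivative (\<lambda>h. h \<bullet> g)) (at z)" by (rule has_derivative_eq_rhs[OF D])
  then have "\<exists>g. GDERIV ?H z :> g" unfolding gderiv_def by blast
  then have "GDERIV ?H z :> gradHtil x \<beta> z \<mu>"
    unfolding gradHtil_def by (rule someI_ex)
  then have "(?H has_derivative (\<lambda>h. h \<bullet> gradHtil x \<beta> z \<mu>)) (at z)" unfolding gderiv_def .
  from fun_cong[OF has_derivative_unique[OF this D], of d] show ?thesis by (simp add: inner_commute)
qed

subsection \<open>The feasible set and the proximal step\<close>

lemma infnorm_le_iff: "infnorm (x :: 'a::euclidean_space) \<le> c \<longleftrightarrow> (\<forall>b\<in>Basis. \<bar>x \<bullet> b\<bar> \<le> c)"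
  by (subst infnorm_Max) (simp add: Max_le_iff)

lemma infnorm_pair_le_iff: "infnorm (x :: 'a::euclidean_space, y :: 'b::euclidean_space) \<le> c \<longleftrightarrow> infnorm x \<le> c \<and> infnorm y \<le> c"
  by (simp add: infnorm_le_iff Basis_prod_def ball_Un)

lemma infnorm_vec_le_iff: "infnorm (x :: 'a::euclidean_space^'n) \<le> c \<longleftrightarrow> (\<forall>i. infnorm (x $ i) \<le> c)"
  by (auto simp: infnorm_le_iff Basis_vec_def inner_axis)

lemma infnorm_real: "infnorm (x :: real) = \<bar>x\<bar>"
  by (simp add: infnorm_Max)

lemma Zset_iff: "z \<in> Zset x \<alpha> \<longleftrightarrow> (\<forall>n j. pos (tmat x z $ n $ j) \<le> Vm z $ n $ j) \<and>
   (\<forall>j. \<bar>Bh z $ j\<bar> \<le> \<alpha>) \<and> (\<forall>i. \<bar>Bo z $ i\<bar> \<le> \<alpha>)"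
proof -
  obtain W b1 b2 V where z: "z = (W, (b1, b2), V)" by (metis prod.collapse)
  show ?thesis
    by (simp add: z Zset_def Omega2_def Omega3_def infnorm_pair_le_iff infnorm_vec_le_iff infnorm_real
        relu_def pos_def tmat_def)
qed

lemma Omega2_iff: "z \<in> Omega2 x \<longleftrightarrow> (\<forall>n j. pos (tmat x z $ n $ j) \<le> Vm z $ n $ j)"
proof -
  obtain W b1 b2 V where z: "z = (W, (b1, b2), V)" by (metis prod.collapse)
  show ?thesis by (simp add: z Omega2_def relu_def pos_def tmat_def)
qed

lemma pos_convex: "0 \<le> s \<Longrightarrow> s \<le> 1 \<Longrightarrow> pos ((1 - s) * a + s * b) \<le> (1 - s) * pos a + s * pos b"
proof -
  assume s: "0 \<le> s" "s \<le> 1"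
  have "(1 - s) * a + s * b \<le> (1 - s) * pos a + s * pos b"
    using s by (intro add_mono mult_left_mono) (auto simp: pos_ge)
  moreover have "0 \<le> (1 - s) * pos a + s * pos b" using s by simp
  ultimately show ?thesis by (simp add: pos_def[of "(1 - s) * a + s * b"])
qed

lemma Zset_convex:
  fixes x :: "'N::finite \<Rightarrow> real^'n0::finite"
  shows "convex (Zset x \<alpha> :: ('n0,'n1::finite,'N) pt set)"
  unfolding convex_alt
proof (intro ballI allI impI)
  fix z w :: "('n0,'n1,'N) pt" and s :: real
  assume z: "z \<in> Zset x \<alpha>" and w: "w \<in> Zset x \<alpha>" and s: "0 \<le> s \<and> s \<le> 1"
  have abs: "\<bar>(1 - s) * a + s * b\<bar> \<le> \<alpha>" if "\<bar>a\<bar> \<le> \<alpha>" "\<bar>b\<bar> \<le> \<alpha>" for a b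
  proof -
    have "\<bar>(1 - s) * a + s * b\<bar> \<le> (1 - s) * \<bar>a\<bar> + s * \<bar>b\<bar>"
      using abs_triangle_ineq[of "(1 - s) * a" "s * b"] s by (simp add: abs_mult)
    also have "\<dots> \<le> (1 - s) * \<alpha> + s * \<alpha>"
      using that s by (intro add_mono mult_left_mono) auto
    finally show ?thesis by (simp add: algebra_simps)
  qed
  have "pos ((1 - s) * tmat x z $ n $ j + s * tmat x w $ n $ j) \<le> (1 - s) * Vm z $ n $ j + s * Vm w $ n $ j" for n j
  proof -
    have "(1 - s) * pos (tmat x z $ n $ j) + s * pos (tmat x w $ n $ j) \<le> (1 - s) * Vm z $ n $ j + s * Vm w $ n $ j"
      using z w s by (intro add_mono mult_left_mono) (auto simp: Zset_iff)
    then show ?thesis using pos_convex[of s "tmat x z $ n $ j" "tmat x w $ n $ j"] s by linarith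
  qed
  then show "(1 - s) *\<^sub>R z + s *\<^sub>R w \<in> Zset x \<alpha>"
    using z w abs by (simp add: Zset_iff tmat_nth_add tmat_nth_scaleR)
qed

lemma Robj_expand: "Robj lam1 lam2 (z + e) = Robj lam1 lam2 z + DR lam1 lam2 z e + lam2 * (norm (Wm e))\<^sup>2"
proof -
  have "(norm (Wm z + Wm e))\<^sup>2 = (norm (Wm z))\<^sup>2 + 2 * (Wm z \<bullet> Wm e) + (norm (Wm e))\<^sup>2"
    by (simp add: power2_norm_eq_inner inner_add_left inner_add_right inner_commute)
  then show ?thesis
    by (simp add: Robj_eq DR_def esum_def sum.distrib algebra_simps)
qed

lemma DR_add: "DR lam1 lam2 z (d + e) = DR lam1 lam2 z d + DR lam1 lam2 z e"
  by (simp add: DR_def esum_def sum.distrib inner_add_right algebra_simps)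

lemma DR_scaleR: "DR lam1 lam2 z (s *\<^sub>R e) = s * DR lam1 lam2 z e"
  by (simp add: DR_def esum_def sum_distrib_left[symmetric] algebra_simps)

text \<open>First-order optimality on a convex set: compare \<open>zp\<close> with a point moved by
  a fraction \<open>s\<close> towards \<open>q\<close>, divide by \<open>s\<close> and let
  \<open>s\<close> tend to 0. The model is a quadratic polynomial along the segment, so the error is
  exactly \<open>s * C\<close>.\<close>

lemma prox_VI:
  assumes conv: "convex Z" and zp: "zp \<in> Z" and q: "q \<in> Z"
    and min: "\<And>w. w \<in> Z \<Longrightarrow> g \<bullet> (zp - z) + Robj lam1 lam2 zp + L / 2 * (norm (zp - z))\<^sup>2
       \<le> g \<bullet> (w - z) + Robj lam1 lam2 w + L / 2 * (norm (w - z))\<^sup>2"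
  shows "0 \<le> g \<bullet> (q - zp) + DR lam1 lam2 zp (q - zp) + L * ((zp - z) \<bullet> (q - zp))"
    (is "0 \<le> ?A")
proof -
  define e where "e = q - zp"
  define C where "C = lam2 * (norm (Wm e))\<^sup>2 + L / 2 * (norm e)\<^sup>2"
  have "0 \<le> ?A + s * C" if s: "0 < s" "s < 1" for s
  proof -
    have "zp + s *\<^sub>R e = (1 - s) *\<^sub>R zp + s *\<^sub>R q" by (simp add: e_def algebra_simps)
    also have "\<dots> \<in> Z" using conv zp q s by (simp add: convex_alt)
    finally have w: "zp + s *\<^sub>R e \<in> Z" .
    have n: "(norm (zp + s *\<^sub>R e - z))\<^sup>2 = (norm (zp - z))\<^sup>2 + 2 * s * ((zp - z) \<bullet> e) + s\<^sup>2 * (norm e)\<^sup>2"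
    proof -
      have "zp + s *\<^sub>R e - z = (zp - z) + s *\<^sub>R e" by simp
      then show ?thesis
        unfolding power2_norm_eq_inner
        by (simp only: inner_add_left inner_add_right inner_scaleR_left inner_scaleR_right)
           (simp add: inner_commute power2_eq_square algebra_simps)
    qed
    have g: "g \<bullet> (zp + s *\<^sub>R e - z) = g \<bullet> (zp - z) + s * (g \<bullet> e)"
      by (simp add: inner_add_right inner_diff_right)
    have "0 \<le> s * (g \<bullet> e) + s * DR lam1 lam2 zp e + lam2 * (s\<^sup>2 * (norm (Wm e))\<^sup>2)
        + L / 2 * (2 * s * ((zp - z) \<bullet> e) + s\<^sup>2 * (norm e)\<^sup>2)"
      using min[OF w] unfolding n g Robj_expand DR_scaleR by (simp add: power_mult_distrib algebra_simps)
    also have "\<dots> = s * (?A + s * C)"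
      unfolding C_def e_def[symmetric] by (simp add: power2_eq_square algebra_simps)
    finally show ?thesis using s by (simp add: zero_le_mult_iff)
  qed
  moreover have "((\<lambda>s. ?A + s * C) \<longlongrightarrow> ?A + 0 * C) (at_right 0)"
    by (intro tendsto_intros)
  moreover have "\<forall>\<^sub>F s in at_right 0. (0::real) < s \<and> s < 1"
    by (auto simp: eventually_at_right_field intro!: exI[of _ 1])
  ultimately have "0 \<le> ?A + 0 * C"
    by (intro tendsto_lowerbound[of "\<lambda>s. ?A + s * C"]) (auto elim!: eventually_mono)
  then show ?thesis by simp
qed

subsection \<open>Boundedness of the run\<close>

definition Psi :: "('n0::finite,'n1::finite,'N::finite) pt \<Rightarrow> real" where
  "Psi z = (norm (Wm z))\<^sup>2 + (norm (Bh z))\<^sup>2 + (norm (Vm z))\<^sup>2 + 2 * (norm (Bo z))\<^sup>2"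

text \<open>\<open>sig1\<close> is convex and enters with a minus sign, so the penalty is concave in
  \<open>z\<close>: its tangents lie above it and it adds no curvature to the descent
  estimates.\<close>

lemma Ptil_tangent:
  assumes "0 < \<mu>" "0 \<le> \<beta>"
  shows "Ptil x \<beta> w \<mu> \<le> Ptil x \<beta> z \<mu> + DP x \<beta> z \<mu> (w - z)"
proof -
  have "Vm w $ n $ j - sig1 \<mu> (tmat x w $ n $ j) \<le> Vm z $ n $ j - sig1 \<mu> (tmat x z $ n $ j)
     + (Vm (w - z) $ n $ j - dsig \<mu> (tmat x z $ n $ j) * tmat x (w - z) $ n $ j)" for n j
  proof -
    have "tmat x (w - z) $ n $ j = tmat x w $ n $ j - tmat x z $ n $ j"
      using tmat_nth_add[of x z "w - z" n j] by simp
    then show ?thesis using sig1_tangent[OF assms(1), of "tmat x z $ n $ j" "tmat x w $ n $ j"] by simp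
  qed
  then show ?thesis
    unfolding Ptil_eq DP_def distrib_left[symmetric] sum.distrib[symmetric]
    by (intro mult_left_mono sum_mono assms(2)) auto
qed

lemma DP_add: "DP x \<beta> z \<mu> (d + e) = DP x \<beta> z \<mu> d + DP x \<beta> z \<mu> e"
  unfolding DP_def by (simp add: tmat_nth_add sum.distrib algebra_simps sum_subtractf)

lemma DP_scaleR: "DP x \<beta> z \<mu> (s *\<^sub>R e) = s * DP x \<beta> z \<mu> e"
  unfolding DP_def tmat_nth_scaleR
  by (simp add: sum_distrib_left sum_subtractf algebra_simps)

lemma dumat_scaleR: "dumat z (s *\<^sub>R e) = s *\<^sub>R dumat z e"
  by (simp add: vec_eq_iff dumat_nth sum_distrib_left algebra_simps)

lemma DF_scaleR: "DF x z \<mu> (s *\<^sub>R e) = s * DF x z \<mu> e"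
  by (simp add: DF_def dumat_scaleR)

text \<open>Feasibility gives the sign: \<open>dsig \<mu> t * t \<le> pos t\<close>, and
  \<open>pos t\<close> is at most the corresponding entry of \<open>Vm z\<close>.\<close>

lemma DP_self_nonneg:
  assumes "0 < \<mu>" "0 \<le> \<beta>" "z \<in> Zset x \<alpha>"
  shows "0 \<le> DP x \<beta> z \<mu> z"
  unfolding DP_def using assms dsig_mult_le[OF assms(1)]
  by (auto intro!: mult_nonneg_nonneg sum_nonneg simp: Zset_iff) (meson order_trans)

lemma amgm_weighted:
  fixes a b L :: real
  assumes "0 < L"
  shows "a * b \<le> L / 2 * a\<^sup>2 + b\<^sup>2 / (2 * L)"
proof -
  have "0 \<le> (L * a - b)\<^sup>2 / (2 * L)" using assms by simp
  also have "\<dots> = L / 2 * a\<^sup>2 + b\<^sup>2 / (2 * L) - a * b"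
    using assms by (simp add: power2_diff field_simps power2_eq_square)
  finally show ?thesis by simp
qed

text \<open>Each term of the variational inequality, tested with the weighted inward field, has a
  role: the proximal term yields the difference of \<open>Psi\<close> and a negative square of the
  step, the penalty yields its own decrease, and the loss yields a bounded source
  \<open>c * frob2 x\<close> together with the reserve from \<open>dphi_mult_lower\<close>. The last
  hypothesis says that \<open>L\<close> is large enough for the negative square and the reserve to
  absorb the mixed terms.\<close>

lemma lyapunov_step:
  fixes x :: "'N::finite \<Rightarrow> real^'n0::finite" and z zp :: "('n0,'n1::finite,'N) pt"
  assumes m: "0 < \<mu>" and L: "0 < L" and pr: "0 \<le> \<beta>" "0 \<le> \<alpha>"
    and z: "z \<in> Zset x \<alpha>" and zp: "zp \<in> Zset x \<alpha>"
    and VI: "\<And>q. q \<in> Zset x \<alpha> \<Longrightarrow> 0 \<le> gradHtil x \<beta> z \<mu> \<bullet> (q - zp) + DR lam1 lam2 zp (q - zp) + L * ((zp - z) \<bullet> (q - zp))"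
    and c: "0 < c" "\<kappa> = 2 - 2 / c"
    and kap: "(norm (Wm z))\<^sup>2 + (norm (Vm z))\<^sup>2 + 2 * real CARD('N) \<le> \<kappa> * real CARD('N) * L"
  shows "Psi zp + 2 / L * (Ptil x \<beta> zp \<mu> + lam1 * (\<Sum>n\<in>UNIV. esum (Vm zp $ n)) + 2 * lam2 * (norm (Wm zp))\<^sup>2)
     \<le> Psi z + 2 / L * (Ptil x \<beta> z \<mu> + c * (frob2 x / real CARD('N)))"
proof -
  let ?N = "real CARD('N)"
  define d where "d = zp - z"
  have zpd: "zp = z + d" by (simp add: d_def)
  \<comment> \<open>Two feasible test points: one deletes \<open>W\<close>, \<open>b1\<close> and
    \<open>V\<close>, the other deletes \<open>b2\<close>. Weights 1 and 2 combine them to the field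
    with the homogeneity weights, which no single choice of \<open>q\<close> needs to
    realise.\<close>
  define qa :: "('n0,'n1,'N) pt" where "qa = (0, (0, Bo zp), 0)"
  define qb :: "('n0,'n1,'N) pt" where "qb = (Wm zp, (Bh zp, 0), Vm zp)"
  have qa: "qa \<in> Zset x \<alpha>" using zp pr by (simp add: qa_def Zset_iff tmat_nth pos_def)
  have qb: "qb \<in> Zset x \<alpha>" using zp pr by (simp add: qb_def Zset_iff tmat_nth)
  define E where "E = (qa - zp) + 2 *\<^sub>R (qb - zp)"
  have E: "Wm E = - Wm zp" "Bh E = - Bh zp" "Bo E = - 2 *\<^sub>R Bo zp" "Vm E = - Vm zp"
    by (simp_all add: E_def qa_def qb_def vec_eq_iff)
  have "0 \<le> gradHtil x \<beta> z \<mu> \<bullet> E + DR lam1 lam2 zp E + L * ((zp - z) \<bullet> E)"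
    using VI[OF qa] VI[OF qb] unfolding E_def DR_add DR_scaleR inner_add_right inner_scaleR_right
    by (simp add: algebra_simps)
  then have VE: "0 \<le> DF x z \<mu> E + DP x \<beta> z \<mu> E + DR lam1 lam2 zp E + L * (d \<bullet> E)"
    by (simp add: gradHtil_inner[OF m] d_def)
  \<comment> \<open>\<open>DP\<close> is linear in the direction and blind to \<open>b2\<close>, so
    the doubled weight there is invisible. Splitting \<open>zp\<close> into \<open>z\<close> and the
    step leaves one term of known sign and one bounded by concavity.\<close>
  have DPE: "DP x \<beta> z \<mu> E \<le> Ptil x \<beta> z \<mu> - Ptil x \<beta> zp \<mu>"
  proof -
    have "tmat x E $ n $ j = - tmat x zp $ n $ j" for n j
      by (simp add: tmat_nth E sum_negf)
    then have "DP x \<beta> z \<mu> E = - DP x \<beta> z \<mu> zp"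
      unfolding DP_def E by (simp add: sum_negf sum_subtractf algebra_simps)
    also have "\<dots> = - DP x \<beta> z \<mu> z - DP x \<beta> z \<mu> (zp - z)"
      using DP_add[of x \<beta> z \<mu> z d] by (simp add: d_def)
    finally show ?thesis
      using DP_self_nonneg[OF m pr(1) z] Ptil_tangent[OF m pr(1), of x zp z] by linarith
  qed
  have DRE: "DR lam1 lam2 zp E = - (lam1 * (\<Sum>n\<in>UNIV. esum (Vm zp $ n)) + 2 * lam2 * (norm (Wm zp))\<^sup>2)"
    by (simp add: DR_def E esum_def sum_negf power2_norm_eq_inner)
  \<comment> \<open>\<open>E\<close> is minus half the gradient of \<open>Psi\<close> at
    \<open>zp\<close>. Polarisation therefore turns the proximal term into the exact difference of
    \<open>Psi\<close> and the weighted square of the step.\<close>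
  have dE: "L * (d \<bullet> E) = - (L / 2) * (Psi zp - Psi z + (norm (Wm d))\<^sup>2 + (norm (Bh d))\<^sup>2 + (norm (Vm d))\<^sup>2 + 2 * (norm (Bo d))\<^sup>2)"
  proof -
    have *: "- (a \<bullet> b) * 2 = - (b \<bullet> b - (b - a) \<bullet> (b - a) + a \<bullet> a)" for a b :: "'a::real_inner"
      by (simp add: inner_diff_left inner_diff_right inner_commute)
    have "2 * (d \<bullet> E) = - (Wm d \<bullet> Wm zp) * 2 + - (Bh d \<bullet> Bh zp) * 2 + 2 * (- (Bo d \<bullet> Bo zp) * 2) + - (Vm d \<bullet> Vm zp) * 2"
      by (simp add: inner_prod_def E)
    also have "\<dots> = - (Psi zp - Psi z + (norm (Wm d))\<^sup>2 + (norm (Bh d))\<^sup>2 + (norm (Vm d))\<^sup>2 + 2 * (norm (Bo d))\<^sup>2)"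
      unfolding * by (simp add: Psi_def power2_norm_eq_inner d_def)
    finally have e: "2 * (d \<bullet> E) = - (Psi zp - Psi z + (norm (Wm d))\<^sup>2 + (norm (Bh d))\<^sup>2 + (norm (Vm d))\<^sup>2 + 2 * (norm (Bo d))\<^sup>2)" .
    have "L * (d \<bullet> E) = (L / 2) * (2 * (d \<bullet> E))" by simp
    also note e
    finally show ?thesis by (simp only: mult_minus_left mult_minus_right)
  qed
  define G where "G = gmat x \<mu> z"
  \<comment> \<open>The gradient is taken at \<open>z\<close> while \<open>E\<close> belongs to
    \<open>zp\<close>. Euler's identity for weighted homogeneity gives twice \<open>umat z\<close>,
    and \<open>Y\<close> collects the mismatch, which is linear in the step.\<close>
  define Y where "Y = Vm d ** Wm z + Vm z ** Wm d + 2 *\<^sub>R rep (Bo d)"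
  have DFE: "DF x z \<mu> E = - (2 * (G \<bullet> umat z) + G \<bullet> Y) / ?N"
  proof -
    have "dumat z E = - (2 *\<^sub>R umat z + Y)"
      by (simp add: vec_eq_iff dumat_nth umat_nth E Y_def rep_def matrix_matrix_mult_def zpd
          sum_negf sum_subtractf sum.distrib algebra_simps)
    then have "G \<bullet> dumat z E = - (2 * (G \<bullet> umat z) + G \<bullet> Y)"
      by (simp add: inner_add_right inner_diff_right)
    then show ?thesis by (simp add: DF_def G_def)
  qed
  have N: "0 < ?N" by simp
  \<comment> \<open>Each product is split by the arithmetic-geometric mean with weight
    \<open>L\<close>. The squared increments cancel against those of \<open>dE\<close>, and
    \<open>kap\<close> bounds the rest by exactly the multiple of the squared norm of
    \<open>G\<close> that \<open>GU\<close> holds in reserve.\<close>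
  have GY: "- (G \<bullet> Y) / ?N \<le> L / 2 * ((norm (Wm d))\<^sup>2 + (norm (Vm d))\<^sup>2 + 2 * (norm (Bo d))\<^sup>2) + \<kappa> / (2 * ?N) * (norm G)\<^sup>2"
  proof -
    have "- (G \<bullet> Y) \<le> norm G * norm Y" using norm_cauchy_schwarz[of "- G" Y] by simp
    also have "norm Y \<le> norm (Vm d) * norm (Wm z) + norm (Vm z) * norm (Wm d) + 2 * (sqrt ?N * norm (Bo d))"
      unfolding Y_def
      by (intro norm_triangle_mono norm_matrix_mult_le) (simp add: norm_rep)
    finally have "- (G \<bullet> Y) \<le> norm G * (norm (Vm d) * norm (Wm z) + norm (Vm z) * norm (Wm d) + 2 * (sqrt ?N * norm (Bo d)))"
      by (simp add: mult_left_mono)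
    then have "- (G \<bullet> Y) / ?N \<le> norm G * (norm (Vm d) * norm (Wm z) + norm (Vm z) * norm (Wm d) + 2 * (sqrt ?N * norm (Bo d))) / ?N"
      using N by (intro divide_right_mono) auto
    also have "\<dots> = norm (Vm d) * (norm G * norm (Wm z) / ?N) + norm (Wm d) * (norm G * norm (Vm z) / ?N)
        + 2 * (norm (Bo d) * (norm G * sqrt ?N / ?N))"
      by (simp add: add_divide_distrib algebra_simps)
    also have "\<dots> \<le> (L / 2 * (norm (Vm d))\<^sup>2 + (norm G * norm (Wm z) / ?N)\<^sup>2 / (2 * L))
       + (L / 2 * (norm (Wm d))\<^sup>2 + (norm G * norm (Vm z) / ?N)\<^sup>2 / (2 * L))
       + 2 * (L / 2 * (norm (Bo d))\<^sup>2 + (norm G * sqrt ?N / ?N)\<^sup>2 / (2 * L))"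
      by (intro add_mono mult_left_mono amgm_weighted L) auto
    also have "\<dots> = L / 2 * ((norm (Wm d))\<^sup>2 + (norm (Vm d))\<^sup>2 + 2 * (norm (Bo d))\<^sup>2)
       + (norm G)\<^sup>2 * ((norm (Wm z))\<^sup>2 + (norm (Vm z))\<^sup>2 + 2 * ?N) / (2 * L * ?N\<^sup>2)"
      using N by (simp add: power_mult_distrib power_divide add_divide_distrib algebra_simps)
    also have "\<dots> \<le> L / 2 * ((norm (Wm d))\<^sup>2 + (norm (Vm d))\<^sup>2 + 2 * (norm (Bo d))\<^sup>2)
       + (norm G)\<^sup>2 * (\<kappa> * ?N * L) / (2 * L * ?N\<^sup>2)"
      using kap L by (intro add_left_mono divide_right_mono mult_left_mono) auto
    also have "(norm G)\<^sup>2 * (\<kappa> * ?N * L) / (2 * L * ?N\<^sup>2) = \<kappa> / (2 * ?N) * (norm G)\<^sup>2"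
      using L N by (simp add: power2_eq_square field_simps)
    finally show ?thesis .
  qed
  have GU: "- c * frob2 x \<le> 2 * (G \<bullet> umat z) - \<kappa> / 2 * (norm G)\<^sup>2"
  proof -
    have "- c * frob2 x = (\<Sum>n\<in>UNIV. \<Sum>i\<in>UNIV. - c * (x n $ i)\<^sup>2)"
      by (simp add: frob2_def norm_vec_square sum_distrib_left sum_negf)
    also have "\<dots> \<le> (\<Sum>n\<in>UNIV. \<Sum>i\<in>UNIV. 2 * dphi (x n $ i) \<mu> (umat z $ n $ i) * (umat z $ n $ i) - \<kappa> / 2 * (dphi (x n $ i) \<mu> (umat z $ n $ i))\<^sup>2)"
      by (intro sum_mono dphi_mult_lower m c)
    also have "\<dots> = 2 * (G \<bullet> umat z) - \<kappa> / 2 * (norm G)\<^sup>2"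
      by (simp add: G_def gmat_def inner_mat norm_mat_square sum_subtractf sum_distrib_left mult.assoc)
    finally show ?thesis .
  qed
  have "- (2 * (G \<bullet> umat z)) / ?N \<le> c * (frob2 x / ?N) - \<kappa> / (2 * ?N) * (norm G)\<^sup>2"
  proof -
    have "- (2 * (G \<bullet> umat z)) / ?N \<le> (c * frob2 x - \<kappa> / 2 * (norm G)\<^sup>2) / ?N"
      using GU N by (intro divide_right_mono) auto
    also have "\<dots> = c * (frob2 x / ?N) - \<kappa> / (2 * ?N) * (norm G)\<^sup>2" using N by (simp add: field_simps)
    finally show ?thesis .
  qed
  moreover have "DF x z \<mu> E = - (2 * (G \<bullet> umat z)) / ?N + - (G \<bullet> Y) / ?N"
    unfolding DFE by (simp add: add_divide_distrib diff_divide_distrib)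
  ultimately have DFle: "DF x z \<mu> E \<le> c * (frob2 x / ?N) + L / 2 * ((norm (Wm d))\<^sup>2 + (norm (Vm d))\<^sup>2 + 2 * (norm (Bo d))\<^sup>2)"
    using GY by linarith
  have "0 \<le> c * (frob2 x / ?N) + L / 2 * ((norm (Wm d))\<^sup>2 + (norm (Vm d))\<^sup>2 + 2 * (norm (Bo d))\<^sup>2)
     + (Ptil x \<beta> z \<mu> - Ptil x \<beta> zp \<mu>) - (lam1 * (\<Sum>n\<in>UNIV. esum (Vm zp $ n)) + 2 * lam2 * (norm (Wm zp))\<^sup>2)
     + - (L / 2) * (Psi zp - Psi z + (norm (Wm d))\<^sup>2 + (norm (Bh d))\<^sup>2 + (norm (Vm d))\<^sup>2 + 2 * (norm (Bo d))\<^sup>2)"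
    using VE DFle DPE unfolding DRE dE by linarith
  then have "L / 2 * (Psi zp - Psi z) \<le> c * (frob2 x / ?N) + (Ptil x \<beta> z \<mu> - Ptil x \<beta> zp \<mu>)
      - (lam1 * (\<Sum>n\<in>UNIV. esum (Vm zp $ n)) + 2 * lam2 * (norm (Wm zp))\<^sup>2) - L / 2 * (norm (Bh d))\<^sup>2"
    by (simp add: algebra_simps diff_divide_distrib)
  moreover have "0 \<le> L / 2 * (norm (Bh d))\<^sup>2" using L by simp
  ultimately have "L / 2 * (Psi zp - Psi z) \<le> c * (frob2 x / ?N) + (Ptil x \<beta> z \<mu> - Ptil x \<beta> zp \<mu>)
      - (lam1 * (\<Sum>n\<in>UNIV. esum (Vm zp $ n)) + 2 * lam2 * (norm (Wm zp))\<^sup>2)" by linarith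
  then have "2 / L * (L / 2 * (Psi zp - Psi z)) \<le> 2 / L * (c * (frob2 x / ?N) + (Ptil x \<beta> z \<mu> - Ptil x \<beta> zp \<mu>)
      - (lam1 * (\<Sum>n\<in>UNIV. esum (Vm zp $ n)) + 2 * lam2 * (norm (Wm zp))\<^sup>2))"
    using L by (intro mult_left_mono) auto
  then show ?thesis using L by (simp add: distrib_left right_diff_distrib)
qed

section \<open>Size of feasible points with small regulariser\<close>

lemma Vm_nonneg: "z \<in> Zset x \<alpha> \<Longrightarrow> 0 \<le> Vm z $ n $ j"
  unfolding Zset_iff by (meson order_trans pos_nonneg)

lemma esum_nonneg: "z \<in> Zset x \<alpha> \<Longrightarrow> 0 \<le> esum (Vm z $ n)"
  unfolding esum_def by (intro sum_nonneg) (rule Vm_nonneg)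

lemma norm_V_le_sum:
  assumes "z \<in> Zset x \<alpha>"
  shows "norm (Vm z) \<le> (\<Sum>n\<in>UNIV. esum (Vm z $ n))"
proof -
  have "norm (Vm z) \<le> (\<Sum>n\<in>UNIV. norm (Vm z $ n))"
    unfolding norm_vec_def by (rule L2_set_le_sum) auto
  also have "\<dots> \<le> (\<Sum>n\<in>UNIV. esum (Vm z $ n))"
  proof (rule sum_mono)
    fix n
    have "norm (Vm z $ n) \<le> (\<Sum>j\<in>UNIV. norm (Vm z $ n $ j))"
      unfolding norm_vec_def[of "Vm z $ n"] by (rule L2_set_le_sum) auto
    also have "\<dots> = esum (Vm z $ n)"
      unfolding esum_def using assms
      by (intro sum.cong refl) (simp add: Vm_nonneg)
    finally show "norm (Vm z $ n) \<le> esum (Vm z $ n)" .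
  qed
  finally show ?thesis .
qed

lemma norm_vec_square_le_card:
  assumes "\<And>i. \<bar>(v :: real^'n) $ i\<bar> \<le> a"
  shows "(norm v)\<^sup>2 \<le> real CARD('n) * a\<^sup>2"
proof -
  have "(norm v)\<^sup>2 \<le> (\<Sum>i\<in>(UNIV::'n set). a\<^sup>2)"
    unfolding norm_vec_square
    using power_mono[OF assms abs_ge_zero, where n = 2] by (intro sum_mono) simp
  then show ?thesis by simp
qed

lemma Ptil_nonneg:
  assumes "0 < \<mu>" "0 \<le> \<beta>" "z \<in> Zset x \<alpha>"
  shows "0 \<le> Ptil x \<beta> z \<mu>"
  unfolding Ptil_eq using assms sig1_le_pos[OF assms(1)]
  by (auto intro!: mult_nonneg_nonneg sum_nonneg simp: Zset_iff) (meson order_trans)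

lemma Ptil_le_sum:
  assumes "0 < \<mu>" "0 \<le> \<beta>"
  shows "Ptil x \<beta> z \<mu> \<le> \<beta> * (\<Sum>n\<in>UNIV. esum (Vm z $ n))"
  unfolding Ptil_eq esum_def using sig1_nonneg[OF assms(1)]
  by (intro mult_left_mono sum_mono assms(2)) auto

lemma Ptil_mono:
  assumes "0 < \<mu>'" "\<mu>' \<le> \<mu>" "0 \<le> \<beta>"
  shows "Ptil x \<beta> z \<mu>' \<le> Ptil x \<beta> z \<mu>"
  unfolding Ptil_eq using sig1_antimono[OF assms(1,2)]
  by (intro mult_left_mono sum_mono assms(3)) auto

text \<open>The level \<open>c\<close> is shared. If \<open>V\<close> takes the part
  \<open>q\<close>, then \<open>norm (Vm z)\<close> is at most \<open>q * \<eta>\<close> and the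
  square of \<open>norm (Wm z)\<close> at most \<open>(c - q) * \<eta>\<^sup>2\<close>. Since
  \<open>c\<close> is at least 1, \<open>q\<^sup>2 + (c - q)\<close> never exceeds
  \<open>c\<^sup>2\<close> for \<open>q\<close> between 0 and \<open>c\<close>; adding the separate
  maxima would cost an extra \<open>c\<close>. The biases are bounded by the box.\<close>

lemma Psi_le_of_small:
  fixes z :: "('n0::finite,'n1::finite,'N::finite) pt"
  assumes z: "z \<in> Zset x \<alpha>" and pr: "0 < lam1" "0 < lam2" "0 < \<theta>" "0 < \<eta>"
    and eta: "\<theta> / lam1 \<le> \<eta>" "\<theta> / lam2 \<le> \<eta>\<^sup>2" and c: "1 \<le> c"
    and R: "lam1 * (\<Sum>n\<in>UNIV. esum (Vm z $ n)) + lam2 * (norm (Wm z))\<^sup>2 \<le> c * \<theta>"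
  shows "Psi z \<le> c\<^sup>2 * \<eta>\<^sup>2 + (real CARD('n1) + 2 * real CARD('n0)) * \<alpha>\<^sup>2"
proof -
  define S where "S = (\<Sum>n\<in>UNIV. esum (Vm z $ n))"
  have S0: "0 \<le> S" unfolding S_def by (intro sum_nonneg esum_nonneg[OF z])
  define q where "q = lam1 * S / \<theta>"
  have q0: "0 \<le> q" using S0 pr by (simp add: q_def)
  have W: "(norm (Wm z))\<^sup>2 \<le> (c - q) * (\<theta> / lam2)"
  proof -
    have "lam2 * (norm (Wm z))\<^sup>2 \<le> (c - q) * \<theta>"
      using R pr by (simp add: q_def S_def[symmetric] algebra_simps)
    then show ?thesis using pr by (simp add: field_simps)
  qed
  have "0 \<le> (c - q) * (\<theta> / lam2)" by (rule order_trans[OF _ W]) simp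
  then have qc: "q \<le> c" using pr by (simp add: zero_le_mult_iff zero_le_divide_iff)
  have W2: "(norm (Wm z))\<^sup>2 \<le> (c - q) * \<eta>\<^sup>2"
    using W mult_left_mono[OF eta(2), of "c - q"] qc by linarith
  have "norm (Vm z) \<le> S" unfolding S_def by (rule norm_V_le_sum[OF z])
  also have "S = q * (\<theta> / lam1)" using pr by (simp add: q_def)
  also have "\<dots> \<le> q * \<eta>" using q0 eta by (intro mult_left_mono) auto
  finally have "(norm (Vm z))\<^sup>2 \<le> (q * \<eta>)\<^sup>2" by (intro power_mono) auto
  then have V2: "(norm (Vm z))\<^sup>2 \<le> q\<^sup>2 * \<eta>\<^sup>2" by (simp add: power_mult_distrib)
  have "c\<^sup>2 - (q\<^sup>2 + (c - q)) = (c - q) * (c + q - 1)"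
    by (simp add: power2_eq_square algebra_simps)
  also have "\<dots> \<ge> 0" using qc q0 c by simp
  finally have "(q\<^sup>2 + (c - q)) * \<eta>\<^sup>2 \<le> c\<^sup>2 * \<eta>\<^sup>2" by (intro mult_right_mono) auto
  moreover have "(norm (Bh z))\<^sup>2 \<le> real CARD('n1) * \<alpha>\<^sup>2" "(norm (Bo z))\<^sup>2 \<le> real CARD('n0) * \<alpha>\<^sup>2"
    using z by (auto intro!: norm_vec_square_le_card simp: Zset_iff)
  ultimately show ?thesis using W2 V2 unfolding Psi_def by (simp add: algebra_simps)
qed

lemma norm_pt_square: "(norm w)\<^sup>2 = (norm (Wm w))\<^sup>2 + (norm (Bh w))\<^sup>2 + (norm (Bo w))\<^sup>2 + (norm (Vm w))\<^sup>2"
  for w :: "('n0::finite,'n1::finite,'N::finite) pt"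
  unfolding power2_norm_eq_inner by (simp add: inner_prod_def)

text \<open>The run together with an abstract budget. \<open>kap\<close> keeps the Lyapunov function
  below \<open>B\<close>; the second part of \<open>X\<close> lets the step parameter beat the
  curvature \<open>X / \<mu>\<close> of the loss; \<open>8 * \<beta> \<le> \<eta> * c0\<close>
  produces the summand \<open>c / 4\<close> in \<open>B\<close>. The prox step appears only through
  its variational inequality.\<close>

locale spg_run =
  fixes x :: "'N::finite \<Rightarrow> real^'n0::finite"
    and lam1 lam2 \<beta> \<theta> \<alpha> \<eta> c0 tau1 tau2 tau3 c \<kappa> B X :: real
    and z :: "nat \<Rightarrow> ('n0, 'n1::finite, 'N) pt"
    and \<mu> L :: "nat \<Rightarrow> real"
  assumes pr: "lam1 > 0" "lam2 > 0" "\<beta> > 0" "\<theta> > 0" "\<eta> > 0" "\<alpha> \<ge> 0"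
    and theta: "frob2 x / real CARD('N) \<le> \<theta>"
    and eta: "\<theta> / lam1 \<le> \<eta>" "\<theta> / lam2 \<le> \<eta>\<^sup>2"
    and init: "z 0 \<in> Zset x \<alpha>" "0 < \<mu> 0" "\<mu> 0 < 1" "0 < tau1" "tau1 < 1" "tau2 > 0" "tau3 \<ge> 1" "L 0 \<ge> 1"
    and R0: "Robj lam1 lam2 (z 0) \<le> \<theta>"
    and step_in: "\<And>k. z (Suc k) \<in> Zset x \<alpha>"
    and step_VI: "\<And>k q. q \<in> Zset x \<alpha> \<Longrightarrow> 0 \<le> gradHtil x \<beta> (z k) (\<mu> k) \<bullet> (q - z (Suc k))
       + DR lam1 lam2 (z (Suc k)) (q - z (Suc k)) + L k * ((z (Suc k) - z k) \<bullet> (q - z (Suc k)))"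
    and update: "\<And>k. (\<mu> (Suc k), L (Suc k)) =
       (if Otil x lam1 lam2 \<beta> (z (Suc k)) (\<mu> k) - Otil x lam1 lam2 \<beta> (z k) (\<mu> k) < - tau2 * \<mu> k / L k
        then (\<mu> k, L k) else (tau1 * \<mu> k, tau3 * L k))"
    and tau13: "tau1 * tau3 \<ge> 1"
    and c0: "c0 \<le> \<mu> 0 * L 0" "0 < c0" "8 * \<beta> \<le> \<eta> * c0"
    and c: "1 \<le> c" "\<kappa> = 2 - 2 / c"
    and B: "B = (c\<^sup>2 + c / 4) * \<eta>\<^sup>2 + (real CARD('n1) + 2 * real CARD('n0)) * \<alpha>\<^sup>2"
    and kap: "2 + B / real CARD('N) \<le> \<kappa> * c0"
    and X: "\<And>n i. \<bar>x n $ i\<bar> \<le> X" "X * (1 + B / real CARD('N)) < c0"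
begin

lemma kappa_nonneg: "0 \<le> \<kappa>"
proof -
  have "2 / c \<le> 2" using c(1) by (simp add: divide_le_eq)
  then show ?thesis using c(2) by simp
qed

text \<open>A reduction multiplies the product of \<open>\<mu>\<close> and \<open>L\<close> by
  \<open>tau1 * tau3\<close>, which is at least 1, so the initial bound \<open>c0\<close> survives
  forever. Since \<open>\<mu>\<close> stays below 1, also \<open>L\<close> stays above
  \<open>c0\<close>.\<close>

lemma mu_L: "0 < \<mu> k \<and> \<mu> k < 1 \<and> 1 \<le> L k \<and> c0 \<le> \<mu> k * L k"
proof (induction k)
  case 0
  then show ?case using init c0 by auto
next
  case (Suc k)
  consider "\<mu> (Suc k) = \<mu> k" "L (Suc k) = L k" | "\<mu> (Suc k) = tau1 * \<mu> k" "L (Suc k) = tau3 * L k"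
    using update[of k] by (auto split: if_splits)
  then show ?case
  proof cases
    case 2
    have "tau1 * \<mu> k < 1" using Suc init mult_strict_mono[of tau1 1 "\<mu> k" 1] by auto
    moreover have "1 * 1 \<le> tau3 * L k" using Suc init by (intro mult_mono) auto
    moreover have "c0 \<le> (tau1 * tau3) * (\<mu> k * L k)"
    proof -
      have "1 * (\<mu> k * L k) \<le> (tau1 * tau3) * (\<mu> k * L k)"
        using tau13 Suc by (intro mult_right_mono) auto
      then show ?thesis using Suc by linarith
    qed
    ultimately show ?thesis using Suc 2 init by (auto simp: algebra_simps)
  qed (use Suc in auto)
qed

lemma mu_antimono: "\<mu> (Suc k) \<le> \<mu> k" and L_mono: "L k \<le> L (Suc k)"
proof -
  have "tau1 * \<mu> k \<le> 1 * \<mu> k" "1 * L k \<le> tau3 * L k"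
    using mu_L[of k] init by (intro mult_right_mono; simp)+
  then show "\<mu> (Suc k) \<le> \<mu> k" "L k \<le> L (Suc k)"
    using update[of k] by (auto split: if_splits)
qed

lemma z_in: "z k \<in> Zset x \<alpha>"
  using init step_in by (cases k) auto

lemma c0_le_L: "c0 \<le> L k"
proof -
  have "\<mu> k * L k \<le> 1 * L k" using mu_L[of k] by (intro mult_right_mono) auto
  then show ?thesis using mu_L[of k] by linarith
qed

text \<open>The penalty is at most \<open>\<beta>\<close> times the sum of the entries of
  \<open>V\<close>, hence at most \<open>\<beta> * c * \<eta>\<close>, and \<open>L\<close> is at
  least \<open>8 * \<beta> / \<eta>\<close>.\<close>

lemma penalty_small:
  assumes "lam1 * (\<Sum>n\<in>UNIV. esum (Vm w $ n)) \<le> c * \<theta>"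
  shows "2 / L k * Ptil x \<beta> w (\<mu> k) \<le> c / 4 * \<eta>\<^sup>2"
proof -
  have "(\<Sum>n\<in>UNIV. esum (Vm w $ n)) \<le> c * (\<theta> / lam1)" using assms pr by (simp add: field_simps)
  also have "\<dots> \<le> c * \<eta>" using eta c by (intro mult_left_mono) auto
  finally have S: "(\<Sum>n\<in>UNIV. esum (Vm w $ n)) \<le> c * \<eta>" .
  have "Ptil x \<beta> w (\<mu> k) \<le> \<beta> * (\<Sum>n\<in>UNIV. esum (Vm w $ n))"
    using mu_L[of k] pr by (intro Ptil_le_sum) auto
  also have "\<dots> \<le> \<beta> * (c * \<eta>)" using S pr by (intro mult_left_mono) auto
  also have "\<dots> = (8 * \<beta>) * (c * \<eta> / 8)" by simp
  also have "\<dots> \<le> (\<eta> * L k) * (c * \<eta> / 8)"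
    using order_trans[OF c0(3) mult_left_mono[OF c0_le_L[of k], of \<eta>]] pr c
    by (intro mult_right_mono) auto
  finally show ?thesis using mu_L[of k] by (simp add: field_simps power2_eq_square)
qed

lemma small_invariant:
  assumes "z k \<in> Zset x \<alpha>" "lam1 * (\<Sum>n\<in>UNIV. esum (Vm (z k) $ n)) + lam2 * (norm (Wm (z k)))\<^sup>2 \<le> c * \<theta>"
  shows "Psi (z k) + 2 / L m * Ptil x \<beta> (z k) (\<mu> m) \<le> B"
proof -
  have "0 \<le> lam2 * (norm (Wm (z k)))\<^sup>2" using pr by simp
  then have "lam1 * (\<Sum>n\<in>UNIV. esum (Vm (z k) $ n)) \<le> c * \<theta>" using assms(2) by linarith
  from penalty_small[OF this, of m] Psi_le_of_small[OF assms(1) pr(1,2,4,5) eta c(1) assms(2)]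
  show ?thesis unfolding B by (simp add: algebra_simps)
qed

text \<open>The bound feeds itself: it supplies the size of \<open>W\<close> and \<open>V\<close>
  that \<open>lyapunov_step\<close> requires in order to propagate it.\<close>

lemma invariant: "Psi (z k) + 2 / L k * Ptil x \<beta> (z k) (\<mu> k) \<le> B"
proof (induction k)
  case 0
  have "\<theta> \<le> c * \<theta>" using c pr by simp
  then show ?case using R0 by (intro small_invariant init) (simp add: Robj_eq)
next
  case (Suc k)
  let ?R = "lam1 * (\<Sum>n\<in>UNIV. esum (Vm (z (Suc k)) $ n)) + 2 * lam2 * (norm (Wm (z (Suc k))))\<^sup>2"
  have L: "0 < L k" "1 \<le> L k" "0 < L (Suc k)" using mu_L[of k] mu_L[of "Suc k"] by auto
  have P: "0 \<le> Ptil x \<beta> (z j) (\<mu> m)" for j m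
    using Ptil_nonneg[OF _ _ z_in[of j]] mu_L[of m] pr by auto
  have Psi0: "(norm (Wm (z k)))\<^sup>2 + (norm (Vm (z k)))\<^sup>2 \<le> B"
  proof -
    have "0 \<le> 2 / L k * Ptil x \<beta> (z k) (\<mu> k)" using P[of k k] L by simp
    then have "Psi (z k) \<le> B" using Suc by linarith
    moreover have "0 \<le> (norm (Bh (z k)))\<^sup>2" "0 \<le> (norm (Bo (z k)))\<^sup>2" by auto
    ultimately show ?thesis unfolding Psi_def by linarith
  qed
  have kk: "B + 2 * real CARD('N) \<le> \<kappa> * real CARD('N) * L k"
  proof -
    have "(2 + B / real CARD('N)) * real CARD('N) \<le> (\<kappa> * L k) * real CARD('N)"
      using kap mult_left_mono[OF c0_le_L[of k] kappa_nonneg] by (intro mult_right_mono) auto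
    then show ?thesis by (simp add: algebra_simps)
  qed
  have "Psi (z (Suc k)) + 2 / L k * (Ptil x \<beta> (z (Suc k)) (\<mu> k) + lam1 * (\<Sum>n\<in>UNIV. esum (Vm (z (Suc k)) $ n)) + 2 * lam2 * (norm (Wm (z (Suc k))))\<^sup>2)
     \<le> Psi (z k) + 2 / L k * (Ptil x \<beta> (z k) (\<mu> k) + c * (frob2 x / real CARD('N)))"
    by (rule lyapunov_step[OF _ L(1) _ pr(6) z_in step_in step_VI _ c(2)])
       (use mu_L[of k] pr c Psi0 kk in auto)
  then have main: "Psi (z (Suc k)) + 2 / L k * Ptil x \<beta> (z (Suc k)) (\<mu> k)
      \<le> (Psi (z k) + 2 / L k * Ptil x \<beta> (z k) (\<mu> k)) + 2 / L k * (c * (frob2 x / real CARD('N)) - ?R)"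
    by (simp add: distrib_left right_diff_distrib)
  \<comment> \<open>The parameters change after the step. A larger \<open>L\<close> and a smaller
    \<open>\<mu>\<close> both decrease the penalty part, so the Lyapunov function may be read with
    the new parameters.\<close>
  have shrink: "2 / L (Suc k) * Ptil x \<beta> (z (Suc k)) (\<mu> (Suc k)) \<le> 2 / L k * Ptil x \<beta> (z (Suc k)) (\<mu> k)"
    using L_mono[of k] L P[of "Suc k" k] P[of "Suc k" "Suc k"] mu_antimono[of k] mu_L[of "Suc k"] pr
    by (intro mult_mono Ptil_mono divide_left_mono) auto
  \<comment> \<open>If the weighted regulariser is below \<open>c * \<theta>\<close>, the new point
    satisfies the bound by its size alone; otherwise it outweighs the source term, which is at most
    \<open>c * \<theta>\<close>, and the Lyapunov function does not grow.\<close>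
  show ?case
  proof (cases "?R \<le> c * \<theta>")
    case True
    have "0 \<le> lam2 * (norm (Wm (z (Suc k))))\<^sup>2" using pr by simp
    then show ?thesis using True by (intro small_invariant step_in) linarith
  next
    case False
    have "c * (frob2 x / real CARD('N)) \<le> c * \<theta>" using theta c by (intro mult_left_mono) auto
    then have "c * (frob2 x / real CARD('N)) - ?R \<le> 0" using False by linarith
    then have "2 / L k * (c * (frob2 x / real CARD('N)) - ?R) \<le> 0"
      using L by (intro mult_nonneg_nonpos) auto
    then show ?thesis using main shrink Suc by linarith
  qed
qed

lemma Psi_le: "Psi (z k) \<le> B"
proof -
  have "0 \<le> 2 / L k * Ptil x \<beta> (z k) (\<mu> k)"
    using Ptil_nonneg[OF _ _ z_in[of k], of "\<mu> k" \<beta>] mu_L[of k] pr by auto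
  then show ?thesis using invariant[of k] by linarith
qed

lemma B_nonneg: "0 \<le> B"
  using Psi_le[of 0] by (rule order_trans[rotated]) (simp add: Psi_def)

lemma norm_z_le: "norm (z k) \<le> sqrt B"
proof -
  have "(norm (z k))\<^sup>2 \<le> Psi (z k)" unfolding norm_pt_square Psi_def by simp
  then show ?thesis using Psi_le[of k] by (intro real_le_rsqrt) linarith
qed

end

subsection \<open>Vanishing residuals at the reduction steps\<close>

lemma umat_add: "umat (z + d) = umat z + dumat z d + Vm d ** Wm d"
  by (simp add: vec_eq_iff umat_nth dumat_nth matrix_matrix_mult_def sum.distrib algebra_simps)

text \<open>A bilinear map has exact differences when the other factor is taken at the midpoint. No
  second-order term remains, and by convexity of the squared norm the midpoints satisfy the same
  bound \<open>B\<close> as the end points.\<close>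

lemma umat_diff_midpoint:
  "umat w - umat z = ((1/2) *\<^sub>R (Vm z + Vm w)) ** Wm (w - z) + Vm (w - z) ** ((1/2) *\<^sub>R (Wm z + Wm w)) + rep (Bo (w - z))"
proof -
  have "(\<Sum>j\<in>UNIV. Vm w $ n $ j * Wm w $ j $ i) - (\<Sum>j\<in>UNIV. Vm z $ n $ j * Wm z $ j $ i)
     = (\<Sum>j\<in>UNIV. (Vm z $ n $ j + Vm w $ n $ j) / 2 * (Wm w $ j $ i - Wm z $ j $ i))
     + (\<Sum>j\<in>UNIV. (Vm w $ n $ j - Vm z $ n $ j) * ((Wm z $ j $ i + Wm w $ j $ i) / 2))" for n i
    unfolding sum_subtractf[symmetric] sum.distrib[symmetric]
    by (intro sum.cong refl) (simp add: field_simps)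
  then show ?thesis
    by (simp add: vec_eq_iff umat_nth rep_def matrix_matrix_mult_def)
qed

lemma norm_parts_le:
  fixes w :: "('n0::finite,'n1::finite,'N::finite) pt"
  shows "norm (Wm w) \<le> norm w" "norm (Bh w) \<le> norm w" "norm (Bo w) \<le> norm w" "norm (Vm w) \<le> norm w"
  by (rule power2_le_imp_le; simp add: norm_pt_square)+

lemma midpoint_square: "(norm ((1/2) *\<^sub>R (a + b)))\<^sup>2 \<le> ((norm a)\<^sup>2 + (norm b)\<^sup>2) / 2"
  for a b :: "'a::real_inner"
proof -
  have "0 \<le> (a - b) \<bullet> (a - b)" by simp
  then show ?thesis
    unfolding power2_norm_eq_inner by (simp add: inner_add_left inner_add_right inner_diff_left inner_diff_right inner_commute)
qed

lemma cauchy3: "(a * p + b * q + c * r)\<^sup>2 \<le> (a\<^sup>2 + b\<^sup>2 + c\<^sup>2) * (p\<^sup>2 + q\<^sup>2 + r\<^sup>2)"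
  for a b c p q r :: real
proof -
  have "0 \<le> (a * q - b * p)\<^sup>2 + (a * r - c * p)\<^sup>2 + (b * r - c * q)\<^sup>2" by simp
  then show ?thesis by (simp add: power2_eq_square algebra_simps)
qed

lemma umat_diff_le:
  fixes z w :: "('n0::finite,'n1::finite,'N::finite) pt"
  assumes z: "(norm (Wm z))\<^sup>2 + (norm (Vm z))\<^sup>2 \<le> B" and w: "(norm (Wm w))\<^sup>2 + (norm (Vm w))\<^sup>2 \<le> B"
  shows "(norm (umat w - umat z))\<^sup>2 \<le> (B + real CARD('N)) * (norm (w - z))\<^sup>2"
proof -
  let ?V = "norm ((1/2) *\<^sub>R (Vm z + Vm w))" and ?W = "norm ((1/2) *\<^sub>R (Wm z + Wm w))" and ?d = "w - z"
  have "norm (umat w - umat z) \<le> ?V * norm (Wm ?d) + norm (Vm ?d) * ?W + sqrt (real CARD('N)) * norm (Bo ?d)"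
    unfolding umat_diff_midpoint norm_rep[symmetric]
    by (intro norm_triangle_mono norm_matrix_mult_le order_refl)
  then have "(norm (umat w - umat z))\<^sup>2 \<le> (?V * norm (Wm ?d) + ?W * norm (Vm ?d) + sqrt (real CARD('N)) * norm (Bo ?d))\<^sup>2"
    by (intro power_mono) (auto simp: mult.commute)
  also have "\<dots> \<le> (?V\<^sup>2 + ?W\<^sup>2 + (sqrt (real CARD('N)))\<^sup>2) * ((norm (Wm ?d))\<^sup>2 + (norm (Vm ?d))\<^sup>2 + (norm (Bo ?d))\<^sup>2)"
    by (rule cauchy3)
  also have "\<dots> \<le> (B + real CARD('N)) * (norm ?d)\<^sup>2"
  proof (intro mult_mono)
    show "?V\<^sup>2 + ?W\<^sup>2 + (sqrt (real CARD('N)))\<^sup>2 \<le> B + real CARD('N)"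
      using midpoint_square[of "Vm z" "Vm w"] midpoint_square[of "Wm z" "Wm w"] z w by simp
    have "0 \<le> (norm (Wm z))\<^sup>2 + (norm (Vm z))\<^sup>2" by simp
    then show "0 \<le> B + real CARD('N)" using z by linarith
  qed (auto simp: norm_pt_square)
  finally show ?thesis .
qed

lemma gmat_le: "norm (gmat x \<mu> z) \<le> 2 * norm (umat z) + 2 * norm (vec_lambda x)"
  if "0 < \<mu>" for x :: "'N::finite \<Rightarrow> real^'n0::finite" and z :: "('n0,'n1::finite,'N) pt"
proof -
  have "gmat x \<mu> z = 2 *\<^sub>R (\<chi> n i. pos (umat z $ n $ i)) - 2 *\<^sub>R (\<chi> n i. x n $ i * dsig \<mu> (umat z $ n $ i))"
    by (simp add: vec_eq_iff gmat_def dphi_def)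
  then have "norm (gmat x \<mu> z) \<le> norm (2 *\<^sub>R (\<chi> n i. pos (umat z $ n $ i)) :: real^'n0^'N)
      + norm (2 *\<^sub>R (\<chi> n i. x n $ i * dsig \<mu> (umat z $ n $ i)) :: real^'n0^'N)"
    by (simp only: norm_triangle_ineq4)
  also have "\<dots> \<le> 2 * norm (umat z) + 2 * norm (vec_lambda x)"
  proof -
    have "norm ((\<chi> n i. pos (umat z $ n $ i)) :: real^'n0^'N) \<le> norm (umat z)"
      by (intro norm_le_componentwise_cart) (simp add: pos_def abs_if max_def)
    moreover have "norm ((\<chi> n i. x n $ i * dsig \<mu> (umat z $ n $ i)) :: real^'n0^'N) \<le> norm (vec_lambda x)"
      using dsig_nonneg[OF that] dsig_le_1[OF that]
      by (intro norm_le_componentwise_cart) (simp add: abs_mult mult_left_le)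
    ultimately show ?thesis by simp
  qed
  finally show ?thesis .
qed

lemma umat_le: "norm (umat z) \<le> norm (Vm z) * norm (Wm z) + sqrt (real CARD('N)) * norm (Bo z)"
  for z :: "('n0::finite,'n1::finite,'N::finite) pt"
  unfolding umat_def norm_rep[symmetric] by (intro norm_triangle_mono norm_matrix_mult_le order_refl)

lemma dumat_le: "norm (dumat z d) \<le> norm (Vm d) * norm (Wm z) + norm (Vm z) * norm (Wm d) + sqrt (real CARD('N)) * norm (Bo d)"
  for z :: "('n0::finite,'n1::finite,'N::finite) pt"
  unfolding dumat_def norm_rep[symmetric] by (intro norm_triangle_mono norm_matrix_mult_le order_refl)

text \<open>Two quadratic errors occur: the bilinear remainder of the pre-activation, weighted by
  the gradient bound \<open>C\<close>, which will be chosen independently of \<open>\<mu>\<close>,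
  and the curvature of \<open>phi\<close> times the squared change of the pre-activation. The
  concave penalty adds none. Only the part with \<open>X / \<mu>\<close> grows as smoothing is
  removed.\<close>

lemma Htil_descent:
  fixes x :: "'N::finite \<Rightarrow> real^'n0::finite" and z w :: "('n0,'n1::finite,'N) pt"
  assumes m: "0 < \<mu>" and b: "0 \<le> \<beta>" and X: "\<And>n i. \<bar>x n $ i\<bar> \<le> X"
    and z: "(norm (Wm z))\<^sup>2 + (norm (Vm z))\<^sup>2 \<le> B" and w: "(norm (Wm w))\<^sup>2 + (norm (Vm w))\<^sup>2 \<le> B"
    and C: "norm (gmat x \<mu> z) \<le> C"
  shows "Htil x \<beta> w \<mu> \<le> Htil x \<beta> z \<mu> + gradHtil x \<beta> z \<mu> \<bullet> (w - z)
     + (C + (1 + X / \<mu>) * (1 + B / real CARD('N))) * (norm (w - z))\<^sup>2"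
proof -
  let ?N = "real CARD('N)"
  define d where "d = w - z"
  have wd: "w = z + d" by (simp add: d_def)
  have N: "1 \<le> ?N" by (simp add: Suc_leI)
  have "\<bar>x n $ i\<bar> \<le> X" for n i by (rule X)
  then have X0: "0 \<le> X" by (meson abs_ge_zero order_trans)
  have "(\<Sum>n\<in>UNIV. \<Sum>i\<in>UNIV. phi (x n $ i) \<mu> (umat w $ n $ i)) \<le> (\<Sum>n\<in>UNIV. \<Sum>i\<in>UNIV.
      phi (x n $ i) \<mu> (umat z $ n $ i) + gmat x \<mu> z $ n $ i * (umat w - umat z) $ n $ i + (1 + X / \<mu>) * ((umat w - umat z) $ n $ i)\<^sup>2)"
  proof (intro sum_mono)
    fix n i
    have "(1 + \<bar>x n $ i\<bar> / \<mu>) * ((umat w - umat z) $ n $ i)\<^sup>2 \<le> (1 + X / \<mu>) * ((umat w - umat z) $ n $ i)\<^sup>2"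
      using X[of n i] m by (intro mult_right_mono) (auto simp: divide_right_mono)
    then show "phi (x n $ i) \<mu> (umat w $ n $ i) \<le>
      phi (x n $ i) \<mu> (umat z $ n $ i) + gmat x \<mu> z $ n $ i * (umat w - umat z) $ n $ i + (1 + X / \<mu>) * ((umat w - umat z) $ n $ i)\<^sup>2"
      using phi_upper[OF m, of "x n $ i" "umat w $ n $ i" "umat z $ n $ i"] by (simp add: gmat_def)
  qed
  also have "\<dots> = (\<Sum>n\<in>UNIV. \<Sum>i\<in>UNIV. phi (x n $ i) \<mu> (umat z $ n $ i)) + gmat x \<mu> z \<bullet> (umat w - umat z) + (1 + X / \<mu>) * (norm (umat w - umat z))\<^sup>2"
    by (simp add: sum.distrib inner_mat norm_mat_square sum_distrib_left)
  also have "gmat x \<mu> z \<bullet> (umat w - umat z) = gmat x \<mu> z \<bullet> dumat z d + gmat x \<mu> z \<bullet> (Vm d ** Wm d)"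
    by (simp add: wd umat_add inner_add_right)
  finally have "Ftil x w \<mu> \<le> ((\<Sum>n\<in>UNIV. \<Sum>i\<in>UNIV. phi (x n $ i) \<mu> (umat z $ n $ i)) + (gmat x \<mu> z \<bullet> dumat z d + gmat x \<mu> z \<bullet> (Vm d ** Wm d)) + (1 + X / \<mu>) * (norm (umat w - umat z))\<^sup>2) / ?N"
    unfolding Ftil_eq using N by (intro divide_right_mono) auto
  also have "\<dots> = Ftil x z \<mu> + DF x z \<mu> d + (gmat x \<mu> z \<bullet> (Vm d ** Wm d)) / ?N + (1 + X / \<mu>) * ((norm (umat w - umat z))\<^sup>2 / ?N)"
    by (simp add: Ftil_eq DF_def add_divide_distrib)
  also have "(gmat x \<mu> z \<bullet> (Vm d ** Wm d)) / ?N \<le> C * (norm d)\<^sup>2"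
  proof -
    have C0: "0 \<le> C" using C norm_ge_zero order_trans by blast
    have "gmat x \<mu> z \<bullet> (Vm d ** Wm d) \<le> norm (gmat x \<mu> z) * norm (Vm d ** Wm d)" by (rule norm_cauchy_schwarz)
    also have "\<dots> \<le> C * (norm (Vm d) * norm (Wm d))"
      using C C0 by (intro mult_mono norm_matrix_mult_le) auto
    also have "\<dots> \<le> C * (norm d * norm d)"
      using C0 by (intro mult_left_mono mult_mono norm_parts_le) auto
    finally have "(gmat x \<mu> z \<bullet> (Vm d ** Wm d)) \<le> C * (norm d)\<^sup>2" by (simp add: power2_eq_square)
    moreover have "C * (norm d)\<^sup>2 * 1 \<le> C * (norm d)\<^sup>2 * ?N" using N C0 by (intro mult_left_mono) auto
    ultimately show ?thesis using N by (simp add: divide_le_eq)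
  qed
  also have "(1 + X / \<mu>) * ((norm (umat w - umat z))\<^sup>2 / ?N) \<le> (1 + X / \<mu>) * ((1 + B / ?N) * (norm d)\<^sup>2)"
  proof -
    have "(norm (umat w - umat z))\<^sup>2 / ?N \<le> (B + ?N) * (norm d)\<^sup>2 / ?N"
      using umat_diff_le[OF z w] by (intro divide_right_mono) (auto simp: d_def)
    also have "\<dots> = (1 + B / ?N) * (norm d)\<^sup>2" by (simp add: field_simps)
    finally show ?thesis using X0 m by (intro mult_left_mono) auto
  qed
  finally have "Ftil x w \<mu> \<le> Ftil x z \<mu> + DF x z \<mu> d + (C + (1 + X / \<mu>) * (1 + B / ?N)) * (norm d)\<^sup>2"
    by (simp add: algebra_simps)
  then show ?thesis
    using Ptil_tangent[OF m b, of x w z] unfolding Htil_def gradHtil_inner[OF m] d_def by linarith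
qed

section \<open>Closedness of the feasible set and uniform bounds on derivatives\<close>

lemma pos_continuous: "continuous_on UNIV pos"
  unfolding pos_def[abs_def] by (intro continuous_intros)

lemma tmat_nth_continuous: "continuous_on UNIV (\<lambda>w. tmat x w $ n $ j)"
  by (intro has_derivative_continuous_on) (rule has_derivative_at_withinI[OF tmat_nth_deriv])

lemma Zset_closed:
  fixes x :: "'N::finite \<Rightarrow> real^'n0::finite"
  shows "closed (Zset x \<alpha> :: ('n0,'n1::finite,'N) pt set)"
proof -
  have "Zset x \<alpha> = {z :: ('n0,'n1,'N) pt. (\<forall>n j. pos (tmat x z $ n $ j) \<le> Vm z $ n $ j) \<and>
   (\<forall>j. \<bar>Bh z $ j\<bar> \<le> \<alpha>) \<and> (\<forall>i. \<bar>Bo z $ i\<bar> \<le> \<alpha>)}"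
    using Zset_iff by blast
  also have "closed \<dots>"
    by (intro closed_Collect_conj closed_Collect_all closed_Collect_le continuous_intros
        continuous_on_compose2[OF pos_continuous tmat_nth_continuous]) auto
  finally show ?thesis .
qed

lemma DR_le: "\<bar>DR lam1 lam2 z e\<bar> \<le> (\<bar>lam1\<bar> * (real CARD('N) * real CARD('n1)) + 2 * \<bar>lam2\<bar> * norm z) * norm e"
  for z :: "('n0::finite,'n1::finite,'N::finite) pt"
proof -
  have v: "\<bar>Vm e $ n $ j\<bar> \<le> norm e" for n j
    using component_le_norm_cart[of "Vm e $ n" j] Finite_Cartesian_Product.norm_nth_le[of "Vm e" n] norm_parts_le(4)[of e]
    by linarith
  have "\<bar>\<Sum>n\<in>UNIV. esum (Vm e $ n)\<bar> \<le> (\<Sum>n\<in>(UNIV::'N set). \<Sum>j\<in>(UNIV::'n1 set). norm e)"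
    unfolding esum_def by (intro order_trans[OF sum_abs] sum_mono order_trans[OF sum_abs] v)
  also have "\<dots> = real CARD('N) * real CARD('n1) * norm e" by simp
  finally have 1: "\<bar>lam1\<bar> * \<bar>\<Sum>n\<in>UNIV. esum (Vm e $ n)\<bar> \<le> \<bar>lam1\<bar> * (real CARD('N) * real CARD('n1) * norm e)"
    by (intro mult_left_mono) auto
  have "\<bar>Wm z \<bullet> Wm e\<bar> \<le> norm (Wm z) * norm (Wm e)" by (rule Cauchy_Schwarz_ineq2)
  also have "\<dots> \<le> norm z * norm e" by (intro mult_mono norm_parts_le) auto
  finally have 2: "2 * \<bar>lam2\<bar> * \<bar>Wm z \<bullet> Wm e\<bar> \<le> 2 * \<bar>lam2\<bar> * (norm z * norm e)"
    by (intro mult_left_mono) auto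
  have "\<bar>DR lam1 lam2 z e\<bar> \<le> \<bar>lam1 * (\<Sum>n\<in>UNIV. esum (Vm e $ n))\<bar> + \<bar>2 * lam2 * (Wm z \<bullet> Wm e)\<bar>"
    unfolding DR_def by (rule abs_triangle_ineq)
  also have "\<dots> = \<bar>lam1\<bar> * \<bar>\<Sum>n\<in>UNIV. esum (Vm e $ n)\<bar> + 2 * \<bar>lam2\<bar> * \<bar>Wm z \<bullet> Wm e\<bar>"
    unfolding abs_mult by simp
  also have "\<dots> \<le> \<bar>lam1\<bar> * (real CARD('N) * real CARD('n1) * norm e) + 2 * \<bar>lam2\<bar> * (norm z * norm e)"
    by (rule add_mono[OF 1 2])
  finally show ?thesis by (simp only: distrib_right mult.assoc)
qed

lemma DP_le: "\<exists>K\<ge>0. \<forall>z \<mu> e. 0 < \<mu> \<longrightarrow> \<bar>DP x \<beta> (z::('n0,'n1::finite,'N) pt) \<mu> e\<bar> \<le> K * norm e"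
  for x :: "'N::finite \<Rightarrow> real^'n0::finite"
proof -
  have "\<exists>k. \<forall>e::('n0,'n1,'N) pt. \<bar>tmat x e $ n $ j\<bar> \<le> norm e * k" for n j
    using bounded_linear.bounded[OF has_derivative_bounded_linear[OF tmat_nth_deriv]] by (metis real_norm_def)
  then obtain k where k: "\<And>n j e. \<bar>tmat x (e::('n0,'n1,'N) pt) $ n $ j\<bar> \<le> norm e * k n j" by metis
  have k0: "\<bar>tmat x (e::('n0,'n1,'N) pt) $ n $ j\<bar> \<le> norm e * \<bar>k n j\<bar>" for n j e
    by (rule order_trans[OF k]) (simp add: mult_left_mono)
  define K where "K = \<bar>\<beta>\<bar> * (\<Sum>n\<in>UNIV. \<Sum>j\<in>UNIV. 1 + \<bar>k n j\<bar>)"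
  have "\<bar>DP x \<beta> (z::('n0,'n1,'N) pt) \<mu> e\<bar> \<le> K * norm e" if m: "0 < \<mu>" for z \<mu> e
  proof -
    have v: "\<bar>Vm e $ n $ j\<bar> \<le> norm e" for n j
      using component_le_norm_cart[of "Vm e $ n" j] Finite_Cartesian_Product.norm_nth_le[of "Vm e" n] norm_parts_le(4)[of e]
      by linarith
    have t: "\<bar>Vm e $ n $ j - dsig \<mu> (tmat x z $ n $ j) * tmat x e $ n $ j\<bar> \<le> (1 + \<bar>k n j\<bar>) * norm e" for n j
    proof -
      have "\<bar>dsig \<mu> (tmat x z $ n $ j) * tmat x e $ n $ j\<bar> \<le> 1 * (norm e * \<bar>k n j\<bar>)"
        unfolding abs_mult using dsig_nonneg[OF m] dsig_le_1[OF m] by (intro mult_mono k0) auto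
      then show ?thesis using v[of n j] abs_triangle_ineq4[of "Vm e $ n $ j" "dsig \<mu> (tmat x z $ n $ j) * tmat x e $ n $ j"]
        by (simp add: algebra_simps)
    qed
    have "\<bar>DP x \<beta> z \<mu> e\<bar> \<le> \<bar>\<beta>\<bar> * (\<Sum>n\<in>UNIV. \<Sum>j\<in>UNIV. (1 + \<bar>k n j\<bar>) * norm e)"
      unfolding DP_def abs_mult by (intro mult_left_mono order_trans[OF sum_abs] sum_mono t) auto
    then show ?thesis by (simp add: K_def sum_distrib_right mult.assoc)
  qed
  moreover have "0 \<le> K" unfolding K_def by (intro mult_nonneg_nonneg sum_nonneg) auto
  ultimately show ?thesis by blast
qed

section \<open>Residuals and the limiting variational inequality\<close>

context spg_run
begin

lemma WV_le: "(norm (Wm (z k)))\<^sup>2 + (norm (Vm (z k)))\<^sup>2 \<le> B"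
  using Psi_le[of k] unfolding Psi_def by (smt (verit) zero_le_power2)

lemma gmat_bounded: "\<exists>C\<ge>0. \<forall>k. norm (gmat x (\<mu> k) (z k)) \<le> C"
proof -
  define C where "C = 2 * (sqrt B * sqrt B + sqrt (real CARD('N)) * sqrt B) + 2 * norm (vec_lambda x)"
  have "norm (gmat x (\<mu> k) (z k)) \<le> C" for k
  proof -
    have n: "norm (Vm (z k)) \<le> sqrt B" "norm (Wm (z k)) \<le> sqrt B" "norm (Bo (z k)) \<le> sqrt B"
      using norm_parts_le[of "z k"] norm_z_le[of k] by linarith+
    have "norm (umat (z k)) \<le> sqrt B * sqrt B + sqrt (real CARD('N)) * sqrt B"
      by (rule order_trans[OF umat_le]) (intro add_mono mult_mono n; simp add: B_nonneg)
    moreover have "0 < \<mu> k" using mu_L by blast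
    ultimately show ?thesis using gmat_le[of "\<mu> k" x "z k"] unfolding C_def by simp
  qed
  moreover have "0 \<le> C" unfolding C_def using B_nonneg by auto
  ultimately show ?thesis by blast
qed

text \<open>Smoothing affects the curvature but not the slope: \<open>dsig\<close> stays between 0
  and 1 for every \<open>\<mu>\<close>, and the iterates are bounded.\<close>

lemma grad_bounded: "\<exists>G>0. \<forall>k e. \<bar>gradHtil x \<beta> (z k) (\<mu> k) \<bullet> e + DR lam1 lam2 (z k) e\<bar> \<le> G * norm e
  \<and> \<bar>gradHtil x \<beta> (z k) (\<mu> k) \<bullet> e\<bar> \<le> G * norm e"
proof -
  obtain C where C: "0 \<le> C" "\<And>k. norm (gmat x (\<mu> k) (z k)) \<le> C" using gmat_bounded by blast
  obtain K where K: "0 \<le> K" "\<And>(w::('n0,'n1,'N) pt) m e. 0 < m \<Longrightarrow> \<bar>DP x \<beta> w m e\<bar> \<le> K * norm e"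
    using DP_le[of x \<beta>] by metis
  define D where "D = C * (sqrt B + sqrt B + sqrt (real CARD('N)))"
  define R where "R = \<bar>lam1\<bar> * (real CARD('N) * real CARD('n1)) + 2 * \<bar>lam2\<bar> * sqrt B"
  have D0: "0 \<le> D" "0 \<le> R" using C B_nonneg by (auto simp: D_def R_def)
  have DF: "\<bar>DF x (z k) (\<mu> k) e\<bar> \<le> D * norm e" for k e
  proof -
    have n: "norm (Vm (z k)) \<le> sqrt B" "norm (Wm (z k)) \<le> sqrt B"
      using norm_parts_le[of "z k"] norm_z_le[of k] by linarith+
    have "\<bar>gmat x (\<mu> k) (z k) \<bullet> dumat (z k) e\<bar> \<le> norm (gmat x (\<mu> k) (z k)) * norm (dumat (z k) e)"
      by (rule Cauchy_Schwarz_ineq2)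
    also have "\<dots> \<le> C * (norm e * sqrt B + sqrt B * norm e + sqrt (real CARD('N)) * norm e)"
      using C B_nonneg
      by (intro mult_mono order_trans[OF dumat_le] add_mono n norm_parts_le) auto
    finally have "\<bar>gmat x (\<mu> k) (z k) \<bullet> dumat (z k) e\<bar> \<le> D * norm e" by (simp add: D_def algebra_simps)
    moreover have "D * norm e * 1 \<le> D * norm e * real CARD('N)"
      using D0 by (intro mult_left_mono) (auto simp: Suc_leI)
    ultimately show ?thesis unfolding DF_def by (simp add: divide_le_eq)
  qed
  have g: "\<bar>gradHtil x \<beta> (z k) (\<mu> k) \<bullet> e\<bar> \<le> (D + K) * norm e" for k e
    using DF[of k e] K(2)[of "\<mu> k" "z k" e] mu_L[of k] gradHtil_inner[of "\<mu> k" x \<beta> "z k" e]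
    by (simp add: algebra_simps)
  have r: "\<bar>DR lam1 lam2 (z k) e\<bar> \<le> R * norm e" for k e
    by (rule order_trans[OF DR_le]) (auto simp: R_def intro!: mult_right_mono mult_left_mono norm_z_le)
  show ?thesis
  proof (intro exI[of _ "D + K + R + 1"] conjI allI)
    show "0 < D + K + R + 1" using D0 K by linarith
    fix k and e :: "('n0,'n1,'N) pt"
    have "0 \<le> R * norm e" using D0 by simp
    then show "\<bar>gradHtil x \<beta> (z k) (\<mu> k) \<bullet> e\<bar> \<le> (D + K + R + 1) * norm e"
      using g[where k=k and e=e] norm_ge_zero[of e] unfolding distrib_right by linarith
    show "\<bar>gradHtil x \<beta> (z k) (\<mu> k) \<bullet> e + DR lam1 lam2 (z k) e\<bar> \<le> (D + K + R + 1) * norm e"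
      using g[where k=k and e=e] r[where k=k and e=e] norm_ge_zero[of e] unfolding distrib_right by linarith
  qed
qed

text \<open>Testing with \<open>q = z k\<close> gives the full coefficient \<open>L k\<close>;
  comparing objective values alone would give half of it. The budget
  \<open>X * (1 + B / real CARD('N)) < c0\<close> relies on this factor.\<close>

lemma grad_step: "gradHtil x \<beta> (z k) (\<mu> k) \<bullet> (z (Suc k) - z k) + Robj lam1 lam2 (z (Suc k)) - Robj lam1 lam2 (z k)
    \<le> - L k * (norm (z (Suc k) - z k))\<^sup>2"
proof -
  define d where "d = z (Suc k) - z k"
  have e: "z k = z (Suc k) + (- d)" "z k - z (Suc k) = - d" by (simp_all add: d_def)
  have "Robj lam1 lam2 (z k) = Robj lam1 lam2 (z (Suc k)) + DR lam1 lam2 (z (Suc k)) (- d) + lam2 * (norm (Wm (- d)))\<^sup>2"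
    by (subst e(1)) (rule Robj_expand)
  moreover have "0 \<le> lam2 * (norm (Wm (- d)))\<^sup>2" using pr by simp
  moreover have "0 \<le> - (gradHtil x \<beta> (z k) (\<mu> k) \<bullet> d) + DR lam1 lam2 (z (Suc k)) (- d) + L k * (- (norm d)\<^sup>2)"
    using step_VI[OF z_in[of k], of k] unfolding e(2) d_def[symmetric] inner_minus_right power2_norm_eq_inner .
  ultimately show ?thesis unfolding d_def[symmetric] by (simp only: mult_minus_left mult_minus_right)
qed

lemma reduced_step: "\<mu> (Suc k) = tau1 * \<mu> k \<Longrightarrow>
   - tau2 * \<mu> k / L k \<le> Otil x lam1 lam2 \<beta> (z (Suc k)) (\<mu> k) - Otil x lam1 lam2 \<beta> (z k) (\<mu> k)"
  using update[of k] mu_L[of k] init by (auto split: if_splits)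

text \<open>Each index of the subsequence is itself a reduction step, so passing from one to the
  next gains at least a factor \<open>tau1\<close>.\<close>

lemma mu_reduced_tendsto:
  assumes r: "strict_mono r" and K: "\<And>j. \<mu> (Suc (r j)) = tau1 * \<mu> (r j)"
  shows "(\<lambda>j. \<mu> (r j)) \<longlonglongrightarrow> 0"
proof -
  have anti: "\<mu> b \<le> \<mu> a" if "a \<le> b" for a b
    using lift_Suc_antimono_le[of \<mu>, OF mu_antimono that] .
  have "\<mu> (r j) \<le> tau1 ^ j * \<mu> 0" for j
  proof (induction j)
    case 0
    then show ?case using anti[of 0 "r 0"] by simp
  next
    case (Suc j)
    have "\<mu> (r (Suc j)) \<le> tau1 * \<mu> (r j)"
      using anti[of "Suc (r j)" "r (Suc j)"] strict_monoD[OF r, of j "Suc j"] K[of j] by simp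
    also have "\<dots> \<le> tau1 * (tau1 ^ j * \<mu> 0)" using Suc init by (intro mult_left_mono) auto
    finally show ?case by simp
  qed
  then have le: "norm (\<mu> (r j)) \<le> tau1 ^ j * \<mu> 0" for j
    using mu_L[of "r j"] by simp
  have "(\<lambda>j. tau1 ^ j) \<longlonglongrightarrow> 0"
    using init by (intro LIMSEQ_power_zero) simp
  then have lim: "(\<lambda>j. tau1 ^ j * \<mu> 0) \<longlonglongrightarrow> 0" by (rule tendsto_mult_left_zero)
  show ?thesis
    by (rule Lim_null_comparison[OF _ lim]) (simp add: le del: real_norm_def)
qed

text \<open>\<open>\<delta>\<close> is the fraction of \<open>L\<close> left over after the
  curvature \<open>X / \<mu>\<close> is paid, uniformly because \<open>L\<close> is at least
  \<open>c0 / \<mu>\<close>. Half of it absorbs the bounded constant \<open>C'\<close> once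
  \<open>\<mu>\<close> is small; the other half forces decrease, and the failed decrease test then
  bounds the square of the residual by a multiple of \<open>\<mu>\<close>.\<close>

lemma residual_tendsto:
  assumes r: "strict_mono r" and K: "\<And>j. \<mu> (Suc (r j)) = tau1 * \<mu> (r j)"
  shows "(\<lambda>j. L (r j) * norm (z (Suc (r j)) - z (r j))) \<longlonglongrightarrow> 0"
proof -
  let ?Q = "1 + B / real CARD('N)"
  obtain C where C: "0 \<le> C" "\<And>k. norm (gmat x (\<mu> k) (z k)) \<le> C" using gmat_bounded by blast
  have Q: "0 \<le> ?Q" using B_nonneg by simp
  define \<delta> where "\<delta> = 1 - X * ?Q / c0"
  define C' where "C' = C + ?Q + 1"
  have \<delta>: "0 < \<delta>" using X(2) c0(2) by (simp add: \<delta>_def)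
  have C': "0 < C'" using C(1) Q by (simp add: C'_def)
  have X0: "0 \<le> X" using X(1) by (meson abs_ge_zero order_trans)
  have main: "L k * norm (z (Suc k) - z k) \<le> sqrt (2 * tau2 / \<delta> * \<mu> k)"
    if k: "\<mu> (Suc k) = tau1 * \<mu> k" and small: "\<mu> k \<le> c0 * \<delta> / (2 * C')" for k
  proof -
    let ?d = "(norm (z (Suc k) - z k))\<^sup>2"
    note mL = mu_L[of k]
    have muL: "c0 / \<mu> k \<le> L k" using mL by (simp add: field_simps)
    have "X / \<mu> k * ?Q = X * ?Q / c0 * (c0 / \<mu> k)" using c0 by simp
    also have "\<dots> \<le> X * ?Q / c0 * L k" using muL X0 Q c0 by (intro mult_left_mono) auto
    also have "\<dots> = (1 - \<delta>) * L k" by (simp add: \<delta>_def)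
    finally have XL: "X / \<mu> k * ?Q \<le> (1 - \<delta>) * L k" .
    have "2 * C' / \<delta> \<le> L k"
    proof (rule order_trans[OF _ muL])
      show "2 * C' / \<delta> \<le> c0 / \<mu> k" using small mL \<delta> C' by (simp add: field_simps)
    qed
    then have CL: "C' \<le> \<delta> / 2 * L k" using \<delta> by (simp add: field_simps)
    have "Otil x lam1 lam2 \<beta> (z (Suc k)) (\<mu> k) - Otil x lam1 lam2 \<beta> (z k) (\<mu> k)
       \<le> - L k * ?d + (C + (1 + X / \<mu> k) * ?Q) * ?d"
      using Htil_descent[of "\<mu> k" \<beta> x X "z k" B "z (Suc k)" C] mL pr X(1) WV_le C(2) grad_step[of k]
      unfolding Otil_def by auto
    also have "\<dots> = (- L k + (C' - 1) + X / \<mu> k * ?Q) * ?d" by (simp add: C'_def algebra_simps)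
    also have "\<dots> \<le> (- (\<delta> / 2) * L k) * ?d"
    proof (intro mult_right_mono)
      have "(1 - \<delta>) * L k = L k - 2 * (\<delta> / 2 * L k)" by (simp add: algebra_simps)
      then show "- L k + (C' - 1) + X / \<mu> k * ?Q \<le> - (\<delta> / 2) * L k" using XL CL by simp
    qed simp
    finally have "\<delta> / 2 * L k * ?d \<le> tau2 * \<mu> k / L k"
      using reduced_step[OF k] by simp
    then have "\<delta> / 2 * (L k * norm (z (Suc k) - z k))\<^sup>2 \<le> tau2 * \<mu> k"
      using mL by (simp add: field_simps power2_eq_square)
    then have "(L k * norm (z (Suc k) - z k))\<^sup>2 \<le> 2 * tau2 / \<delta> * \<mu> k"
      using \<delta> by (simp add: field_simps)
    then show ?thesis by (rule real_le_rsqrt)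
  qed
  have mu: "(\<lambda>j. \<mu> (r j)) \<longlonglongrightarrow> 0" by (rule mu_reduced_tendsto[OF r K])
  then have "\<forall>\<^sub>F j in sequentially. \<mu> (r j) < c0 * \<delta> / (2 * C')"
    using c0 \<delta> C' by (intro order_tendstoD(2)) auto
  then have ev: "\<forall>\<^sub>F j in sequentially. norm (L (r j) * norm (z (Suc (r j)) - z (r j))) \<le> sqrt (2 * tau2 / \<delta> * \<mu> (r j))"
  proof eventually_elim
    case (elim j)
    have "0 \<le> L (r j)" using mu_L[of "r j"] by linarith
    then show ?case using main[OF K[of j]] elim by (simp add: abs_mult)
  qed
  have "(\<lambda>j. sqrt (2 * tau2 / \<delta> * \<mu> (r j))) \<longlonglongrightarrow> sqrt (2 * tau2 / \<delta> * 0)"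
    by (intro tendsto_intros mu)
  then show ?thesis by (intro Lim_null_comparison[OF ev]) simp
qed

text \<open>The gradients along the subsequence need not converge, so the limit is expressed by an
  eventual bound with slack \<open>e\<close>. They are bounded, which lets the base point
  \<open>z (Suc (r j))\<close> be replaced by \<open>zs\<close>.\<close>

lemma limit_VI:
  assumes r: "strict_mono r" and K: "\<And>j. \<mu> (Suc (r j)) = tau1 * \<mu> (r j)"
    and lim: "(\<lambda>j. z (r j)) \<longlonglongrightarrow> zs" and q: "q \<in> Zset x \<alpha>" and e: "0 < e"
  shows "\<forall>\<^sub>F j in sequentially. - e < gradHtil x \<beta> (z (r j)) (\<mu> (r j)) \<bullet> (q - zs) + DR lam1 lam2 (z (r j)) (q - zs)"
proof -
  let ?g = "\<lambda>j. gradHtil x \<beta> (z (r j)) (\<mu> (r j))" and ?p = "\<lambda>j. z (Suc (r j))"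
  obtain G where G: "0 < G" "\<And>k e. \<bar>gradHtil x \<beta> (z k) (\<mu> k) \<bullet> e\<bar> \<le> G * norm e" using grad_bounded by blast
  have res: "(\<lambda>j. L (r j) * norm (?p j - z (r j))) \<longlonglongrightarrow> 0" by (rule residual_tendsto[OF r K])
  have "(\<lambda>j. ?p j - z (r j)) \<longlonglongrightarrow> 0"
  proof (rule Lim_null_comparison[OF _ res], rule always_eventually, rule allI)
    fix j
    show "norm (?p j - z (r j)) \<le> L (r j) * norm (?p j - z (r j))"
      using mult_right_mono[of 1 "L (r j)" "norm (?p j - z (r j))"] mu_L[of "r j"] by simp
  qed
  from tendsto_add[OF this lim] have p: "?p \<longlonglongrightarrow> zs" by simp
  have 1: "(\<lambda>j. ?g j \<bullet> (zs - ?p j)) \<longlonglongrightarrow> 0"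
  proof (rule Lim_null_comparison)
    show "\<forall>\<^sub>F j in sequentially. norm (?g j \<bullet> (zs - ?p j)) \<le> G * norm (zs - ?p j)"
      using G(2) by simp
    have "(\<lambda>j. G * norm (zs - ?p j)) \<longlonglongrightarrow> G * norm (zs - zs)" by (intro tendsto_intros p)
    then show "(\<lambda>j. G * norm (zs - ?p j)) \<longlonglongrightarrow> 0" by simp
  qed
  have DRc: "(\<lambda>j. DR lam1 lam2 (a j) (b j)) \<longlonglongrightarrow> DR lam1 lam2 a' b'"
    if "a \<longlonglongrightarrow> a'" "b \<longlonglongrightarrow> b'" for a b and a' b' :: "('n0,'n1,'N) pt"
    unfolding DR_def esum_def by (intro tendsto_intros that)
  have 2: "(\<lambda>j. DR lam1 lam2 (?p j) (q - ?p j) - DR lam1 lam2 (z (r j)) (q - zs)) \<longlonglongrightarrow> DR lam1 lam2 zs (q - zs) - DR lam1 lam2 zs (q - zs)"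
    by (intro tendsto_diff DRc p lim tendsto_const)
  have 3: "(\<lambda>j. L (r j) * ((?p j - z (r j)) \<bullet> (q - ?p j))) \<longlonglongrightarrow> 0"
  proof (rule Lim_null_comparison)
    show "\<forall>\<^sub>F j in sequentially. norm (L (r j) * ((?p j - z (r j)) \<bullet> (q - ?p j))) \<le> L (r j) * norm (?p j - z (r j)) * norm (q - ?p j)"
    proof (rule always_eventually, rule allI)
      fix j
      have "\<bar>(?p j - z (r j)) \<bullet> (q - ?p j)\<bar> \<le> norm (?p j - z (r j)) * norm (q - ?p j)" by (rule Cauchy_Schwarz_ineq2)
      then show "norm (L (r j) * ((?p j - z (r j)) \<bullet> (q - ?p j))) \<le> L (r j) * norm (?p j - z (r j)) * norm (q - ?p j)"
        using mu_L[of "r j"] by (simp add: abs_mult mult.assoc)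
    qed
    have "(\<lambda>j. L (r j) * norm (?p j - z (r j)) * norm (q - ?p j)) \<longlonglongrightarrow> 0 * norm (q - zs)"
      by (intro tendsto_intros res p)
    then show "(\<lambda>j. L (r j) * norm (?p j - z (r j)) * norm (q - ?p j)) \<longlonglongrightarrow> 0" by simp
  qed
  have "(\<lambda>j. ?g j \<bullet> (zs - ?p j) + (DR lam1 lam2 (?p j) (q - ?p j) - DR lam1 lam2 (z (r j)) (q - zs)) + L (r j) * ((?p j - z (r j)) \<bullet> (q - ?p j))) \<longlonglongrightarrow> 0 + 0 + 0"
    using 2 by (intro tendsto_add 1 3) simp
  then have "\<forall>\<^sub>F j in sequentially. ?g j \<bullet> (zs - ?p j) + (DR lam1 lam2 (?p j) (q - ?p j) - DR lam1 lam2 (z (r j)) (q - zs)) + L (r j) * ((?p j - z (r j)) \<bullet> (q - ?p j)) < e"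
    using e by (intro order_tendstoD(2)) auto
  then show ?thesis
  proof eventually_elim
    case (elim j)
    have "?g j \<bullet> (q - ?p j) = ?g j \<bullet> (q - zs) + ?g j \<bullet> (zs - ?p j)" by (simp add: inner_diff_right)
    then show ?case using elim step_VI[OF q, of "r j"] by linarith
  qed
qed

end

subsection \<open>Comparison with the Clarke derivative\<close>

definition ones :: "('n0::finite,'n1::finite,'N::finite) pt" where
  "ones = (0, ((\<chi> j. 1), (\<chi> i. 1)), 0)"

definition Smooth :: "('N::finite \<Rightarrow> real^'n0::finite) \<Rightarrow> real \<Rightarrow> real \<Rightarrow> real \<Rightarrow> ('n0,'n1::finite,'N) pt \<Rightarrow> real" where
  "Smooth x lam1 lam2 \<beta> z = (\<Sum>n\<in>UNIV. \<Sum>i\<in>UNIV. (pos (umat z $ n $ i))\<^sup>2 + (x n $ i)\<^sup>2) / real CARD('N)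
     + Robj lam1 lam2 z + \<beta> * (\<Sum>n\<in>UNIV. \<Sum>j\<in>UNIV. Vm z $ n $ j)"

text \<open>The nonsmooth part of the objective with all kinks displaced by \<open>s\<close>. Taking
  \<open>g = pos\<close> gives the true objective at the point moved by \<open>- s\<close> along
  \<open>ones\<close>; taking \<open>g = sig1 \<mu>\<close> and \<open>s = 0\<close> gives the
  smoothed one.\<close>

definition kinks :: "('N::finite \<Rightarrow> real^'n0::finite) \<Rightarrow> real \<Rightarrow> ('n0,'n1::finite,'N) pt \<Rightarrow> real \<Rightarrow> (real \<Rightarrow> real) \<Rightarrow> real" where
  "kinks x \<beta> z s g = - (2 / real CARD('N)) * (\<Sum>n\<in>UNIV. \<Sum>i\<in>UNIV. x n $ i * g (umat z $ n $ i - s))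
     - \<beta> * (\<Sum>n\<in>UNIV. \<Sum>j\<in>UNIV. g (tmat x z $ n $ j - s))"

lemma umat_shift: "umat (z - s *\<^sub>R ones) $ n $ i = umat z $ n $ i - s"
  by (simp add: umat_nth ones_def)

lemma tmat_shift: "tmat x (z - s *\<^sub>R ones) $ n $ j = tmat x z $ n $ j - s"
  by (simp add: tmat_nth ones_def)

lemma Oobj_split: "Oobj x lam1 lam2 \<beta> (z - s *\<^sub>R ones) = Smooth x lam1 lam2 \<beta> (z - s *\<^sub>R ones) + kinks x \<beta> z s pos"
  unfolding Oobj_def Fobj_eq Pobj_eq Smooth_def kinks_def umat_shift tmat_shift
  by (simp add: power2_diff sum.distrib sum_subtractf sum_distrib_left algebra_simps add_divide_distrib diff_divide_distrib)
     (simp add: sum_negf sum_divide_distrib)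

lemma Otil_split: "Otil x lam1 lam2 \<beta> z \<mu> = Smooth x lam1 lam2 \<beta> z + kinks x \<beta> z 0 (sig1 \<mu>)"
  unfolding Otil_def Htil_def Ftil_eq Ptil_eq Smooth_def kinks_def phi_def
  by (simp add: sum.distrib sum_subtractf sum_distrib_left algebra_simps add_divide_distrib diff_divide_distrib)
     (simp add: sum_negf sum_divide_distrib)

text \<open>\<open>\<Gamma>\<close> integrates the displaced kinks over the displacement: it
  vanishes at 0 and is \<open>\<mu>\<close> times the smoothed kinks at \<open>\<mu>\<close>. The
  mean value theorem is applied to the difference of the whole sums at \<open>w\<close> and
  \<open>z\<close>, so a single \<open>\<xi>\<close> serves all kinks, whatever the signs of the
  data.\<close>

lemma kinks_mean_value:
  fixes z w :: "('n0::finite,'n1::finite,'N::finite) pt"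
  assumes m: "0 < \<mu>"
  obtains \<xi> where "0 < \<xi>" "\<xi> < \<mu>"
    "kinks x \<beta> w 0 (sig1 \<mu>) - kinks x \<beta> z 0 (sig1 \<mu>) = kinks x \<beta> w \<xi> pos - kinks x \<beta> z \<xi> pos"
proof -
  define q where "q u s = ((pos u)\<^sup>2 - (pos (u - s))\<^sup>2) / 2" for u s
  have q: "((\<lambda>s. q u s) has_real_derivative pos (u - s)) (at s)" for u s
  proof -
    have "((\<lambda>s. (pos (u - s))\<^sup>2) has_real_derivative (2 * pos (u - s)) * (0 - 1)) (at s)"
      by (rule DERIV_chain2[OF pos_square_deriv]) (intro DERIV_diff DERIV_const DERIV_ident)
    then have "((\<lambda>s. ((pos u)\<^sup>2 - (pos (u - s))\<^sup>2) / 2) has_real_derivative (0 - (2 * pos (u - s)) * (0 - 1)) / 2) (at s)"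
      by (intro DERIV_cdivide DERIV_diff DERIV_const)
    then show ?thesis by (simp add: q_def)
  qed
  have q\<mu>: "q u \<mu> = \<mu> * sig1 \<mu> u" for u using m by (simp add: q_def sig1_eq)
  define \<Gamma> where "\<Gamma> z s = - (2 / real CARD('N)) * (\<Sum>n\<in>UNIV. \<Sum>i\<in>UNIV. x n $ i * q (umat z $ n $ i) s)
     - \<beta> * (\<Sum>n\<in>UNIV. \<Sum>j\<in>UNIV. q (tmat x z $ n $ j) s)" for z :: "('n0,'n1,'N) pt" and s
  have D: "(\<Gamma> v has_real_derivative kinks x \<beta> v s pos) (at s)" for v s
    unfolding \<Gamma>_def kinks_def by (intro DERIV_diff DERIV_cmult DERIV_sum q)
  have \<Gamma>0: "\<Gamma> v 0 = 0" for v by (simp add: \<Gamma>_def q_def)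
  have \<Gamma>\<mu>: "\<Gamma> v \<mu> = \<mu> * kinks x \<beta> v 0 (sig1 \<mu>)" for v
    unfolding \<Gamma>_def kinks_def q\<mu> by (simp add: sum_distrib_left algebra_simps)
  obtain \<xi> where \<xi>: "0 < \<xi>" "\<xi> < \<mu>" "(\<Gamma> w \<mu> - \<Gamma> z \<mu>) - (\<Gamma> w 0 - \<Gamma> z 0) = (\<mu> - 0) * (kinks x \<beta> w \<xi> pos - kinks x \<beta> z \<xi> pos)"
    using MVT2[OF m, of "\<lambda>s. \<Gamma> w s - \<Gamma> z s" "\<lambda>s. kinks x \<beta> w s pos - kinks x \<beta> z s pos"] DERIV_diff[OF D D] by blast
  then have "\<mu> * (kinks x \<beta> w 0 (sig1 \<mu>) - kinks x \<beta> z 0 (sig1 \<mu>)) = \<mu> * (kinks x \<beta> w \<xi> pos - kinks x \<beta> z \<xi> pos)"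
    by (simp add: \<Gamma>0 \<Gamma>\<mu> algebra_simps)
  then show ?thesis using m \<xi> that by auto
qed

lemma sig1_lipschitz: "0 < \<mu> \<Longrightarrow> sig1 \<mu> t - sig1 \<mu> s \<le> \<bar>t - s\<bar>"
proof -
  assume m: "0 < \<mu>"
  have "sig1 \<mu> t - sig1 \<mu> s \<le> dsig \<mu> t * (t - s)"
    using sig1_tangent[OF m, of t s] by (simp add: algebra_simps)
  also have "\<dots> \<le> \<bar>dsig \<mu> t\<bar> * \<bar>t - s\<bar>"
    unfolding abs_mult[symmetric] by (rule abs_ge_self)
  also have "\<dots> \<le> 1 * \<bar>t - s\<bar>"
    using dsig_nonneg[OF m, of t] dsig_le_1[OF m, of t] by (intro mult_right_mono) auto
  finally show ?thesis by simp
qed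

text \<open>The displacement also moves the smooth part. Only the squared activations notice it, and
  their change is \<open>2 * s * sig1 s\<close>, a multiple of a 1-Lipschitz function; the error is
  thus of order \<open>s\<close> relative to the increment.\<close>

lemma Smooth_shift_diff:
  fixes z w :: "('n0::finite,'n1::finite,'N::finite) pt"
  assumes s: "0 < s"
  shows "(Smooth x lam1 lam2 \<beta> w - Smooth x lam1 lam2 \<beta> z)
      - (Smooth x lam1 lam2 \<beta> (w - s *\<^sub>R ones) - Smooth x lam1 lam2 \<beta> (z - s *\<^sub>R ones))
    \<le> 2 * s * (\<Sum>n\<in>UNIV. \<Sum>i\<in>UNIV. \<bar>umat w $ n $ i - umat z $ n $ i\<bar>) / real CARD('N)"
proof -
  have R: "Robj lam1 lam2 (v - s *\<^sub>R ones) = Robj lam1 lam2 v" "Vm (v - s *\<^sub>R ones) = Vm v" for v :: "('n0,'n1,'N) pt"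
    by (simp_all add: Robj_eq ones_def)
  have p: "(pos t)\<^sup>2 - (pos (t - s))\<^sup>2 = 2 * s * sig1 s t" for t
    using s by (simp add: sig1_eq)
  have "(Smooth x lam1 lam2 \<beta> w - Smooth x lam1 lam2 \<beta> z)
      - (Smooth x lam1 lam2 \<beta> (w - s *\<^sub>R ones) - Smooth x lam1 lam2 \<beta> (z - s *\<^sub>R ones))
    = (\<Sum>n\<in>UNIV. \<Sum>i\<in>UNIV. ((pos (umat w $ n $ i))\<^sup>2 - (pos (umat w $ n $ i - s))\<^sup>2) - ((pos (umat z $ n $ i))\<^sup>2 - (pos (umat z $ n $ i - s))\<^sup>2)) / real CARD('N)"
    unfolding Smooth_def R umat_shift
    by (simp add: sum.distrib sum_subtractf algebra_simps add_divide_distrib diff_divide_distrib)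
  also have "\<dots> \<le> (\<Sum>n\<in>UNIV. \<Sum>i\<in>UNIV. 2 * s * \<bar>umat w $ n $ i - umat z $ n $ i\<bar>) / real CARD('N)"
    unfolding p using sig1_lipschitz[OF s] s
    by (intro divide_right_mono sum_mono) (auto simp: right_diff_distrib[symmetric])
  finally show ?thesis by (simp add: sum_distrib_left)
qed

lemma Otil_dir_deriv:
  fixes z d :: "('n0::finite,'n1::finite,'N::finite) pt"
  assumes m: "0 < \<mu>"
  shows "((\<lambda>t. (Otil x lam1 lam2 \<beta> (z + t *\<^sub>R d) \<mu> - Otil x lam1 lam2 \<beta> z \<mu>) / t)
    \<longlongrightarrow> gradHtil x \<beta> z \<mu> \<bullet> d + DR lam1 lam2 z d) (at_right 0)"
proof -
  let ?D = "\<lambda>d. DF x z \<mu> d + DP x \<beta> z \<mu> d"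
  have line: "((\<lambda>t::real. z + t *\<^sub>R d) has_derivative (\<lambda>t. t *\<^sub>R d)) (at 0)"
    by (auto intro!: derivative_eq_intros)
  have "((\<lambda>t. Htil x \<beta> (z + t *\<^sub>R d) \<mu>) has_derivative (\<lambda>t. ?D (t *\<^sub>R d))) (at 0)"
    using has_derivative_compose[OF line, of "\<lambda>w. Htil x \<beta> w \<mu>" ?D] Htil_deriv[OF m, of x \<beta> z] by simp
  then have "((\<lambda>t. Htil x \<beta> (z + t *\<^sub>R d) \<mu>) has_real_derivative ?D d) (at 0)"
    by (rule has_derivative_imp_has_field_derivative) (simp add: DF_scaleR DP_scaleR algebra_simps)
  then have "((\<lambda>t. (Htil x \<beta> (z + t *\<^sub>R d) \<mu> - Htil x \<beta> z \<mu>) / t) \<longlongrightarrow> ?D d) (at 0)"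
    unfolding DERIV_def by simp
  then have 1: "((\<lambda>t. (Htil x \<beta> (z + t *\<^sub>R d) \<mu> - Htil x \<beta> z \<mu>) / t) \<longlongrightarrow> ?D d) (at_right 0)"
    by (rule tendsto_within_subset) simp
  have "((\<lambda>t. DR lam1 lam2 z d + t * (lam2 * (norm (Wm d))\<^sup>2)) \<longlongrightarrow> DR lam1 lam2 z d + 0 * (lam2 * (norm (Wm d))\<^sup>2)) (at_right 0)"
    by (intro tendsto_intros)
  then have 2: "((\<lambda>t. DR lam1 lam2 z d + t * (lam2 * (norm (Wm d))\<^sup>2)) \<longlongrightarrow> DR lam1 lam2 z d) (at_right 0)" by simp
  have "\<forall>\<^sub>F t in at_right 0. (Htil x \<beta> (z + t *\<^sub>R d) \<mu> - Htil x \<beta> z \<mu>) / t + (DR lam1 lam2 z d + t * (lam2 * (norm (Wm d))\<^sup>2))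
      = (Otil x lam1 lam2 \<beta> (z + t *\<^sub>R d) \<mu> - Otil x lam1 lam2 \<beta> z \<mu>) / t"
    using eventually_at_right_less[of 0]
  proof eventually_elim
    case (elim t)
    have "(norm (Wm (t *\<^sub>R d)))\<^sup>2 = t * (t * (norm (Wm d))\<^sup>2)" by (simp add: power_mult_distrib power2_eq_square)
    then show ?case using elim
      by (simp add: Otil_def Robj_expand DR_scaleR field_simps power2_eq_square)
  qed
  from tendsto_cong[OF this] tendsto_add[OF 1 2] show ?thesis
    by (simp add: gradHtil_inner[OF m])
qed

lemma clarke_dd_negD:
  fixes f :: "'a::real_normed_vector \<Rightarrow> real"
  assumes "clarke_dd f zs d < 0"
  obtains c \<epsilon> where "c < 0" "0 < \<epsilon>" "\<And>w t. 0 < t \<Longrightarrow> t < \<epsilon> \<Longrightarrow> dist w zs < \<epsilon> \<Longrightarrow> f (w + t *\<^sub>R d) - f w \<le> c * t"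
proof -
  obtain c where c: "clarke_dd f zs d < ereal c" "ereal c < 0" using ereal_dense2[OF assms] by blast
  have "\<forall>\<^sub>F (w, t) in at (zs, 0) within (UNIV \<times> {0<..}). ereal ((f (w + t *\<^sub>R d) - f w) / t) < ereal c"
    using Limsup_lessD[OF c(1)[unfolded clarke_dd_def]] by (simp add: case_prod_beta')
  then obtain e where e: "0 < e" "\<And>w t. 0 < t \<Longrightarrow> dist (w, t) (zs, 0) < e \<Longrightarrow> (f (w + t *\<^sub>R d) - f w) / t < c"
    unfolding eventually_at by auto
  show ?thesis
  proof (rule that[of c "e / 2"])
    show "c < 0" using c(2) by simp
    show "0 < e / 2" using e(1) by simp
    fix w t assume t: "0 < t" "t < e / 2" "dist w zs < e / 2"
    have "dist (w, t) (zs, 0) \<le> \<bar>dist w zs\<bar> + \<bar>dist t 0\<bar>"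
      unfolding dist_Pair_Pair by (rule sqrt_sum_squares_le_sum_abs)
    also have "\<dots> < e" using t by simp
    finally have "(f (w + t *\<^sub>R d) - f w) / t < c" using e(2)[OF t(1)] by simp
    then show "f (w + t *\<^sub>R d) - f w \<le> c * t" using t(1) by (simp add: field_simps)
  qed
qed

text \<open>Gradient consistency in contrapositive form. A negative Clarke derivative means a
  uniform rate of decrease from all base points near \<open>zs\<close>, in particular from the
  displaced ones supplied by the mean value theorem. The smoothed quotients inherit this rate up to
  the error of the smooth part.\<close>

lemma gradient_consistency:
  fixes x :: "'N::finite \<Rightarrow> real^'n0::finite" and zs d :: "('n0,'n1::finite,'N) pt"
  assumes neg: "clarke_dd (Oobj x lam1 lam2 \<beta>) zs d < 0"
  shows "\<exists>\<delta>>0. \<exists>\<rho>>0. \<forall>z \<mu>. 0 < \<mu> \<longrightarrow> \<mu> < \<rho> \<longrightarrow> dist z zs < \<rho>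
    \<longrightarrow> gradHtil x \<beta> z \<mu> \<bullet> d + DR lam1 lam2 z d \<le> - \<delta>"
proof -
  let ?O = "Oobj x lam1 lam2 \<beta>" and ?N = "real CARD('N)" and ?M = "real CARD('n0)"
  let ?one = "ones :: ('n0,'n1,'N) pt"
  obtain c \<epsilon> where c: "c < 0" "0 < \<epsilon>" "\<And>w t. 0 < t \<Longrightarrow> t < \<epsilon> \<Longrightarrow> dist w zs < \<epsilon> \<Longrightarrow> ?O (w + t *\<^sub>R d) - ?O w \<le> c * t"
    using clarke_dd_negD[OF neg] by metis
  define \<omega> where "\<omega> = norm ?one"
  have \<omega>: "0 \<le> \<omega>" by (simp add: \<omega>_def)
  define K where "K = norm d * (2 * (norm zs + 1) + sqrt ?N) + 1"
  have K: "0 < K" unfolding K_def by (intro add_nonneg_pos mult_nonneg_nonneg add_nonneg_nonneg) auto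
  \<comment> \<open>The entry 1 bounds the norm of \<open>z\<close>, the second keeps the displaced
    base point within \<open>\<epsilon>\<close> of \<open>zs\<close>, and the third limits the error
    of the smooth part to half of the rate \<open>c\<close>.\<close>
  define \<rho> where "\<rho> = Min {1, \<epsilon> / (2 * (1 + \<omega>)), - c / (4 * ?M * K)}"
  have \<rho>: "0 < \<rho>" "\<rho> \<le> 1" "\<rho> \<le> \<epsilon> / (2 * (1 + \<omega>))" "\<rho> \<le> - c / (4 * ?M * K)"
  proof -
    have "0 < \<epsilon> / (2 * (1 + \<omega>))" using c(2) by (intro divide_pos_pos) (use \<omega> in auto)
    moreover have "0 < - c / (4 * ?M * K)" using c(1) K by (intro divide_pos_pos) auto
    ultimately show "0 < \<rho>" by (simp add: \<rho>_def)
  qed (auto simp: \<rho>_def)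
  have near: "\<rho> + \<rho> * \<omega> < \<epsilon>"
  proof -
    have "0 < 2 * (1 + \<omega>)" using \<omega> by simp
    then have "\<rho> + \<rho> * \<omega> \<le> \<epsilon> / 2" using \<rho>(3) by (simp add: field_simps)
    then show ?thesis using c(2) by linarith
  qed
  have upper: "gradHtil x \<beta> z \<mu> \<bullet> d + DR lam1 lam2 z d \<le> - (- c / 2)"
    if m: "0 < \<mu>" "\<mu> < \<rho>" and z: "dist z zs < \<rho>" for z \<mu>
  proof -
    let ?T = "\<lambda>w. Otil x lam1 lam2 \<beta> w \<mu>"
    let ?g = "\<lambda>t. c + 2 * \<mu> * (\<Sum>n\<in>UNIV. \<Sum>i\<in>UNIV. \<bar>dumat z d $ n $ i + t * (Vm d ** Wm d) $ n $ i\<bar>) / ?N"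
    have q: "(?T (z + t *\<^sub>R d) - ?T z) / t \<le> ?g t" if t: "0 < t" "t < \<epsilon>" for t
    proof -
      let ?w = "z + t *\<^sub>R d"
      obtain \<xi> where \<xi>: "0 < \<xi>" "\<xi> < \<mu>"
        "kinks x \<beta> ?w 0 (sig1 \<mu>) - kinks x \<beta> z 0 (sig1 \<mu>) = kinks x \<beta> ?w \<xi> pos - kinks x \<beta> z \<xi> pos"
        by (rule kinks_mean_value[OF m(1)])
      have "dist (z - \<xi> *\<^sub>R ?one) zs \<le> dist z zs + norm (\<xi> *\<^sub>R ?one)"
        using norm_triangle_ineq4[of "z - zs" "\<xi> *\<^sub>R ?one"] by (simp add: dist_norm algebra_simps)
      also have "norm (\<xi> *\<^sub>R ?one) \<le> \<rho> * \<omega>"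
        using \<xi> m \<omega> by (simp add: \<omega>_def[symmetric] mult_right_mono)
      finally have "dist (z - \<xi> *\<^sub>R ?one) zs < \<epsilon>" using near z by linarith
      from c(3)[OF t this] have Oq: "?O (?w - \<xi> *\<^sub>R ?one) - ?O (z - \<xi> *\<^sub>R ?one) \<le> c * t"
        by (simp add: algebra_simps)
      have "\<And>n i. umat ?w $ n $ i - umat z $ n $ i = t * (dumat z d $ n $ i + t * (Vm d ** Wm d) $ n $ i)"
        by (simp add: umat_add dumat_scaleR matrix_matrix_mult_def sum_distrib_left algebra_simps)
      then have um: "(\<Sum>n\<in>UNIV. \<Sum>i\<in>UNIV. \<bar>umat ?w $ n $ i - umat z $ n $ i\<bar>)
          = t * (\<Sum>n\<in>UNIV. \<Sum>i\<in>UNIV. \<bar>dumat z d $ n $ i + t * (Vm d ** Wm d) $ n $ i\<bar>)"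
        using t by (simp add: abs_mult sum_distrib_left)
      have S0: "0 \<le> (\<Sum>n\<in>UNIV. \<Sum>i\<in>UNIV. \<bar>dumat z d $ n $ i + t * (Vm d ** Wm d) $ n $ i\<bar>)"
        by (intro sum_nonneg) auto
      have "?T ?w - ?T z = (?O (?w - \<xi> *\<^sub>R ?one) - ?O (z - \<xi> *\<^sub>R ?one))
        + ((Smooth x lam1 lam2 \<beta> ?w - Smooth x lam1 lam2 \<beta> z)
         - (Smooth x lam1 lam2 \<beta> (?w - \<xi> *\<^sub>R ones) - Smooth x lam1 lam2 \<beta> (z - \<xi> *\<^sub>R ones)))"
        using \<xi>(3) unfolding Otil_split Oobj_split by simp
      also have "\<dots> \<le> c * t + 2 * \<xi> * (\<Sum>n\<in>UNIV. \<Sum>i\<in>UNIV. \<bar>umat ?w $ n $ i - umat z $ n $ i\<bar>) / ?N"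
        by (intro add_mono Oq Smooth_shift_diff \<xi>(1))
      also have "\<dots> = t * (c + 2 * \<xi> * (\<Sum>n\<in>UNIV. \<Sum>i\<in>UNIV. \<bar>dumat z d $ n $ i + t * (Vm d ** Wm d) $ n $ i\<bar>) / ?N)"
        unfolding um by (simp add: algebra_simps)
      also have "\<dots> \<le> t * ?g t"
        using t \<xi> m S0 by (intro mult_left_mono add_left_mono divide_right_mono mult_right_mono) auto
      finally show ?thesis using t by (simp add: divide_le_eq mult.commute)
    qed
    have lim: "(?g \<longlongrightarrow> ?g 0) (at_right 0)"
      by (intro tendsto_intros) auto
    have "gradHtil x \<beta> z \<mu> \<bullet> d + DR lam1 lam2 z d \<le> ?g 0"
    proof (rule tendsto_le[OF _ lim Otil_dir_deriv[OF m(1)]])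
      show "\<forall>\<^sub>F t in at_right 0. (?T (z + t *\<^sub>R d) - ?T z) / t \<le> ?g t"
        unfolding eventually_at_right_field using q c(2) by blast
    qed simp
    also have "?g 0 \<le> c / 2"
    proof -
      have "norm z \<le> norm zs + 1"
        using norm_triangle_ineq[of "z - zs" zs] z \<rho>(2) by (simp add: dist_norm)
      have "norm (dumat z d) \<le> norm d * norm z + norm z * norm d + sqrt ?N * norm d"
        by (rule order_trans[OF dumat_le]) (intro add_mono mult_mono norm_parts_le; simp)
      also have "\<dots> = norm d * (2 * norm z + sqrt ?N)" by (simp add: algebra_simps)
      also have "\<dots> \<le> norm d * (2 * (norm zs + 1) + sqrt ?N)"
        using \<open>norm z \<le> norm zs + 1\<close> by (intro mult_left_mono) auto
      finally have D: "norm (dumat z d) \<le> K" by (simp add: K_def)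
      have "\<bar>dumat z d $ n $ i\<bar> \<le> K" for n i
        using component_le_norm_cart[of "dumat z d $ n" i] Finite_Cartesian_Product.norm_nth_le[of "dumat z d" n] D by linarith
      then have "(\<Sum>n\<in>UNIV. \<Sum>i\<in>UNIV. \<bar>dumat z d $ n $ i\<bar>) \<le> (\<Sum>n\<in>(UNIV::'N set). \<Sum>i\<in>(UNIV::'n0 set). K)"
        by (intro sum_mono) auto
      then have "(\<Sum>n\<in>UNIV. \<Sum>i\<in>UNIV. \<bar>dumat z d $ n $ i\<bar>) / ?N \<le> ?M * K"
        by (simp add: field_simps)
      then have "2 * \<mu> * ((\<Sum>n\<in>UNIV. \<Sum>i\<in>UNIV. \<bar>dumat z d $ n $ i\<bar>) / ?N) \<le> 2 * \<rho> * (?M * K)"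
        using m K by (intro mult_mono) (auto intro!: divide_nonneg_nonneg sum_nonneg)
      also have "\<dots> \<le> - c / 2"
        using \<rho>(4) K by (simp add: field_simps)
      finally show ?thesis by simp
    qed
    finally show ?thesis by simp
  qed
  have "0 < - c / 2" using c by simp
  then show ?thesis using \<rho>(1) upper by blast
qed

context spg_run
begin

text \<open>The variational inequality speaks about feasible points, the Clarke derivative about the
  limiting direction \<open>d\<close>. One feasible point whose scaled difference is close to
  \<open>d\<close> links them: the uniform bound \<open>G\<close> controls the discrepancy for all
  large \<open>j\<close> at once.\<close>

lemma limit_stationary:
  assumes r: "strict_mono r" and K: "\<And>j. \<mu> (Suc (r j)) = tau1 * \<mu> (r j)"
    and lim: "(\<lambda>j. z (r j)) \<longlonglongrightarrow> zs"
  shows "gen_d_stationary (Oobj x lam1 lam2 \<beta>) (Zset x \<alpha>) zs"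
  unfolding gen_d_stationary_def
proof (intro conjI ballI)
  show "zs \<in> Zset x \<alpha>"
    by (rule closed_sequentially[OF Zset_closed _ lim]) (rule z_in)
  fix d assume "d \<in> tangent_cone (Zset x \<alpha>) zs"
  then obtain ws ts where ws: "\<And>k. ws k \<in> Zset x \<alpha>" "\<And>k. ts k > (0::real)"
    "(\<lambda>k. (1 / ts k) *\<^sub>R (ws k - zs)) \<longlonglongrightarrow> d"
    unfolding tangent_cone_def by blast
  show "0 \<le> clarke_dd (Oobj x lam1 lam2 \<beta>) zs d"
  proof (rule ccontr)
    assume "\<not> 0 \<le> clarke_dd (Oobj x lam1 lam2 \<beta>) zs d"
    then have "clarke_dd (Oobj x lam1 lam2 \<beta>) zs d < 0" by simp
    then obtain \<delta> \<rho> where \<delta>: "0 < \<delta>" "0 < \<rho>"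
      "\<And>z \<mu>. 0 < \<mu> \<Longrightarrow> \<mu> < \<rho> \<Longrightarrow> dist z zs < \<rho> \<Longrightarrow> gradHtil x \<beta> z \<mu> \<bullet> d + DR lam1 lam2 z d \<le> - \<delta>"
      using gradient_consistency by blast
    let ?D = "\<lambda>j e. gradHtil x \<beta> (z (r j)) (\<mu> (r j)) \<bullet> e + DR lam1 lam2 (z (r j)) e"
    have lin: "?D j (a + b) = ?D j a + ?D j b" "?D j (s *\<^sub>R a) = s * ?D j a" for j a b s
      by (simp_all add: inner_add_right DR_add DR_scaleR algebra_simps)
    obtain G where G: "0 < G" "\<And>k e. \<bar>gradHtil x \<beta> (z k) (\<mu> k) \<bullet> e + DR lam1 lam2 (z k) e\<bar> \<le> G * norm e"
      using grad_bounded by blast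
    have "\<forall>\<^sub>F k in sequentially. dist ((1 / ts k) *\<^sub>R (ws k - zs)) d < \<delta> / (4 * G)"
      using ws(3) \<delta> G by (intro tendstoD) auto
    then obtain k where k: "dist ((1 / ts k) *\<^sub>R (ws k - zs)) d < \<delta> / (4 * G)"
      using eventually_happens[of _ sequentially] by auto
    define h where "h = (1 / ts k) *\<^sub>R (ws k - zs)"
    have wh: "ws k - zs = ts k *\<^sub>R h" using ws(2)[of k] by (simp add: h_def)
    have ev1: "\<forall>\<^sub>F j in sequentially. - (\<delta> / 2 * ts k) < ?D j (ws k - zs)"
      using \<delta> ws(2)[of k] by (intro limit_VI[OF r K lim ws(1)]) auto
    have ev2: "\<forall>\<^sub>F j in sequentially. dist (z (r j)) zs < \<rho>" using lim \<delta> by (intro tendstoD)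
    have ev3: "\<forall>\<^sub>F j in sequentially. \<mu> (r j) < \<rho>"
      using mu_reduced_tendsto[OF r K] \<delta> by (intro order_tendstoD(2)) auto
    have "\<forall>\<^sub>F j in sequentially. False"
      using ev1 ev2 ev3
    proof eventually_elim
      case (elim j)
      have "?D j d \<le> - \<delta>" using \<delta>(3) elim mu_L[of "r j"] by auto
      moreover have "?D j (h - d) \<le> \<delta> / 4"
      proof -
        have "?D j (h - d) \<le> G * norm (h - d)" using G(2)[of "r j" "h - d"] by linarith
        also have "\<dots> \<le> G * (\<delta> / (4 * G))"
          using k G unfolding h_def dist_norm by (intro mult_left_mono) auto
        finally show ?thesis using G by simp
      qed
      ultimately have "?D j h \<le> - (\<delta> / 2)" using lin(1)[of j d "h - d"] \<delta>(1) by simp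
      then have "ts k * ?D j h \<le> ts k * - (\<delta> / 2)" using ws(2)[of k] by (intro mult_left_mono) auto
      then show False using elim(1) unfolding wh lin(2) by (simp add: mult.commute)
    qed
    then show False by simp
  qed
qed

end

lemma regular_d_stationary:
  assumes "gen_d_stationary f S zs" "regular_at f zs"
  shows "d_stationary f S zs"
  using assms unfolding gen_d_stationary_def regular_at_def d_stationary_def by (metis ereal_less_eq(5))

subsection \<open>Lower bounds for the gradient Lipschitz constant\<close>

text \<open>A family of test points on which the gradient can be evaluated in closed form: all
  pre-activations coincide, and the data enter only through their mean.\<close>

definition cpt :: "real \<Rightarrow> real \<Rightarrow> real \<Rightarrow> ('n0::finite,'n1::finite,'N::finite) pt" where
  "cpt w v b = ((\<chi> j i. w), ((\<chi> j. 0), (\<chi> i. b)), (\<chi> n j. v))"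

definition xmean :: "('N::finite \<Rightarrow> real^'n0::finite) \<Rightarrow> real" where
  "xmean x = (\<Sum>n\<in>UNIV. \<Sum>i\<in>UNIV. x n $ i) / (real CARD('N) * real CARD('n0))"

lemma umat_cpt: "umat (cpt w v b :: ('n0::finite,'n1::finite,'N::finite) pt) $ n $ i = real CARD('n1) * w * v + b"
  by (simp add: umat_nth cpt_def)

lemma dumat_cpt: "dumat (cpt w v b :: ('n0::finite,'n1::finite,'N::finite) pt) (cpt w' v' b') $ n $ i
   = real CARD('n1) * (v' * w + v * w') + b'"
  by (simp add: dumat_nth cpt_def algebra_simps)

lemma cpt_diff: "cpt w v b - cpt w' v' b' = cpt (w - w') (v - v') (b - b')"
  by (simp add: cpt_def vec_eq_iff)

lemma norm_cpt_square: "(norm (cpt w v b :: ('n0::finite,'n1::finite,'N::finite) pt))\<^sup>2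
   = real CARD('n1) * real CARD('n0) * w\<^sup>2 + real CARD('n0) * b\<^sup>2 + real CARD('N) * real CARD('n1) * v\<^sup>2"
  by (simp add: norm_pt_square norm_mat_square norm_vec_square cpt_def)

lemma DF_cpt:
  fixes x :: "'N::finite \<Rightarrow> real^'n0::finite"
  shows "DF x (cpt w v b :: ('n0,'n1::finite,'N) pt) \<mu> (cpt w' v' b')
   = 2 * real CARD('n0) * (pos (real CARD('n1) * w * v + b) - xmean x * dsig \<mu> (real CARD('n1) * w * v + b))
     * (real CARD('n1) * (v' * w + v * w') + b')"
proof -
  let ?u = "real CARD('n1) * w * v + b" and ?D = "real CARD('n1) * (v' * w + v * w') + b'"
  have "DF x (cpt w v b :: ('n0,'n1,'N) pt) \<mu> (cpt w' v' b')
    = (\<Sum>n\<in>UNIV. \<Sum>i\<in>UNIV. (2 * pos ?u - 2 * x n $ i * dsig \<mu> ?u) * ?D) / real CARD('N)"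
    unfolding DF_def inner_mat dumat_cpt gmat_def by (simp add: umat_cpt dphi_def)
  also have "\<dots> = (real CARD('N) * real CARD('n0) * (2 * pos ?u) - 2 * (\<Sum>n\<in>UNIV. \<Sum>i\<in>UNIV. x n $ i) * dsig \<mu> ?u) * ?D / real CARD('N)"
    by (simp add: sum_distrib_right[symmetric] sum_subtractf sum_distrib_left[symmetric])
  also have "(\<Sum>n\<in>UNIV. \<Sum>i\<in>UNIV. x n $ i) = real CARD('N) * real CARD('n0) * xmean x"
    by (simp add: xmean_def)
  also have "(real CARD('N) * real CARD('n0) * (2 * pos ?u) - 2 * (real CARD('N) * real CARD('n0) * xmean x) * dsig \<mu> ?u) * ?D / real CARD('N)
      = 2 * real CARD('n0) * (pos ?u - xmean x * dsig \<mu> ?u) * ?D"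
  proof -
    have "(N * a * (2 * p) - 2 * (N * a * y) * s) * D / N = 2 * a * (p - y * s) * D" if "N \<noteq> 0" for N a p y s D :: real
      using that by (simp add: field_simps)
    then show ?thesis by simp
  qed
  finally show ?thesis .
qed

lemma infnorm_pt_le_iff:
  fixes z :: "('n0::finite,'n1::finite,'N::finite) pt"
  shows "infnorm z \<le> c \<longleftrightarrow> (\<forall>j i. \<bar>Wm z $ j $ i\<bar> \<le> c) \<and> (\<forall>j. \<bar>Bh z $ j\<bar> \<le> c) \<and> (\<forall>i. \<bar>Bo z $ i\<bar> \<le> c)
     \<and> (\<forall>n j. \<bar>Vm z $ n $ j\<bar> \<le> c)"
proof -
  obtain W b1 b2 V where z: "z = (W, (b1, b2), V)" by (metis prod.collapse)
  show ?thesis by (simp add: z infnorm_pair_le_iff infnorm_vec_le_iff infnorm_real)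
qed

lemma xmean_square: "real CARD('n0) * (xmean x)\<^sup>2 \<le> frob2 x / real CARD('N)"
  for x :: "'N::finite \<Rightarrow> real^'n0::finite"
proof -
  let ?S = "\<Sum>n\<in>UNIV. \<Sum>i\<in>UNIV. x n $ i"
  have "?S\<^sup>2 = (\<Sum>p\<in>(UNIV::'N set) \<times> (UNIV::'n0 set). x (fst p) $ snd p * 1)\<^sup>2"
    by (simp add: sum.cartesian_product case_prod_beta)
  also have "\<dots> \<le> (\<Sum>p\<in>(UNIV::'N set) \<times> (UNIV::'n0 set). (x (fst p) $ snd p)\<^sup>2) * (\<Sum>p\<in>(UNIV::'N set) \<times> (UNIV::'n0 set). 1\<^sup>2)"
    by (rule Cauchy_Schwarz_ineq_sum)
  also have "\<dots> = frob2 x * (real CARD('N) * real CARD('n0))"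
    by (simp add: frob2_def norm_vec_square sum.cartesian_product case_prod_beta card_cartesian_product del: UNIV_Times_UNIV)
  finally have "?S\<^sup>2 \<le> frob2 x * (real CARD('N) * real CARD('n0))" .
  then have "real CARD('n0) * (?S\<^sup>2 / (real CARD('N) * real CARD('n0))\<^sup>2) \<le> real CARD('n0) * (frob2 x * (real CARD('N) * real CARD('n0)) / (real CARD('N) * real CARD('n0))\<^sup>2)"
    by (intro mult_left_mono divide_right_mono) auto
  then show ?thesis by (simp add: xmean_def power_divide power2_eq_square)
qed

lemma grad_lipschitz_test:
  fixes x :: "'N::finite \<Rightarrow> real^'n0::finite" and z z' e :: "('n0,'n1::finite,'N) pt"
  assumes Lip: "LgH-lipschitz_on ({w :: ('n0, 'n1, 'N) pt. infnorm w \<le> \<rho>} \<times> {0<..<1}) (\<lambda>(w, m). m *\<^sub>R gradHtil x \<beta> w m)"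
    and z: "infnorm z \<le> \<rho>" "infnorm z' \<le> \<rho>" and m: "0 < m" "m < 1" "0 < m'" "m' < 1"
  shows "m * (DF x z m e + DP x \<beta> z m e) - m' * (DF x z' m' e + DP x \<beta> z' m' e) \<le> LgH * dist (z, m) (z', m') * norm e"
proof -
  have "m * (DF x z m e + DP x \<beta> z m e) - m' * (DF x z' m' e + DP x \<beta> z' m' e)
      = (m *\<^sub>R gradHtil x \<beta> z m - m' *\<^sub>R gradHtil x \<beta> z' m') \<bullet> e"
    using m by (simp add: inner_diff_left gradHtil_inner)
  also have "\<dots> \<le> norm (m *\<^sub>R gradHtil x \<beta> z m - m' *\<^sub>R gradHtil x \<beta> z' m') * norm e"
    by (rule norm_cauchy_schwarz)
  also have "\<dots> \<le> LgH * dist (z, m) (z', m') * norm e"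
    using lipschitz_onD[OF Lip, of "(z, m)" "(z', m')"] z m by (intro mult_right_mono) (auto simp: dist_norm)
  finally show ?thesis .
qed

text \<open>Quantities at the corner where all weights and the output bias equal
  \<open>\<rho>\<close>: \<open>u\<close> is the pre-activation, \<open>g\<close> its derivative
  along \<open>(\<rho>, c, 1)\<close> with \<open>c = \<rho> * n0 / n\<close>, and \<open>h2\<close>
  the one along \<open>(0, c, 1)\<close>. The squared lengths of these directions are
  \<open>n0 * g\<close> and \<open>n0 * h2\<close>. The parameter \<open>dummy\<close> fixes the
  type of hidden units.\<close>

locale gradient_box =
  fixes x :: "'N::finite \<Rightarrow> real^'n0::finite" and \<beta> \<rho> LgH :: real and dummy :: "'n1::finite itself"
    and n n0 n1 A B u g h2 :: real
  assumes Lip: "LgH-lipschitz_on ({w :: ('n0, 'n1, 'N) pt. infnorm w \<le> \<rho>} \<times> {0<..<1}) (\<lambda>(w, m). m *\<^sub>R gradHtil x \<beta> w m)"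
    and rho: "0 < \<rho>" and beta: "0 \<le> \<beta>"
    and n: "n = real CARD('N)" "n0 = real CARD('n0)" "n1 = real CARD('n1)"
    and A: "A = n1 * \<rho>\<^sup>2" and B: "B = n1 * \<rho>\<^sup>2 * n0 / n"
    and u: "u = A + \<rho>" and g: "g = 1 + A + B" and h2: "h2 = 1 + B"
begin

lemma n_ge: "1 \<le> n" "1 \<le> n0" "1 \<le> n1"
  using n by (simp_all add: Suc_leI)

lemma AB_pos: "0 < A" "0 < B"
  using A B rho n_ge by simp_all

text \<open>The ratio \<open>\<rho> * n0 / n\<close> between the changes of \<open>V\<close> and \<open>b\<^sub>2\<close> maximises the change of the pre-activation
  per unit length.\<close>
lemma secant:
  assumes m: "0 < m" "m < 1" and t: "0 < t" "t \<le> \<rho>" "t * (n0 / n) \<le> 1"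
  shows "m * 2 * ((pos u - xmean x * dsig m u) * g - (pos (u - t * h2) - xmean x * dsig m (u - t * h2)) * (g - t * B))
     \<le> LgH * t * ((h2 + g) / 2)"
proof -
  define c where "c = \<rho> * n0 / n"
  let ?z = "cpt \<rho> \<rho> \<rho> :: ('n0,'n1,'N) pt" and ?z' = "cpt \<rho> (\<rho> - t * c) (\<rho> - t) :: ('n0,'n1,'N) pt"
    and ?e = "cpt \<rho> c 1 :: ('n0,'n1,'N) pt"
  have tc: "0 \<le> t * c" "t * c \<le> \<rho>"
    using t(1) rho n_ge mult_left_mono[OF t(3), of \<rho>] by (simp_all add: c_def mult_ac)
  have z: "infnorm ?z \<le> \<rho>" "infnorm ?z' \<le> \<rho>"
    using rho t tc by (auto simp: infnorm_pt_le_iff cpt_def)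
  have cB: "n1 * \<rho> * c = B" "n * n1 * c\<^sup>2 = n0 * B"
    using n_ge by (simp_all add: c_def B power2_eq_square field_simps)
  have u1: "n1 * \<rho> * \<rho> + \<rho> = u" by (simp add: u A power2_eq_square)
  have ut: "n1 * \<rho> * (\<rho> - t * c) + (\<rho> - t) = u - t * h2"
    using cB(1) by (simp add: u1[symmetric] h2 algebra_simps)
  have g1: "n1 * (c * \<rho> + \<rho> * \<rho>) + 1 = g" using cB(1) by (simp add: g A power2_eq_square algebra_simps)
  have gt: "n1 * (c * \<rho> + (\<rho> - t * c) * \<rho>) + 1 = g - t * B"
    using cB(1) by (simp add: g1[symmetric] algebra_simps)
  have DP: "DP x \<beta> ?z m ?e = DP x \<beta> ?z' m ?e" unfolding DP_def by (simp add: tmat_nth cpt_def)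
  have dist: "dist (?z, m) (?z', m) = t * sqrt (n0 * h2)"
  proof -
    have "(norm (cpt 0 (t * c) t :: ('n0,'n1,'N) pt))\<^sup>2 = t\<^sup>2 * (n0 * h2)"
      using cB(2) unfolding norm_cpt_square n[symmetric] h2 by (simp add: power_mult_distrib algebra_simps)
    then have "norm (cpt 0 (t * c) t :: ('n0,'n1,'N) pt) = sqrt (t\<^sup>2 * (n0 * h2))"
      by (metis norm_ge_zero real_sqrt_unique)
    then show ?thesis using t by (simp add: dist_Pair_Pair dist_norm cpt_diff real_sqrt_mult)
  qed
  have ne: "norm ?e = sqrt (n0 * g)"
  proof -
    have "(norm ?e)\<^sup>2 = n0 * g"
      using cB(2) unfolding norm_cpt_square n[symmetric] g A by (simp add: algebra_simps)
    then show ?thesis by (metis norm_ge_zero real_sqrt_unique)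
  qed
  have hg: "0 \<le> h2" "0 \<le> g" using AB_pos by (simp_all add: h2 g)
  have "2 * n0 * (m * ((pos u - xmean x * dsig m u) * g - (pos (u - t * h2) - xmean x * dsig m (u - t * h2)) * (g - t * B)))
     = m * (DF x ?z m ?e + DP x \<beta> ?z m ?e) - m * (DF x ?z' m ?e + DP x \<beta> ?z' m ?e)"
    unfolding DP DF_cpt n[symmetric] u1 ut g1 gt by (simp add: algebra_simps)
  also have "\<dots> \<le> LgH * dist (?z, m) (?z', m) * norm ?e"
    by (rule grad_lipschitz_test[OF Lip z m m])
  also have "\<dots> = LgH * t * (n0 * (sqrt h2 * sqrt g))"
    unfolding dist ne using n_ge by (simp add: real_sqrt_mult)
  \<comment> \<open>Replacing the geometric mean by the arithmetic one keeps the resulting lower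
    bounds rational in \<open>\<rho>\<close> and the dimensions.\<close>
  also have "\<dots> \<le> LgH * t * (n0 * ((h2 + g) / 2))"
  proof -
    have "sqrt h2 * sqrt g \<le> (h2 + g) / 2"
      using arith_geo_mean_sqrt[OF hg] by (simp add: real_sqrt_mult)
    moreover have "0 \<le> LgH" using Lip lipschitz_on_nonneg by blast
    ultimately show ?thesis using t n_ge by (intro mult_left_mono) auto
  qed
  finally have "n0 * (m * 2 * ((pos u - xmean x * dsig m u) * g - (pos (u - t * h2) - xmean x * dsig m (u - t * h2)) * (g - t * B)))
     \<le> n0 * (LgH * t * ((h2 + g) / 2))"
    by (simp add: algebra_simps)
  then show ?thesis using n_ge by simp
qed

text \<open>Here \<open>m = 1 - s\<close> exceeds \<open>u\<close>, so that \<open>dsig m\<close> is still in its linear range, and \<open>s\<close> tends to \<open>0\<close>.\<close>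
lemma lower_small:
  assumes "u < 1"
  shows "(1 - xmean x) * ((4 * h2 * g + 4 * u * B) / (2 + A + 2 * B)) \<le> LgH"
proof -
  let ?x = "xmean x"
  have u0: "0 < u" using AB_pos rho u by simp
  have h0: "0 < h2" using AB_pos h2 by simp
  define T where "T = Min {\<rho>, n / n0, u / h2, 1 - u, 1}"
  have T: "0 < T" "T \<le> \<rho>" "T \<le> n / n0" "T \<le> u / h2" "T \<le> 1 - u" "T \<le> 1"
    using assms u0 h0 rho n_ge by (auto simp: T_def)
  have ineq: "2 * (1 - s - ?x) * (h2 * g + u * B - s * (h2 * B)) \<le> LgH * ((h2 + g) / 2)" if s: "0 < s" "s < T" for s
  proof -
    have m: "0 < 1 - s" "1 - s < 1" "u \<le> 1 - s" using s T by auto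
    have "s \<le> n / n0" "s \<le> u / h2" using s T by linarith+
    then have 1: "s \<le> \<rho>" "s * (n0 / n) \<le> 1" "s * h2 \<le> u"
      using s T n_ge h0 by (auto simp: field_simps)
    have d: "dsig (1 - s) u = u / (1 - s)" "dsig (1 - s) (u - s * h2) = (u - s * h2) / (1 - s)"
      using m 1 u0 s h0 by (auto intro!: dsig_linear simp: mult_nonneg_nonneg less_imp_le intro: order_trans[OF _ m(3)])
    have p: "pos u = u" "pos (u - s * h2) = u - s * h2" using u0 1 by (auto simp: pos_def)
    have "(1 - s) * 2 * ((u - ?x * (u / (1 - s))) * g - ((u - s * h2) - ?x * ((u - s * h2) / (1 - s))) * (g - s * B))
       = s * (2 * (1 - s - ?x) * (h2 * g + u * B - s * (h2 * B)))"
    proof -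
      have f: "(1 - s) * (v - ?x * (v / (1 - s))) = (1 - s - ?x) * v" for v
        using m by (simp add: field_simps)
      have gen: "m * 2 * (a * b - c * d) = 2 * ((m * a) * b - (m * c) * d)" for m a b c d :: real
        by (simp add: algebra_simps)
      have "(1 - s) * 2 * ((u - ?x * (u / (1 - s))) * g - ((u - s * h2) - ?x * ((u - s * h2) / (1 - s))) * (g - s * B))
        = 2 * ((1 - s - ?x) * u * g - (1 - s - ?x) * (u - s * h2) * (g - s * B))"
        unfolding gen f ..
      also have "\<dots> = s * (2 * (1 - s - ?x) * (h2 * g + u * B - s * (h2 * B)))"
        by (simp add: algebra_simps)
      finally show ?thesis .
    qed
    then have "s * (2 * (1 - s - ?x) * (h2 * g + u * B - s * (h2 * B))) \<le> s * (LgH * ((h2 + g) / 2))"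
      using secant[OF m(1,2) s(1) 1(1,2)] unfolding d p by (simp add: mult.assoc mult.left_commute)
    then show ?thesis by (rule mult_left_le_imp_le) (rule s)
  qed
  have lim: "((\<lambda>s. 2 * (1 - s - ?x) * (h2 * g + u * B - s * (h2 * B))) \<longlongrightarrow> 2 * (1 - 0 - ?x) * (h2 * g + u * B - 0 * (h2 * B))) (at_right 0)"
    by (intro tendsto_intros)
  have "2 * (1 - 0 - ?x) * (h2 * g + u * B - 0 * (h2 * B)) \<le> LgH * ((h2 + g) / 2)"
    by (rule tendsto_upperbound[OF lim]) (use ineq T in \<open>auto simp: eventually_at_right_field\<close>)
  moreover have D: "2 + A + 2 * B = h2 + g" by (simp add: h2 g)
  ultimately have "(1 - ?x) * (4 * h2 * g + 4 * u * B) \<le> LgH * (2 + A + 2 * B)"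
    unfolding D by (simp add: algebra_simps)
  then show ?thesis using AB_pos by (simp add: field_simps)
qed

text \<open>At \<open>m = 1 - s\<close> both pre-activations lie beyond the smoothing zone, so
  \<open>dsig\<close> is 1 and the data cost only a constant shift. The step length is the square of
  \<open>s\<close>: the pre-activation then drops by at most \<open>s\<close> and stays above
  \<open>m\<close> even if \<open>u = 1\<close>.\<close>

lemma lower_large:
  assumes "1 \<le> u"
  shows "(4 * h2 * g + 4 * (u - xmean x) * B) / (2 + A + 2 * B) \<le> LgH"
proof -
  let ?x = "xmean x"
  have h0: "0 < h2" using AB_pos h2 by simp
  define T where "T = Min {\<rho>, n / n0, 1 / h2, 1 / 2}"
  have T: "0 < T" "T \<le> \<rho>" "T \<le> n / n0" "T \<le> 1 / h2" "T \<le> 1 / 2"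
  proof -
    show "0 < T" using h0 rho n_ge by (simp add: T_def)
    show "T \<le> 1 / 2" unfolding T_def by (rule Min_le) auto
  qed (auto simp: T_def)
  have ineq: "2 * (1 - s) * (h2 * g + (u - ?x) * B - s\<^sup>2 * (h2 * B)) \<le> LgH * ((h2 + g) / 2)" if s: "0 < s" "s < T" for s
  proof -
    have m: "0 < 1 - s" "1 - s < 1" "1 - s \<le> u" using s T assms by auto
    have s2: "0 < s\<^sup>2" "s\<^sup>2 \<le> s"
      using s T mult_left_le[of s s] by (auto simp: power2_eq_square)
    have "s \<le> n / n0" "s \<le> 1 / h2" using s T by linarith+
    then have "s * (n0 / n) \<le> 1" "s * h2 \<le> 1" using n_ge h0 by (auto simp: field_simps)
    moreover have "s\<^sup>2 * (n0 / n) \<le> s * (n0 / n)" using s2 n_ge by (intro mult_right_mono) auto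
    moreover have "s\<^sup>2 * h2 \<le> s"
      using mult_left_mono[OF \<open>s * h2 \<le> 1\<close>, of s] s by (simp add: power2_eq_square mult.assoc)
    ultimately have 1: "s\<^sup>2 \<le> \<rho>" "s\<^sup>2 * (n0 / n) \<le> 1" "1 - s \<le> u - s\<^sup>2 * h2"
      using s2 s T assms by linarith+
    have d: "dsig (1 - s) u = 1" "dsig (1 - s) (u - s\<^sup>2 * h2) = 1"
      using m 1 by (auto intro!: dsig_eq_1)
    have p: "pos u = u" "pos (u - s\<^sup>2 * h2) = u - s\<^sup>2 * h2" using m 1 by (auto simp: pos_def)
    have "(1 - s) * 2 * ((u - ?x * 1) * g - ((u - s\<^sup>2 * h2) - ?x * 1) * (g - s\<^sup>2 * B))
       = s\<^sup>2 * (2 * (1 - s) * (h2 * g + (u - ?x) * B - s\<^sup>2 * (h2 * B)))"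
      by (simp add: algebra_simps)
    then have "s\<^sup>2 * (2 * (1 - s) * (h2 * g + (u - ?x) * B - s\<^sup>2 * (h2 * B))) \<le> s\<^sup>2 * (LgH * ((h2 + g) / 2))"
      using secant[OF m(1,2) s2(1) 1(1,2)] unfolding d p by (simp add: mult.assoc mult.left_commute)
    then show ?thesis by (rule mult_left_le_imp_le) (rule s2)
  qed
  have lim: "((\<lambda>s. 2 * (1 - s) * (h2 * g + (u - ?x) * B - s\<^sup>2 * (h2 * B))) \<longlongrightarrow> 2 * (1 - 0) * (h2 * g + (u - ?x) * B - 0\<^sup>2 * (h2 * B))) (at_right 0)"
    by (intro tendsto_intros)
  have "2 * (1 - 0) * (h2 * g + (u - ?x) * B - 0\<^sup>2 * (h2 * B)) \<le> LgH * ((h2 + g) / 2)"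
    by (rule tendsto_upperbound[OF lim]) (use ineq T in \<open>auto simp: eventually_at_right_field\<close>)
  moreover have D: "2 + A + 2 * B = h2 + g" by (simp add: h2 g)
  ultimately have "4 * h2 * g + 4 * (u - ?x) * B \<le> LgH * (2 + A + 2 * B)"
    unfolding D by (simp add: algebra_simps)
  then show ?thesis using AB_pos by (simp add: field_simps)
qed

text \<open>The two points differ only in the smoothing parameter: \<open>1/2\<close> against \<open>1/4\<close>.\<close>
lemma lower_gradient:
  assumes "1 \<le> u"
  shows "2 * (u - xmean x) * sqrt (n0 * h2) \<le> LgH"
proof -
  define c where "c = \<rho> * n0 / n"
  let ?z = "cpt \<rho> \<rho> \<rho> :: ('n0,'n1,'N) pt" and ?e = "cpt 0 c 1 :: ('n0,'n1,'N) pt"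
  have c: "0 \<le> c" using rho n_ge by (simp add: c_def)
  have z: "infnorm ?z \<le> \<rho>" using rho by (auto simp: infnorm_pt_le_iff cpt_def)
  have cB: "n1 * \<rho> * c = B" "n * n1 * c\<^sup>2 = n0 * B"
    using n_ge by (simp_all add: c_def B power2_eq_square field_simps)
  have u1: "n1 * \<rho> * \<rho> + \<rho> = u" by (simp add: u A power2_eq_square)
  have DF: "DF x ?z m ?e = 2 * n0 * (u - xmean x) * h2" if "0 < m" "m \<le> 1" for m
    unfolding DF_cpt n[symmetric] u1 using that assms cB(1)
    by (simp add: dsig_eq_1 pos_def h2 algebra_simps)
  have DP: "DP x \<beta> ?z m ?e = \<beta> * (n * n1 * c)" for m
    unfolding DP_def by (simp add: tmat_nth cpt_def n)
  have ne: "norm ?e = sqrt (n0 * h2)"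
  proof -
    have "(norm ?e)\<^sup>2 = n0 * h2"
      using cB(2) unfolding norm_cpt_square n[symmetric] h2 by (simp add: algebra_simps)
    then show ?thesis by (metis norm_ge_zero real_sqrt_unique)
  qed
  have P: "0 \<le> \<beta> * (n * n1 * c)" using beta c n_ge by simp
  have "(1/2 :: real) * (DF x ?z (1/2) ?e + DP x \<beta> ?z (1/2) ?e) - (1/4) * (DF x ?z (1/4) ?e + DP x \<beta> ?z (1/4) ?e)
     \<le> LgH * dist (?z, 1/2 :: real) (?z, 1/4) * norm ?e"
    by (rule grad_lipschitz_test[OF Lip z z]) auto
  moreover have "dist (?z, 1/2 :: real) (?z, 1/4) = 1/4" by (simp add: dist_Pair_Pair dist_real_def)
  ultimately have "2 * n0 * (u - xmean x) * h2 + \<beta> * (n * n1 * c) \<le> LgH * sqrt (n0 * h2)"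
    by (simp add: DF DP ne)
  then have le: "2 * (u - xmean x) * (n0 * h2) \<le> LgH * sqrt (n0 * h2)" using P by (simp add: algebra_simps)
  have pos: "0 < n0 * h2" using n_ge AB_pos h2 by simp
  then have "2 * (u - xmean x) * sqrt (n0 * h2) * sqrt (n0 * h2) \<le> LgH * sqrt (n0 * h2)"
    using le by (simp add: mult.assoc)
  then show ?thesis using pos by simp
qed

end

subsection \<open>The step-size budget\<close>

lemma mult_absorb_square:
  fixes a x b :: real
  assumes "0 < a"
  shows "- (b\<^sup>2 / (4 * a)) \<le> a * x\<^sup>2 - b * x"
proof -
  have "0 \<le> (2 * a * x - b)\<^sup>2 / (4 * a)" using assms by simp
  also have "\<dots> = a * x\<^sup>2 - b * x + b\<^sup>2 / (4 * a)"
    using assms by (simp add: power2_diff field_simps power2_eq_square)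
  finally show ?thesis by simp
qed

text \<open>For \<open>\<kappa> = 11/10\<close> one has \<open>c = 20/9\<close>; then
  \<open>10/11\<close> is \<open>1 / \<kappa>\<close> and \<open>445/324\<close> is
  \<open>(c\<^sup>2 + c / 4) / 4\<close>, the last quarter coming from
  \<open>\<eta> \<le> \<rho> / 2\<close>. The slack \<open>l\<close> is the price of the data mean
  after completing the square, with one value for each regime of \<open>u\<close>.\<close>

lemma budget_polynomial:
  fixes \<rho> n n0 n1 l :: real
  assumes n: "1 \<le> n" "1 \<le> n0" "1 \<le> n1" and rho: "0 < \<rho>" "\<rho> \<le> 9/5"
    and e: "e = \<rho>\<^sup>2 / n" and A: "A = n1 * \<rho>\<^sup>2" and B: "B = n1 * \<rho>\<^sup>2 * n0 / n" and D: "D = 2 + A + 2 * B"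
    and l: "l = \<rho>\<^sup>2 / 32 \<or> A + \<rho> < 1 \<and> l = 49/128 * \<rho>\<^sup>2"
  shows "10/11 * (2 + (445/324 + n1 + 2 * n0) * e) + l \<le> (4 * (1 + B) * (1 + A + B) + 4 * (A + \<rho>) * B) / D"
proof -
  define r2 where "r2 = \<rho>\<^sup>2"
  have r2: "0 < r2" "r2 \<le> 81/25" using rho power_mono[OF rho(2), of 2] by (simp_all add: r2_def power2_eq_square)
  define E where "E = n1 * e"
  have e0: "0 \<le> e" "e \<le> r2" using n r2 by (simp_all add: e r2_def[symmetric] divide_le_eq)
  have A0: "0 < A" "r2 \<le> A" using n r2 by (simp_all add: A r2_def[symmetric])
  have BE: "B = n0 * E" by (simp add: B E_def e)
  have E: "0 \<le> E" "e \<le> E" "E \<le> A" "E \<le> B"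
  proof -
    show 1: "0 \<le> E" using n e0 by (simp add: E_def)
    show "e \<le> E" using n e0 mult_right_mono[of 1 n1 e] by (simp add: E_def)
    show "E \<le> A" unfolding E_def A using n e0 by (intro mult_left_mono) (auto simp: r2_def)
    show "E \<le> B" unfolding BE using n 1 mult_right_mono[of 1 n0 E] by simp
  qed
  have B0: "0 \<le> B" using E by linarith
  have D0: "0 < D" using A0 B0 D by simp
  have f: "n0 * e \<le> B" unfolding BE using n E by (intro mult_left_mono) auto
  \<comment> \<open>Each product is named and compared once, after which the polynomial inequality
    is linear in these names.\<close>
  define AB where "AB = A * B"
  define BB where "BB = B * B"
  define rB where "rB = \<rho> * B"
  define qB where "qB = r2 * B"
  have p1: "E * A \<le> AB" unfolding AB_def using mult_right_mono[OF E(4), of A] A0 by (simp add: mult.commute)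
  have p2: "E * B \<le> AB" unfolding AB_def using E B0 by (intro mult_right_mono) auto
  have p3: "e * A \<le> qB"
  proof -
    have "e * A = r2 * E" by (simp add: A E_def r2_def)
    also have "\<dots> \<le> qB" unfolding qB_def using E r2 by (intro mult_left_mono) auto
    finally show ?thesis .
  qed
  have p4: "e * B \<le> qB" unfolding qB_def using e0 B0 by (intro mult_right_mono) auto
  have p5: "qB \<le> AB" unfolding qB_def AB_def using A0 B0 by (intro mult_right_mono) auto
  have p6: "qB \<le> 9/5 * rB"
  proof -
    have "qB = \<rho> * rB" by (simp add: qB_def rB_def r2_def power2_eq_square)
    also have "\<dots> \<le> 9/5 * rB" using rho B0 by (intro mult_right_mono) (auto simp: rB_def)
    finally show ?thesis .
  qed
  have p7: "n0 * e * D \<le> 2 * B + AB + 2 * BB"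
    using mult_right_mono[OF f, of D] D0 by (simp add: D AB_def BB_def algebra_simps)
  have p8: "\<rho> * e \<le> rB" unfolding rB_def using rho E by (intro mult_left_mono) auto
  have nn: "0 \<le> BB" "0 \<le> AB" "0 \<le> rB" "0 \<le> qB"
    using A0 B0 rho r2 by (simp_all add: BB_def AB_def rB_def qB_def)
  \<comment> \<open>The right-hand side is what the other terms leave of the target: for instance
    \<open>4/11 = 4 - 40/11\<close> and \<open>2225/891 = 2 * (10/11) * (445/324)\<close>. The
    missing \<open>3/5\<close> of \<open>rB\<close> is set aside for the terms in
    \<open>qB\<close>.\<close>
  have lD: "l * D \<le> 4/11 + 4/11 * A + 8/11 * B + (4 - 3/5) * rB - 2225/891 * e"
    using l
  proof
    assume l: "l = \<rho>\<^sup>2 / 32"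
    have "l * D = 1/16 * r2 + 1/32 * (r2 * A) + 1/16 * qB" by (simp add: l D r2_def qB_def algebra_simps)
    moreover have "r2 * A \<le> 81/25 * A" using r2 A0 by (intro mult_right_mono) auto
    moreover have "2225/891 * e \<le> 4/11 + 9/10 * e + 3 * (\<rho> * e)"
    proof (cases "1/2 \<le> \<rho>")
      case True
      then have "1/2 * e \<le> \<rho> * e" using e0 by (intro mult_right_mono) auto
      then show ?thesis using e0 r2 by linarith
    next
      case False
      have "(1/2 - \<rho>) * e \<le> (1/2 - \<rho>) * r2" using False e0 by (intro mult_left_mono) auto
      \<comment> \<open>The cubic attains its maximum on the positive axis at
        \<open>\<rho> = 1/3\<close>, which explains the double root in the square below.\<close>
      moreover have "(1/2 - \<rho>) * r2 \<le> 1/54"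
      proof -
        have "0 \<le> (\<rho> - 1/3)\<^sup>2 * (\<rho> + 1/6)" using rho by simp
        then show ?thesis by (simp add: r2_def power2_eq_square algebra_simps)
      qed
      ultimately have "1/2 * e - \<rho> * e \<le> 1/54" by (simp add: algebra_simps)
      moreover have "e \<le> 1/4" using e0 False rho power_mono[of \<rho> "1/2" 2] by (simp add: r2_def power2_eq_square)
      ultimately show ?thesis using e0 by linarith
    qed
    moreover have "1/16 * r2 + 1/32 * rA + 1/16 * q \<le> 4/11 + 4/11 * A + 8/11 * B + (4 - 3/5) * rB - 2225/891 * e"
      if "rA \<le> 81/25 * A" "2225/891 * e \<le> 4/11 + 9/10 * e + 3 * re" "q \<le> 9/5 * rB" "re \<le> rB" for rA re q
      using that A0(2) E(2,4) nn(3) e0 by argo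
    ultimately show ?thesis using p6 p8 by simp
  next
    assume "A + \<rho> < 1 \<and> l = 49/128 * \<rho>\<^sup>2"
    then have l: "l = 49/128 * \<rho>\<^sup>2" and A1: "A + \<rho> < 1" by auto
    \<comment> \<open>From \<open>\<rho>\<^sup>2 + \<rho> < 1\<close>: the reciprocal of the golden
      ratio, rounded up.\<close>
    have rho1: "\<rho> \<le> 62/100"
    proof (rule ccontr)
      assume c: "\<not> \<rho> \<le> 62/100"
      then have "(62/100)\<^sup>2 \<le> r2" unfolding r2_def by (intro power_mono) auto
      then show False using c A1 A0 by (simp add: power2_eq_square)
    qed
    have r21: "r2 \<le> 39/100" using power_mono[OF rho1, of 2] rho by (simp add: r2_def power2_eq_square)
    have lDeq: "l * D = 49/128 * (2 * r2 + r2 * A + 2 * qB)" by (simp add: l D r2_def qB_def algebra_simps)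
    have q1: "r2 * A \<le> 39/100 * A" using r21 A0 by (intro mult_right_mono) auto
    have q2: "qB \<le> 62/100 * rB"
    proof -
      have "qB = \<rho> * rB" by (simp add: qB_def rB_def r2_def power2_eq_square)
      also have "\<dots> \<le> 62/100 * rB" using rho1 B0 rho by (intro mult_right_mono) (auto simp: rB_def)
      finally show ?thesis .
    qed
    have "0 \<le> 36/100 - 56/100 * r2 + (29/10 * \<rho> - 178/100) * e"
    proof (cases "178/290 \<le> \<rho>")
      case True
      then have "0 \<le> (29/10 * \<rho> - 178/100) * e" using e0 by (intro mult_nonneg_nonneg) auto
      then show ?thesis using r21 by simp
    next
      case False
      have "(178/100 - 29/10 * \<rho>) * e \<le> (178/100 - 29/10 * \<rho>) * r2"
        using False e0 by (intro mult_left_mono) auto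
      moreover have "0 \<le> 36/100 - 234/100 * r2 + 29/10 * (\<rho> * r2)"
      proof -
        have "0 \<le> \<rho> * (\<rho> - 1/2)\<^sup>2" using rho by simp
        then have "r2 - 1/4 * \<rho> \<le> \<rho> * r2" by (simp add: r2_def power2_eq_square algebra_simps)
        moreover have "0 \<le> 56/100 * (\<rho> - 5/8)\<^sup>2" by simp
        then have "0 \<le> 56/100 * r2 - 7/10 * \<rho> + 56/100 * (25/64)" by (simp add: r2_def power2_eq_square algebra_simps)
        ultimately show ?thesis using rho rho1 by linarith
      qed
      ultimately show ?thesis by (simp add: algebra_simps)
    qed
    then have q3: "0 \<le> 36/100 - 56/100 * r2 + 29/10 * (\<rho> * e) - 178/100 * e" by (simp add: algebra_simps)
    have lin: "49/128 * (2 * r2 + rA + 2 * q) \<le> 4/11 + 4/11 * A + 8/11 * B + (4 - 3/5) * rB - 2225/891 * e"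
      if "rA \<le> 39/100 * A" "q \<le> 62/100 * rB" "0 \<le> 36/100 - 56/100 * r2 + 29/10 * re - 178/100 * e" "re \<le> rB" for rA re q
      using that A0(2) E(2,4) nn(3) e0 by argo
    show ?thesis unfolding lDeq by (rule lin[OF q1 q2 q3 p8])
  qed
  have "(10/11 * (2 + (445/324 + n1 + 2 * n0) * e) + l) * D
     = 20/11 * (2 + A + 2 * B) + 10/11 * 445/324 * (2 * e + e * A + 2 * (e * B)) + 10/11 * (2 * E + E * A + 2 * (E * B)) + 20/11 * (n0 * e * D) + l * D"
    by (simp add: D E_def field_simps)
  also have "\<dots> \<le> 4 * (1 + B) * (1 + A + B) + 4 * (A + \<rho>) * B"
  proof -
    have eq: "4 * (1 + B) * (1 + A + B) + 4 * (A + \<rho>) * B = 4 + 4 * A + 8 * B + 8 * AB + 4 * BB + 4 * rB"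
      by (simp add: AB_def BB_def rB_def algebra_simps)
    have lin: "20/11 * (2 + A + 2 * B) + 10/11 * 445/324 * (2 * e + eA + 2 * eB) + 10/11 * (2 * E + EA + 2 * EB) + 20/11 * f + lD
      \<le> 4 + 4 * A + 8 * B + 8 * AB + 4 * BB + 4 * rB"
      if "EA \<le> AB" "EB \<le> AB" "eA \<le> qB" "eB \<le> qB" "f \<le> 2 * B + AB + 2 * BB"
        "lD \<le> 4/11 + 4/11 * A + 8/11 * B + (4 - 3/5) * rB - 2225/891 * e" for EA EB eA eB f lD
      using that p5 p6 E(3) nn by argo
    show ?thesis unfolding eq by (rule lin[OF p1 p2 p3 p4 p7 lD])
  qed
  finally show ?thesis using D0 by (simp add: le_divide_eq)
qed

text \<open>The data mean \<open>x\<close> weakens the secant bound by \<open>S * x\<close> in the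
  linear regime and by \<open>(4 * B / D) * x\<close> in the saturated one. The quadratic term
  \<open>Q\<close> compensates: minimising over \<open>x\<close> leaves at most
  \<open>49/128 * \<rho>\<^sup>2\<close> and \<open>\<rho>\<^sup>2 / 32\<close>.\<close>

lemma budget_small_radius:
  fixes \<rho> n n0 n1 x Lg Q c0 :: real
  assumes n: "1 \<le> n" "1 \<le> n0" "1 \<le> n1" and nat: "n0 * \<rho>\<^sup>2 * n1 / n = B" and rho: "0 < \<rho>" "\<rho> \<le> 9/5"
    and A: "A = n1 * \<rho>\<^sup>2"
    and Q: "32 * n1 * n0\<^sup>2 * x\<^sup>2 / \<rho>\<^sup>2 \<le> Q" and c0: "Q + Lg \<le> c0"
    and S1: "A + \<rho> < 1 \<Longrightarrow> (1 - x) * ((4 * (1 + B) * (1 + A + B) + 4 * (A + \<rho>) * B) / (2 + A + 2 * B)) \<le> Lg"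
    and S2: "1 \<le> A + \<rho> \<Longrightarrow> (4 * (1 + B) * (1 + A + B) + 4 * (A + \<rho> - x) * B) / (2 + A + 2 * B) \<le> Lg"
  shows "10/11 * (2 + (445/324 + n1 + 2 * n0) * (\<rho>\<^sup>2 / n)) \<le> c0"
proof -
  have B: "B = n1 * \<rho>\<^sup>2 * n0 / n" using nat by (simp add: mult_ac)
  define D where "D = 2 + A + 2 * B"
  define S where "S = (4 * (1 + B) * (1 + A + B) + 4 * (A + \<rho>) * B) / D"
  have A0: "0 < A" and B0: "0 < B" using n rho by (simp_all add: A B)
  have D0: "0 < D" using A0 B0 by (simp add: D_def)
  have nn: "1 \<le> n1 * n0\<^sup>2" using n mult_mono[of 1 n1 1 "n0\<^sup>2"] by simp
  show ?thesis
  proof (cases "A + \<rho> < 1")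
    case True
    \<comment> \<open>This coarse bound suffices because \<open>Q\<close> carries the factor
      \<open>n0\<^sup>2\<close>, which cancels that of the squared \<open>S\<close>.\<close>
    have S: "0 \<le> S" "S \<le> 7 * n0"
    proof -
      show "0 \<le> S" unfolding S_def using A0 B0 D0 rho by (intro divide_nonneg_nonneg) auto
      have "B = A * n0 / n" by (simp add: A B)
      also have "\<dots> \<le> A * n0" using n A0 by (simp add: divide_le_eq mult_le_cancel_left)
      also have "\<dots> \<le> 1 * n0" using True rho n by (intro mult_right_mono) auto
      finally have "B \<le> n0" by simp
      have "4 * (1 + B) * (1 + A + B) + 4 * (A + \<rho>) * B \<le> (5 + 2 * B) * D"
      proof -
        have "4 * (A + \<rho>) * B \<le> 4 * 1 * B" using True B0 by (intro mult_right_mono) auto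
        moreover have "A * B \<le> 1 * B" using True rho B0 by (intro mult_right_mono) auto
        moreover have "4 * (1 + B) * (1 + A + B) = 4 + 4 * A + 8 * B + 4 * (A * B) + 4 * (B * B)"
          "(5 + 2 * B) * D = 10 + 5 * A + 14 * B + 2 * (A * B) + 4 * (B * B)"
          by (simp_all add: D_def algebra_simps)
        ultimately show ?thesis using A0 B0 by linarith
      qed
      then have "S \<le> 5 + 2 * B" unfolding S_def using D0 by (simp add: divide_le_eq)
      then show "S \<le> 7 * n0" using \<open>B \<le> n0\<close> n by linarith
    qed
    define a where "a = 32 * n1 * n0\<^sup>2 / \<rho>\<^sup>2"
    have a0: "0 < a" using n rho by (simp add: a_def)
    have "S\<^sup>2 / (4 * a) \<le> 49/128 * \<rho>\<^sup>2"
    proof -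
      have "S\<^sup>2 \<le> (7 * n0)\<^sup>2" using S by (intro power_mono) auto
      also have "\<dots> \<le> 49 * (n1 * n0\<^sup>2)" using n mult_right_mono[of 1 n1 "n0\<^sup>2"] by (simp add: power_mult_distrib)
      finally have "S\<^sup>2 / (4 * a) \<le> 49 * (n1 * n0\<^sup>2) / (4 * a)" using a0 by (intro divide_right_mono) auto
      also have "\<dots> = 49/128 * \<rho>\<^sup>2" using n rho by (simp add: a_def field_simps)
      finally show ?thesis .
    qed
    then have "- (49/128 * \<rho>\<^sup>2) \<le> a * x\<^sup>2 - S * x" using mult_absorb_square[OF a0, of S x] by linarith
    moreover have "a * x\<^sup>2 \<le> Q" using Q by (simp add: a_def)
    moreover have "(1 - x) * S \<le> Lg" using S1[OF True] unfolding S_def D_def .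
    ultimately have "S - 49/128 * \<rho>\<^sup>2 \<le> c0" using c0 by (simp add: algebra_simps)
    moreover have "10/11 * (2 + (445/324 + n1 + 2 * n0) * (\<rho>\<^sup>2 / n)) + 49/128 * \<rho>\<^sup>2 \<le> S"
      unfolding S_def by (rule budget_polynomial[OF n rho refl A B D_def]) (use True in simp)
    ultimately show ?thesis by linarith
  next
    case False
    have "(4 * (1 + B) * (1 + A + B) + 4 * (A + \<rho> - x) * B) / D = S - x * (4 * B / D)"
      by (simp add: S_def diff_divide_distrib[symmetric] algebra_simps)
    then have Lg: "S - x * (4 * B / D) \<le> Lg" using S2 False by (simp add: D_def)
    have q: "0 \<le> 4 * B / D" "4 * B / D \<le> 2" using A0 B0 D0 by (simp_all add: D_def divide_le_eq)
    define a where "a = 32 * n1 * n0\<^sup>2 / \<rho>\<^sup>2"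
    have a0: "0 < a" using n rho by (simp add: a_def)
    have "(4 * B / D)\<^sup>2 / (4 * a) \<le> \<rho>\<^sup>2 / 32"
    proof -
      have "(4 * B / D)\<^sup>2 \<le> 2\<^sup>2" using q by (intro power_mono) auto
      also have "\<dots> \<le> 4 * (n1 * n0\<^sup>2)" using nn by simp
      finally have "(4 * B / D)\<^sup>2 / (4 * a) \<le> 4 * (n1 * n0\<^sup>2) / (4 * a)" using a0 by (intro divide_right_mono) auto
      also have "\<dots> = \<rho>\<^sup>2 / 32" using n rho by (simp add: a_def field_simps)
      finally show ?thesis .
    qed
    then have "- (\<rho>\<^sup>2 / 32) \<le> a * x\<^sup>2 - (4 * B / D) * x" using mult_absorb_square[OF a0, of "4 * B / D" x] by linarith
    moreover have "a * x\<^sup>2 \<le> Q" using Q by (simp add: a_def)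
    ultimately have "S - \<rho>\<^sup>2 / 32 \<le> c0" using c0 Lg by (simp add: mult.commute)
    moreover have "10/11 * (2 + (445/324 + n1 + 2 * n0) * (\<rho>\<^sup>2 / n)) + \<rho>\<^sup>2 / 32 \<le> S"
      unfolding S_def by (rule budget_polynomial[OF n rho refl A B D_def]) simp
    ultimately show ?thesis by linarith
  qed
qed

text \<open>Here \<open>\<kappa> = 9/10\<close> and \<open>c = 20/11\<close>, so
  \<open>455/484\<close> is again \<open>(c\<^sup>2 + c / 4) / 4\<close>. The bound on
  \<open>x\<close> leaves \<open>2 * n1 * \<rho>\<^sup>2 + \<rho>\<close> of the gradient, which
  together with the square root outgrows the linear expression in
  \<open>\<rho>\<^sup>2 / n\<close>.\<close>

lemma budget_large_radius:
  fixes \<rho> n n0 n1 x Lg c0 :: real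
  assumes n: "1 \<le> n" "1 \<le> n0" "1 \<le> n1" and rho: "9/5 \<le> \<rho>" and x: "x \<le> \<rho> / 2"
    and Lg: "2 * (n1 * \<rho>\<^sup>2 + \<rho> - x) * sqrt (n0 * (1 + n1 * \<rho>\<^sup>2 * n0 / n)) \<le> c0"
  shows "10/9 * (2 + (455/484 + n1 + 2 * n0) * (\<rho>\<^sup>2 / n)) \<le> c0"
    and "\<rho> / 2 * (1 + (455/484 + n1 + 2 * n0) * (\<rho>\<^sup>2 / n)) < c0"
proof -
  define e where "e = \<rho>\<^sup>2 / n"
  define s where "s = sqrt e"
  define q where "q = sqrt (n0 * (1 + n1 * \<rho>\<^sup>2 * n0 / n))"
  have e0: "0 \<le> e" "e \<le> \<rho>\<^sup>2" using n by (simp_all add: e_def divide_le_eq mult_le_cancel_left1)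
  have s: "0 \<le> s" "s\<^sup>2 = e" "s \<le> \<rho>"
    using e0 rho by (simp_all add: s_def real_le_lsqrt)
  have q2: "1 + (n0 * s)\<^sup>2 \<le> n0 * (1 + n1 * \<rho>\<^sup>2 * n0 / n)"
  proof -
    have "n0\<^sup>2 * e * 1 \<le> n0\<^sup>2 * e * n1" using n e0 by (intro mult_left_mono) auto
    then have "(n0 * s)\<^sup>2 \<le> n0 * (n1 * \<rho>\<^sup>2 * n0 / n)"
      using s(2) by (simp add: e_def power_mult_distrib power2_eq_square mult_ac)
    then show ?thesis using n by (simp add: distrib_left)
  qed
  have q1: "1 \<le> q" "n0 * s \<le> q"
  proof -
    have "1\<^sup>2 \<le> n0 * (1 + n1 * \<rho>\<^sup>2 * n0 / n)" using q2 zero_le_power2[of "n0 * s"] unfolding power_one by linarith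
    then show "1 \<le> q" unfolding q_def by (rule real_le_rsqrt)
    have "(n0 * s)\<^sup>2 \<le> n0 * (1 + n1 * \<rho>\<^sup>2 * n0 / n)" using q2 by linarith
    then show "n0 * s \<le> q" unfolding q_def by (rule real_le_rsqrt)
  qed
  \<comment> \<open>Cauchy-Schwarz against a vector of length just below 1 replaces the root by a
    linear expression; the split between the coefficients suits the borderline radius.\<close>
  have q3: "48/100 + 87/100 * (n0 * s) \<le> q"
  proof -
    have "(48/100 * 1 + 87/100 * (n0 * s))\<^sup>2 \<le> ((48/100)\<^sup>2 + (87/100)\<^sup>2) * (1\<^sup>2 + (n0 * s)\<^sup>2)"
    proof -
      have "0 \<le> (48/100 * (n0 * s) - 87/100 * 1)\<^sup>2" by simp
      then show ?thesis by (simp add: power2_eq_square algebra_simps)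
    qed
    also have "\<dots> \<le> 1 * (1\<^sup>2 + (n0 * s)\<^sup>2)"
      by (intro mult_right_mono) (auto simp: power2_eq_square)
    finally have "(48/100 + 87/100 * (n0 * s))\<^sup>2 \<le> n0 * (1 + n1 * \<rho>\<^sup>2 * n0 / n)" using q2 by simp
    then show ?thesis unfolding q_def by (rule real_le_rsqrt)
  qed
  have c: "(2 * n1 * \<rho>\<^sup>2 + \<rho>) * q \<le> c0"
  proof -
    have "(2 * n1 * \<rho>\<^sup>2 + \<rho>) * q \<le> 2 * (n1 * \<rho>\<^sup>2 + \<rho> - x) * q"
      using x q1 by (intro mult_right_mono) auto
    then show ?thesis using Lg by (simp add: q_def)
  qed
  have rs: "e \<le> \<rho> * s" using mult_right_mono[OF s(3,1)] s(2) by (simp add: power2_eq_square)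
  have P: "1 \<le> n1 * n0" "n1 \<le> n1 * n0" "n0 \<le> n1 * n0"
    using n mult_mono[of 1 n1 1 n0] by (simp_all add: mult_le_cancel_left1 mult_le_cancel_right1)
  have rho2: "81/25 \<le> \<rho>\<^sup>2" using power_mono[OF rho, of 2] by (simp add: power2_eq_square)
  have "10/9 * (2 + (455/484 + n1 + 2 * n0) * e) \<le> (2 * n1 * \<rho>\<^sup>2 + \<rho>) * (48/100 + 87/100 * (n0 * s))"
  proof -
    have 1: "9/5 * (n1 * n0 * e) \<le> n1 * n0 * (\<rho> * (\<rho> * s))"
    proof -
      have "9/5 * e \<le> \<rho> * (\<rho> * s)" using rs rho e0 by (intro mult_mono) auto
      then have "n1 * n0 * (9/5 * e) \<le> n1 * n0 * (\<rho> * (\<rho> * s))" using n by (intro mult_left_mono) auto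
      then show ?thesis by (simp add: mult_ac)
    qed
    have 2: "n0 * e \<le> n0 * (\<rho> * s)" using rs n by (intro mult_left_mono) auto
    have 3: "n1 * e \<le> n1 * \<rho>\<^sup>2" using e0 n by (intro mult_left_mono) auto
    have 4: "81/25 \<le> n1 * \<rho>\<^sup>2" using rho2 mult_right_mono[OF n(3), of "\<rho>\<^sup>2"] by simp
    have 5: "e \<le> n1 * n0 * e" "n1 * e \<le> n1 * n0 * e" "n0 * e \<le> n1 * n0 * e"
      using P e0 mult_right_mono[OF P(1) e0(1)] mult_right_mono[OF P(2) e0(1)] mult_right_mono[OF P(3) e0(1)] by simp_all
    have lin: "20/9 + 10/9 * (455/484 * e + E + 2 * F) \<le> 96/100 * a + 174/100 * b + 48/100 * \<rho> + 87/100 * c"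
      if "9/5 * P \<le> b" "F \<le> c" "E \<le> a" "81/25 \<le> a" "e \<le> P" "E \<le> P" "F \<le> P" for a b c E F P
      using that rho e0(1) by argo
    have e1: "(2 * n1 * \<rho>\<^sup>2 + \<rho>) * (48/100 + 87/100 * (n0 * s))
       = 96/100 * (n1 * \<rho>\<^sup>2) + 174/100 * (n1 * n0 * (\<rho> * (\<rho> * s))) + 48/100 * \<rho> + 87/100 * (n0 * (\<rho> * s))"
      by (simp add: power2_eq_square field_simps)
    have e2: "10/9 * (2 + (455/484 + n1 + 2 * n0) * e) = 20/9 + 10/9 * (455/484 * e + n1 * e + 2 * (n0 * e))"
      by (simp add: algebra_simps)
    show ?thesis unfolding e1 e2 by (rule lin[OF 1 2 3 4 5])
  qed
  also have "\<dots> \<le> (2 * n1 * \<rho>\<^sup>2 + \<rho>) * q" using q3 n rho by (intro mult_left_mono) auto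
  also note c
  finally show "10/9 * (2 + (455/484 + n1 + 2 * n0) * (\<rho>\<^sup>2 / n)) \<le> c0" by (simp add: e_def)
  have "1/2 * (1 + (455/484 + n1 + 2 * n0) * e) < 2 * (n1 * \<rho>) * q + q"
  proof -
    have "n1 * n0 * e \<le> n1 * n0 * (\<rho> * s)" using rs n by (intro mult_left_mono) auto
    also have "\<dots> = n1 * \<rho> * (n0 * s)" by (simp add: mult_ac)
    also have "\<dots> \<le> n1 * \<rho> * q" using q1 n rho by (intro mult_left_mono) auto
    finally have "n1 * n0 * e \<le> n1 * \<rho> * q" .
    moreover have "e \<le> n1 * n0 * e" "n1 * e \<le> n1 * n0 * e" "n0 * e \<le> n1 * n0 * e"
      using P e0 mult_right_mono[OF P(1) e0(1)] mult_right_mono[OF P(2) e0(1)] mult_right_mono[OF P(3) e0(1)] by simp_all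
    moreover have lin: "1/2 + 1/2 * (455/484 * e + E + 2 * F) < 2 * b + q"
      if "P \<le> b" "e \<le> P" "E \<le> P" "F \<le> P" for b E F P
      using that e0(1) q1(1) by argo
    moreover have e1: "1/2 * (1 + (455/484 + n1 + 2 * n0) * e) = 1/2 + 1/2 * (455/484 * e + n1 * e + 2 * (n0 * e))"
      "2 * (n1 * \<rho>) * q = 2 * (n1 * \<rho> * q)"
      by (simp_all add: algebra_simps)
    ultimately show ?thesis unfolding e1 by blast
  qed
  then have "\<rho> * (1/2 * (1 + (455/484 + n1 + 2 * n0) * e)) < \<rho> * (2 * (n1 * \<rho>) * q + q)"
    using rho by (intro mult_strict_left_mono) auto
  also have "\<dots> = (2 * n1 * \<rho>\<^sup>2 + \<rho>) * q" by (simp add: power2_eq_square algebra_simps)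
  also note c
  finally show "\<rho> / 2 * (1 + (455/484 + n1 + 2 * n0) * (\<rho>\<^sup>2 / n)) < c0" by (simp add: e_def)
qed

subsection \<open>The constants of the run\<close>

text \<open>With \<open>W\<close> and the biases zero, raising all entries of \<open>V\<close>
  changes the smoothed objective only through the penalty. The strict inequality for
  \<open>\<theta>\<close> leaves room for a positive \<open>\<epsilon>\<close> inside the level set,
  and the scale factor \<open>m\<close> is sent to 1.\<close>

lemma penalty_le_lipschitz_const:
  fixes x :: "'N::finite \<Rightarrow> real^'n0::finite"
  assumes Lip: "LH-lipschitz_on ((OmegaTheta x lam1 lam2 \<beta> \<theta> \<inter> (Zset x \<alpha> :: ('n0,'n1::finite,'N) pt set)) \<times> {0<..<1})
      (\<lambda>(w, m). m * Htil x \<beta> w m)"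
    and pr: "0 < lam1" "0 < \<beta>" "0 \<le> \<alpha>" and theta: "frob2 x / real CARD('N) < \<theta>"
  shows "\<beta> \<le> LH"
proof -
  define K where "K = real CARD('N) * real CARD('n1)"
  have K: "1 \<le> K" unfolding K_def using mult_mono[of 1 "real CARD('N)" 1 "real CARD('n1)"] by (simp add: Suc_leI)
  define \<epsilon> where "\<epsilon> = (\<theta> - frob2 x / real CARD('N)) / ((lam1 + \<beta>) * K)"
  have \<epsilon>: "0 < \<epsilon>" "(lam1 + \<beta>) * (K * \<epsilon>) = \<theta> - frob2 x / real CARD('N)"
    using theta pr K by (simp_all add: \<epsilon>_def)
  let ?p = "\<lambda>v. cpt 0 v 0 :: ('n0,'n1,'N) pt"
  have um: "umat (?p v) $ n $ i = 0" and tm: "tmat x (?p v) $ n $ j = 0" and vm: "Vm (?p v) $ n $ j = v" for v n i j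
    by (simp add: umat_cpt) (simp_all add: tmat_nth cpt_def)
  have O: "Oobj x lam1 lam2 \<beta> (?p v) = frob2 x / real CARD('N) + (lam1 + \<beta>) * (K * v)" for v
    unfolding Oobj_def Fobj_eq Robj_eq Pobj_eq esum_def um tm vm
    by (simp add: pos_def frob2_def norm_vec_square K_def cpt_def algebra_simps zero_vec_def[symmetric])
  have H: "Htil x \<beta> (?p v) m = frob2 x / real CARD('N) + \<beta> * (K * v)" if "0 < m" for v m
    unfolding Htil_def Ftil_eq Ptil_eq phi_def um tm vm using that
    by (simp add: pos_def sig1_def frob2_def norm_vec_square K_def)
  have mem: "?p v \<in> OmegaTheta x lam1 lam2 \<beta> \<theta> \<inter> Zset x \<alpha>" if v: "0 \<le> v" "v \<le> \<epsilon>" for v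
  proof -
    have "(lam1 + \<beta>) * (K * v) \<le> (lam1 + \<beta>) * (K * \<epsilon>)" using v pr K by (intro mult_left_mono) auto
    then have "Oobj x lam1 lam2 \<beta> (?p v) \<le> \<theta>" unfolding O \<epsilon>(2) by simp
    moreover have "?p v \<in> Omega2 x" unfolding Omega2_iff tm vm using v by (simp add: pos_def)
    moreover have "?p v \<in> Zset x \<alpha>" unfolding Zset_iff tm vm using v pr by (simp add: pos_def cpt_def)
    ultimately show ?thesis by (simp add: OmegaTheta_def)
  qed
  have nrm: "norm (?p \<epsilon> - ?p 0) \<le> K * \<epsilon>"
  proof -
    have "(norm (?p \<epsilon> - ?p 0))\<^sup>2 = K * \<epsilon>\<^sup>2" unfolding cpt_diff norm_cpt_square by (simp add: K_def)
    also have "\<dots> \<le> K * (K * \<epsilon>\<^sup>2)" using K mult_right_mono[OF K, of "K * \<epsilon>\<^sup>2"] by simp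
    also have "\<dots> = (K * \<epsilon>)\<^sup>2" by (simp add: power2_eq_square)
    finally show ?thesis by (rule power2_le_imp_le) (use K \<epsilon> in auto)
  qed
  show ?thesis
  proof (rule field_le_mult_one_interval)
    fix m :: real assume m: "0 < m" "m < 1"
    have "\<bar>m * Htil x \<beta> (?p \<epsilon>) m - m * Htil x \<beta> (?p 0) m\<bar> \<le> LH * dist (?p \<epsilon>, m) (?p 0, m)"
      using lipschitz_onD[OF Lip, of "(?p \<epsilon>, m)" "(?p 0, m)"] mem[of \<epsilon>] mem[of 0] \<epsilon> m by (simp add: dist_real_def)
    also have "dist (?p \<epsilon>, m) (?p 0, m) = norm (?p \<epsilon> - ?p 0)" by (simp add: dist_Pair_Pair dist_norm)
    also have "LH * norm (?p \<epsilon> - ?p 0) \<le> LH * (K * \<epsilon>)"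
      using nrm lipschitz_on_nonneg[OF Lip] by (intro mult_left_mono)
    finally have "m * \<beta> * (K * \<epsilon>) \<le> LH * (K * \<epsilon>)" using m by (simp add: H algebra_simps)
    moreover have "0 < K * \<epsilon>" using K \<epsilon> by simp
    ultimately show "m * \<beta> \<le> LH" by (simp only: mult_le_cancel_right_pos)
  qed
qed

lemma entry_le_frobenius: "(x n $ i)\<^sup>2 \<le> frob2 x" for x :: "'N::finite \<Rightarrow> real^'n0::finite"
proof -
  have "(x n $ i)\<^sup>2 \<le> (\<Sum>i\<in>UNIV. (x n $ i)\<^sup>2)" by (rule member_le_sum) auto
  also have "\<dots> \<le> frob2 x"
    unfolding frob2_def norm_vec_square
    by (rule member_le_sum[of n UNIV "\<lambda>n. \<Sum>i\<in>UNIV. (x n $ i)\<^sup>2"]) (auto intro: sum_nonneg)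
  finally show ?thesis .
qed

lemma entry_le_norm1: "\<bar>x n $ i\<bar> \<le> norm1 x" for x :: "'N::finite \<Rightarrow> real^'n0::finite"
proof -
  have "\<bar>x n $ i\<bar> \<le> (\<Sum>i\<in>UNIV. \<bar>x n $ i\<bar>)" by (rule member_le_sum) auto
  also have "\<dots> \<le> norm1 x" unfolding norm1_def by (rule Max_ge) auto
  finally show ?thesis .
qed

lemma Robj_le_Oobj:
  assumes "z \<in> Zset x \<alpha>" "0 \<le> \<beta>"
  shows "Robj lam1 lam2 z \<le> Oobj x lam1 lam2 \<beta> z"
proof -
  have "0 \<le> Fobj x z" unfolding Fobj_eq by (intro divide_nonneg_nonneg sum_nonneg) auto
  moreover have "0 \<le> Pobj x \<beta> z"
    unfolding Pobj_eq using assms by (intro mult_nonneg_nonneg sum_nonneg) (auto simp: Zset_iff)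
  ultimately show ?thesis by (simp add: Oobj_def)
qed

text \<open>Turns the hypothesis on the initial parameters into the constants required by
  \<open>spg_run\<close>: \<open>B\<close> is estimated through the radius of the box, and the
  Lipschitz constant is bounded below in the same radius.\<close>

lemma step_budget:
  fixes x :: "'N::finite \<Rightarrow> real^'n0::finite"
  assumes Lip: "LgH-lipschitz_on ({w :: ('n0, 'n1::finite, 'N) pt. infnorm w \<le> max \<alpha> (2 * \<eta>)} \<times> {0<..<1})
      (\<lambda>(w, m). m *\<^sub>R gradHtil x \<beta> w m)"
    and pr: "0 < lam2" "0 \<le> \<beta>" "0 < \<eta>" "0 \<le> \<alpha>"
    and theta: "frob2 x / real CARD('N) \<le> \<theta>"
    and eta: "real CARD('n1) * real CARD('n0) * \<theta> / lam2 \<le> \<eta>\<^sup>2"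
    and X: "\<And>n i. 2 * \<bar>x n $ i\<bar> \<le> \<alpha>"
    and c0: "8 * lam2 + LgH \<le> c0"
  shows "\<exists>c \<kappa> B. 1 \<le> c \<and> \<kappa> = 2 - 2 / c \<and> B = (c\<^sup>2 + c / 4) * \<eta>\<^sup>2 + (real CARD('n1) + 2 * real CARD('n0)) * \<alpha>\<^sup>2
    \<and> 2 + B / real CARD('N) \<le> \<kappa> * c0 \<and> max \<alpha> (2 * \<eta>) / 2 * (1 + B / real CARD('N)) < c0"
proof -
  define \<rho> where "\<rho> = max \<alpha> (2 * \<eta>)"
  define n where "n = real CARD('N)"
  define n0 where "n0 = real CARD('n0)"
  define n1 where "n1 = real CARD('n1)"
  have rho: "0 < \<rho>" "\<alpha> \<le> \<rho>" "2 * \<eta> \<le> \<rho>" using pr by (auto simp: \<rho>_def)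
  have sq: "\<alpha>\<^sup>2 \<le> \<rho>\<^sup>2" "\<eta>\<^sup>2 \<le> \<rho>\<^sup>2 / 4"
    using power_mono[OF rho(2), of 2] power_mono[OF rho(3), of 2] pr by (simp_all add: power_mult_distrib)
  define A where "A = n1 * \<rho>\<^sup>2"
  define Bq where "Bq = n1 * \<rho>\<^sup>2 * n0 / n"
  define u where "u = A + \<rho>"
  interpret gb: gradient_box x \<beta> \<rho> LgH "TYPE('n1)" n n0 n1 A Bq u "1 + A + Bq" "1 + Bq"
    by unfold_locales (use Lip rho pr in \<open>auto simp: \<rho>_def[symmetric] n_def n0_def n1_def A_def Bq_def u_def\<close>)
  note ng = gb.n_ge
  let ?x = "xmean x"
  have xr: "?x \<le> \<rho> / 2"
  proof -
    have "(\<Sum>n\<in>UNIV. \<Sum>i\<in>UNIV. x n $ i) \<le> (\<Sum>n\<in>(UNIV::'N set). \<Sum>i\<in>(UNIV::'n0 set). \<rho> / 2)"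
    proof (intro sum_mono)
      fix n i show "x n $ i \<le> \<rho> / 2" using X[of n i] rho by simp
    qed
    then show ?thesis unfolding xmean_def by (simp add: divide_le_eq mult_ac)
  qed
  \<comment> \<open>The data mean satisfies \<open>n0 * ?x\<^sup>2 \<le> \<theta>\<close>, and
    \<open>n1 * n0 * \<theta>\<close> is at most \<open>lam2 * \<eta>\<^sup>2\<close>, hence at most
    \<open>lam2 * \<rho>\<^sup>2 / 4\<close>. This is how \<open>8 * lam2\<close> becomes the
    compensating square.\<close>
  have Q: "32 * n1 * n0\<^sup>2 * ?x\<^sup>2 / \<rho>\<^sup>2 \<le> 8 * lam2"
  proof -
    have "n0 * ?x\<^sup>2 \<le> \<theta>" using xmean_square[of x] theta by (simp add: n0_def)
    then have "32 * (n1 * n0) * (n0 * ?x\<^sup>2) \<le> 32 * (n1 * n0) * \<theta>" using ng by (intro mult_left_mono) auto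
    also have "\<dots> = 32 * (n1 * n0 * \<theta>)" by simp
    also have "\<dots> \<le> 32 * (lam2 * \<eta>\<^sup>2)"
      using eta pr by (simp add: n0_def n1_def divide_le_eq mult.commute)
    also have "\<dots> \<le> 32 * (lam2 * (\<rho>\<^sup>2 / 4))" using sq pr by (intro mult_left_mono) auto
    finally have "32 * n1 * n0\<^sup>2 * ?x\<^sup>2 \<le> 8 * lam2 * \<rho>\<^sup>2" by (simp add: power2_eq_square mult_ac)
    then show ?thesis using rho by (simp add: divide_le_eq)
  qed
  have Bn: "((c\<^sup>2 + c / 4) * \<eta>\<^sup>2 + (n1 + 2 * n0) * \<alpha>\<^sup>2) / n \<le> ((c\<^sup>2 + c / 4) / 4 + n1 + 2 * n0) * (\<rho>\<^sup>2 / n)" if "0 \<le> c" for c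
  proof -
    have "(c\<^sup>2 + c / 4) * \<eta>\<^sup>2 + (n1 + 2 * n0) * \<alpha>\<^sup>2 \<le> (c\<^sup>2 + c / 4) * (\<rho>\<^sup>2 / 4) + (n1 + 2 * n0) * \<rho>\<^sup>2"
      using sq that ng by (intro add_mono mult_left_mono; simp)
    also have "\<dots> = ((c\<^sup>2 + c / 4) / 4 + n1 + 2 * n0) * \<rho>\<^sup>2"
      by (simp add: field_simps)
    finally have "(c\<^sup>2 + c / 4) * \<eta>\<^sup>2 + (n1 + 2 * n0) * \<alpha>\<^sup>2 \<le> ((c\<^sup>2 + c / 4) / 4 + n1 + 2 * n0) * \<rho>\<^sup>2" .
    then show ?thesis using ng by (simp add: divide_right_mono)
  qed
  show ?thesis
  proof (cases "\<rho> \<le> 9/5")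
    txt \<open>\<open>c = 2 / (2 - \<kappa>)\<close> with \<open>\<kappa> = 11/10\<close> for small and \<open>\<kappa> = 9/10\<close> for large radii. The threshold must not
      exceed \<open>2 / \<kappa> = 20/11\<close> for the second bound to follow from the first, and be large enough for the bound of \<open>lower_gradient\<close> to suffice.\<close>
    case True
    define B where "B = ((20/9)\<^sup>2 + (20/9) / 4) * \<eta>\<^sup>2 + (n1 + 2 * n0) * \<alpha>\<^sup>2"
    have "10/11 * (2 + (445/324 + n1 + 2 * n0) * (\<rho>\<^sup>2 / n)) \<le> c0"
      by (rule budget_small_radius[OF ng _ rho(1) True A_def Q c0])
         (use gb.lower_small gb.lower_large in \<open>auto simp: Bq_def u_def mult_ac\<close>)
    moreover have "B / n \<le> (445/324 + n1 + 2 * n0) * (\<rho>\<^sup>2 / n)"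
      using Bn[of "20/9"] by (simp add: B_def power2_eq_square)
    ultimately obtain q where q: "10/11 * (2 + q) \<le> c0" "B / n \<le> q" by blast
    have "2 + B / n \<le> 2 + q" using q(2) by simp
    also have "\<dots> \<le> 11/10 * c0" using q(1) by (simp add: field_simps)
    finally have kap: "2 + B / n \<le> 11/10 * c0" .
    have "0 \<le> B" using ng by (simp add: B_def)
    then have "0 \<le> B / n" using ng by simp
    have "\<rho> / 2 * (1 + B / n) \<le> 9/10 * (1 + B / n)" using True \<open>0 \<le> B / n\<close> by (intro mult_right_mono) auto
    also have "\<dots> < c0" using kap \<open>0 \<le> B / n\<close> by simp
    finally have "\<rho> / 2 * (1 + B / n) < c0" .
    then show ?thesis using kap
      by (intro exI[of _ "20/9"] exI[of _ "11/10"] exI[of _ B]) (simp add: B_def n_def n0_def n1_def \<rho>_def)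
  next
    case False
    define B where "B = ((20/11)\<^sup>2 + (20/11) / 4) * \<eta>\<^sup>2 + (n1 + 2 * n0) * \<alpha>\<^sup>2"
    have "1 * \<rho>\<^sup>2 \<le> A" unfolding A_def using ng by (intro mult_right_mono) auto
    then have "1 \<le> u" using False zero_le_power2[of \<rho>] unfolding u_def by linarith
    then have "2 * (u - ?x) * sqrt (n0 * (1 + Bq)) \<le> c0" using gb.lower_gradient c0 pr by simp
    then have G: "2 * (n1 * \<rho>\<^sup>2 + \<rho> - ?x) * sqrt (n0 * (1 + n1 * \<rho>\<^sup>2 * n0 / n)) \<le> c0"
      by (simp add: u_def A_def Bq_def)
    have r: "9/5 \<le> \<rho>" using False by simp
    note large = budget_large_radius[OF ng r xr G]
    have Ble: "B / n \<le> (455/484 + n1 + 2 * n0) * (\<rho>\<^sup>2 / n)"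
      using Bn[of "20/11"] by (simp add: B_def power2_eq_square)
    have "2 + B / n \<le> 2 + (455/484 + n1 + 2 * n0) * (\<rho>\<^sup>2 / n)" using Ble by simp
    also have "\<dots> \<le> 9/10 * c0" using large(1) by (simp add: field_simps)
    finally have kap: "2 + B / n \<le> 9/10 * c0" .
    have "\<rho> / 2 * (1 + B / n) \<le> \<rho> / 2 * (1 + (455/484 + n1 + 2 * n0) * (\<rho>\<^sup>2 / n))"
      using Ble rho by (intro mult_left_mono) auto
    also note large(2)
    finally have "\<rho> / 2 * (1 + B / n) < c0" .
    then show ?thesis using kap
      by (intro exI[of _ "20/11"] exI[of _ "9/10"] exI[of _ B]) (simp add: B_def n_def n0_def n1_def \<rho>_def)
  qed
qed

theorem theorem3p2:
  fixes x :: "'N::finite \<Rightarrow> real^'n0::finite"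
    and lam1 lam2 \<beta> \<theta> tau1 tau2 tau3 LH LgH :: real
    and z :: "nat \<Rightarrow> ('n0, 'n1::finite, 'N) pt"
    and \<mu> L :: "nat \<Rightarrow> real"
  defines "N \<equiv> CARD('N)" and "N0 \<equiv> CARD('n0)" and "N1 \<equiv> CARD('n1)"
  defines "N2 \<equiv> N0 * N1 + N1 + N0 + N1 * N"
  defines "\<alpha> \<equiv> alpha_c N N0 N1 lam1 lam2 \<theta> (norm1 x)"
  defines "\<eta> \<equiv> eta_c N0 N1 lam1 lam2 \<theta>"
  defines "Z \<equiv> Zset x \<alpha>"
  defines "Obj \<equiv> Oobj x lam1 lam2 \<beta>"
  assumes params: "lam1 > 0" "lam2 > 0" "\<beta> > 0"
    and theta: "\<theta> > frob2 x / real N"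
    and LH: "LH-lipschitz_on ((OmegaTheta x lam1 lam2 \<beta> \<theta> \<inter> Z) \<times> {0<..<1})
               (\<lambda>(w, m). m * Htil x \<beta> w m)"
    and LgH: "LgH-lipschitz_on ({w :: ('n0, 'n1, 'N) pt. infnorm w \<le> max \<alpha> (2 * \<eta>)} \<times> {0<..<1})
               (\<lambda>(w, m). m *\<^sub>R gradHtil x \<beta> w m)"
    and init: "z 0 \<in> Z" "0 < \<mu> 0" "\<mu> 0 < 1" "0 < tau1" "tau1 < 1" "tau2 > 0" "tau3 \<ge> 1" "L 0 \<ge> 1"
    and step: "\<And>k. z (Suc k) \<in> Z \<and>
       (\<forall>w\<in>Z. inner (gradHtil x \<beta> (z k) (\<mu> k)) (z (Suc k) - z k) + Robj lam1 lam2 (z (Suc k))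
                + L k / 2 * (norm (z (Suc k) - z k))\<^sup>2
              \<le> inner (gradHtil x \<beta> (z k) (\<mu> k)) (w - z k) + Robj lam1 lam2 w
                + L k / 2 * (norm (w - z k))\<^sup>2)"
    and update: "\<And>k. (\<mu> (Suc k), L (Suc k)) =
       (if Otil x lam1 lam2 \<beta> (z (Suc k)) (\<mu> k) - Otil x lam1 lam2 \<beta> (z k) (\<mu> k) < - tau2 * \<mu> k / L k
        then (\<mu> k, L k) else (tau1 * \<mu> k, tau3 * L k))"
    and O0: "Obj (z 0) < \<theta>"
    and tau13: "tau1 * tau3 \<ge> 1"
    and muL0: "\<mu> 0 * L 0 \<ge> max (6 * lam2 * real N1 * real N0
                     + (2 / \<eta>) * (real N2 * LH + lam1 * real N1 * real N))
                   (8 * lam2 + LgH)"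
  shows "bounded (z ` {k. \<mu> (Suc k) = tau1 * \<mu> k})
     \<and> (\<forall>zs r. strict_mono r \<and> (\<forall>j. \<mu> (Suc (r j)) = tau1 * \<mu> (r j)) \<and> (z \<circ> r) \<longlonglongrightarrow> zs
          \<longrightarrow> gen_d_stationary Obj Z zs \<and> (regular_at Obj zs \<longrightarrow> d_stationary Obj Z zs))"
proof -
  have cards: "1 \<le> real N" "1 \<le> real N0" "1 \<le> real N1"
    by (simp_all add: N_def N0_def N1_def Suc_leI)
  have "0 \<le> frob2 x" by (simp add: frob2_def sum_nonneg)
  then have "0 \<le> frob2 x / real N" by simp
  then have th: "0 < \<theta>" using theta by linarith
  have norm1: "0 \<le> norm1 x" using entry_le_norm1[of x] abs_ge_zero order_trans by blast
  have eta: "sqrt (real N1 * real N0 * \<theta> / lam2) \<le> \<eta>" "\<theta> / lam1 \<le> \<eta>"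
    by (simp_all add: \<eta>_def eta_c_def)
  have eta0: "0 < \<eta>" using eta(2) th params divide_pos_pos[of \<theta> lam1] by linarith
  have eta2: "real N1 * real N0 * \<theta> / lam2 \<le> \<eta>\<^sup>2" using eta(1) by (rule sqrt_le_D)
  have eta3: "\<theta> / lam2 \<le> \<eta>\<^sup>2"
  proof -
    have "1 * 1 \<le> real N1 * real N0" using cards by (intro mult_mono) auto
    then have "1 * (\<theta> / lam2) \<le> (real N1 * real N0) * (\<theta> / lam2)" using th params by (intro mult_right_mono) auto
    then show ?thesis using eta2 by simp
  qed
  have alpha: "sqrt (real N * \<theta>) + norm1 x \<le> \<alpha>"
  proof -
    have "0 \<le> \<theta> * sqrt (real N1 * real N0 * \<theta>) / (lam1 * sqrt lam2)" using th params by simp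
    then show ?thesis unfolding \<alpha>_def alpha_c_def by linarith
  qed
  have "0 \<le> sqrt (real N * \<theta>)" using th by simp
  then have alpha0: "0 \<le> \<alpha>" using alpha norm1 by linarith
  \<comment> \<open>The factor 2 arises because \<open>\<alpha>\<close> contains the sum of two
    separate bounds on an entry, one from the Frobenius norm and one from the column sums.\<close>
  have X: "2 * \<bar>x n $ i\<bar> \<le> \<alpha>" for n i
  proof -
    have "(x n $ i)\<^sup>2 \<le> real N * \<theta>"
      using entry_le_frobenius[of x n i] theta cards by (simp add: divide_less_eq mult.commute)
    then have "\<bar>x n $ i\<bar> \<le> sqrt (real N * \<theta>)" by (simp add: real_le_rsqrt)
    then show ?thesis using entry_le_norm1[of x n i] alpha by linarith
  qed
  define c0 where "c0 = \<mu> 0 * L 0"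
  have LHb: "\<beta> \<le> LH"
    using penalty_le_lipschitz_const[OF LH[unfolded Z_def] params(1,3) alpha0] theta by (simp add: N_def)
  have c0_1: "6 * lam2 * real N1 * real N0 + (2 / \<eta>) * (real N2 * LH + lam1 * real N1 * real N) \<le> c0"
    and c0_2: "8 * lam2 + LgH \<le> c0"
    using muL0 by (simp_all add: c0_def)
  have parts: "0 < 6 * lam2 * real N1 * real N0" "0 \<le> lam1 * real N1 * real N"
    using params cards by simp_all
  \<comment> \<open>Each of the four summands of \<open>N2\<close> is at least 1, so
    \<open>N2 * LH\<close> is at least \<open>4 * \<beta>\<close>; the factor
    \<open>2 / \<eta>\<close> doubles this.\<close>
  have c0_3: "8 * \<beta> \<le> \<eta> * c0"
  proof -
    have N2: "4 \<le> real N2"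
    proof -
      have "1 * 1 \<le> real N0 * real N1" "1 * 1 \<le> real N1 * real N" using cards by (intro mult_mono; simp)+
      then show ?thesis using cards by (simp add: N2_def)
    qed
    have "4 * \<beta> \<le> real N2 * LH" using N2 LHb params by (intro mult_mono) auto
    then have "2 / \<eta> * (4 * \<beta>) \<le> 2 / \<eta> * (real N2 * LH + lam1 * real N1 * real N)"
      using parts eta0 by (intro mult_left_mono) auto
    then have "2 / \<eta> * (4 * \<beta>) \<le> c0" using c0_1 parts by linarith
    then show ?thesis using eta0 by (simp add: divide_le_eq mult.commute)
  qed
  have c0_pos: "0 < c0"
  proof -
    have "0 < \<eta> * c0" using c0_3 params by linarith
    then show ?thesis using eta0 by (simp add: zero_less_mult_iff)
  qed
  obtain c \<kappa> B where budget: "1 \<le> c" "\<kappa> = 2 - 2 / c"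
    "B = (c\<^sup>2 + c / 4) * \<eta>\<^sup>2 + (real CARD('n1) + 2 * real CARD('n0)) * \<alpha>\<^sup>2"
    "2 + B / real CARD('N) \<le> \<kappa> * c0" "max \<alpha> (2 * \<eta>) / 2 * (1 + B / real CARD('N)) < c0"
    using step_budget[OF LgH params(2) _ eta0 alpha0 _ _ X c0_2, of \<theta>] params theta eta2
    by (auto simp: N_def N0_def N1_def)
  have VI: "0 \<le> gradHtil x \<beta> (z k) (\<mu> k) \<bullet> (q - z (Suc k)) + DR lam1 lam2 (z (Suc k)) (q - z (Suc k))
      + L k * ((z (Suc k) - z k) \<bullet> (q - z (Suc k)))" if "q \<in> Zset x \<alpha>" for k q
    by (rule prox_VI[OF Zset_convex _ that]) (use step[of k] in \<open>auto simp: Z_def\<close>)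
  have R0: "Robj lam1 lam2 (z 0) \<le> \<theta>"
    using Robj_le_Oobj[of "z 0" x \<alpha> \<beta> lam1 lam2] init(1) O0 params by (simp add: Z_def Obj_def)
  have Xmax: "\<bar>x n $ i\<bar> \<le> max \<alpha> (2 * \<eta>) / 2" for n i
    using X[of n i] by simp
  interpret spg_run x lam1 lam2 \<beta> \<theta> \<alpha> \<eta> c0 tau1 tau2 tau3 c \<kappa> B "max \<alpha> (2 * \<eta>) / 2" z \<mu> L
  proof
    show "frob2 x / real CARD('N) \<le> \<theta>" using theta by (simp add: N_def)
    show "z 0 \<in> Zset x \<alpha>" using init by (simp add: Z_def)
    show "z (Suc k) \<in> Zset x \<alpha>" for k using step[of k] by (simp add: Z_def)
    show "c0 \<le> \<mu> 0 * L 0" by (simp add: c0_def)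
  qed (fact params th eta0 alpha0 eta(2) eta3 init R0 VI update tau13 c0_pos c0_3 budget Xmax)+
  show ?thesis
  proof (intro conjI allI impI)
    show "bounded (z ` {k. \<mu> (Suc k) = tau1 * \<mu> k})"
      by (rule boundedI[of _ "sqrt B"]) (auto simp: norm_z_le)
    fix zs r
    assume r: "strict_mono r \<and> (\<forall>j. \<mu> (Suc (r j)) = tau1 * \<mu> (r j)) \<and> (z \<circ> r) \<longlonglongrightarrow> zs"
    then show "gen_d_stationary Obj Z zs"
      unfolding Obj_def Z_def by (intro limit_stationary) (auto simp: comp_def)
    then show "d_stationary Obj Z zs" if "regular_at Obj zs"
      using that by (rule regular_d_stationary)
  qed
qed

end
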